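(* Let $\sum_{n\ge 0}a_nz^n\in\overline{\mathbb{Q}}[[z]]$ be a $D$-finite power series such that \[ \limsup_{n\to\infty}\frac{h(a_n)}{\log n}=0. \] Then the sequence $(a_n)_{n\in\mathbb{N}}$ is eventually periodic.
   Context: A power series $F(z)\in\overline{\mathbb{Q}}[[z]]$ is $D$-finite if it satisfies a non-trivial homogeneous linear differential equation with coefficients in $\overline{\mathbb{Q}}(z)$. $h(\cdot)$ denotes the absolute logarithmic Weil height on $\overline{\mathbb{Q}}$. *)

theory Defs
  imports
    "HOL-Analysis.Analysis"
    "HOL-Computational_Algebra.Computational_Algebra"
    "HOL-Algebra.Generated_Fields"
    "HOL-Algebra.Ideal_Product"
    "HOL-Algebra.QuotRing"
    "HOL-Algebra.Algebraic_Closure_Type"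
begin

text \<open>
  The field of algebraic numbers is taken to be the algebraic closure of the rationals inside the
  complex numbers, i.e. the set of all \<^term>\<open>x :: complex\<close> with \<^term>\<open>algebraic x\<close>. Number fields are
  subfields of the complex numbers, given by their carrier sets.
\<close>

subsection \<open>D-finite power series\<close>

text \<open>
  The field of rational functions over the algebraic numbers, embedded into the field of formal
  Laurent series, where products of rational functions and power series make sense.
\<close>

definition algebraic_ratfuns :: "complex fls set" where
  "algebraic_ratfuns =
     {fps_to_fls (fps_of_poly p) / fps_to_fls (fps_of_poly q) | p q.
        (\<forall>i. algebraic (Polynomial.coeff p i)) \<and> (\<forall>i. algebraic (Polynomial.coeff q i)) \<and> q \<noteq> 0}"

definition D_finite :: "complex fps \<Rightarrow> bool" where
  "D_finite F \<longleftrightarrow>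
     (\<exists>(r::nat) (c :: nat \<Rightarrow> complex fls).
        (\<forall>i\<le>r. c i \<in> algebraic_ratfuns) \<and> (\<exists>i\<le>r. c i \<noteq> 0) \<and>
        (\<Sum>i\<le>r. c i * (fls_deriv ^^ i) (fps_to_fls F)) = 0)"

subsection \<open>The absolute logarithmic Weil height\<close>

abbreviation complex_ring :: "complex ring" where
  "complex_ring \<equiv> ring_of_type_algebra"

definition field_degree :: "complex set \<Rightarrow> nat" where
  "field_degree K = vector_space.dim (\<lambda>(q::rat) (z::complex). of_rat q * z) K"

definition ring_of_integers :: "complex set \<Rightarrow> complex ring" where
  "ring_of_integers K = complex_ring\<lparr>carrier := {x \<in> K. algebraic_int x}\<rparr>"

text \<open>Extensionality makes distinct elements of this set distinct as maps on \<open>K\<close>.\<close>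

definition field_embeddings :: "complex set \<Rightarrow> (complex \<Rightarrow> complex) set" where
  "field_embeddings K = ring_hom (complex_ring\<lparr>carrier := K\<rparr>) complex_ring \<inter> extensional K"

definition finite_places :: "complex set \<Rightarrow> complex set set" where
  "finite_places K = {P. maximalideal P (ring_of_integers K)}"

text \<open>The exponent of \<open>P\<close> in the factorisation of the principal ideal of a nonzero integer \<open>x\<close> of \<open>K\<close>.\<close>

definition int_ord :: "complex set \<Rightarrow> complex set \<Rightarrow> complex \<Rightarrow> nat" where
  "int_ord K P x = (GREATEST n. x \<in> P [^]\<^bsub>ideals_set (ring_of_integers K)\<^esub> n)"

definition place_ord :: "complex set \<Rightarrow> complex set \<Rightarrow> complex \<Rightarrow> int" where
  "place_ord K P x =
     (THE k. \<exists>a b. a \<in> carrier (ring_of_integers K) - {0} \<and> b \<in> carrier (ring_of_integers K) - {0} \<and>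
        x = a / b \<and> k = int (int_ord K P a) - int (int_ord K P b))"

text \<open>
  The normalised absolute value at \<open>P\<close>, that is, \<open>|x|\<^sub>v\<close> raised to the local degree \<open>[K\<^sub>v : \<rat>\<^sub>p]\<close>
  where \<open>|\<cdot>|\<^sub>v\<close> is the extension of the standard \<open>p\<close>-adic absolute value belonging to \<open>P\<close>.
\<close>

definition place_abs :: "complex set \<Rightarrow> complex set \<Rightarrow> complex \<Rightarrow> real" where
  "place_abs K P x =
     (if x = 0 then 0
      else real (card (carrier (ring_of_integers K Quot P))) powi (- place_ord K P x))"

text \<open>
  \<open>[K : \<rat>]\<inverse> * (\<Sum>\<^sub>v [K\<^sub>v : \<rat>\<^sub>v] log max(1, |x|\<^sub>v))\<close>, summed over all places \<open>v\<close> of the number field \<open>K\<close>.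
  The archimedean places weighted by their local degrees are the embeddings of \<open>K\<close> into the complex
  numbers: one for each real place, and two for each complex place.
  The second sum has only finitely many nonzero terms.
\<close>

definition weil_height_over :: "complex set \<Rightarrow> complex \<Rightarrow> real" where
  "weil_height_over K x =
     ((\<Sum>\<sigma>\<in>field_embeddings K. ln (max 1 (cmod (\<sigma> x)))) +
      (\<Sum>\<^sub>\<infinity>P\<in>finite_places K. ln (max 1 (place_abs K P x)))) / real (field_degree K)"

text \<open>
  The value does not depend on the number field containing \<open>x\<close>, so it is computed in the smallest one.
\<close>

definition weil_height :: "complex \<Rightarrow> real" where
  "weil_height x = weil_height_over (generate_field complex_ring {x}) x"

subsection \<open>Eventual periodicity\<close>

definition eventually_periodic :: "(nat \<Rightarrow> 'a) \<Rightarrow> bool" where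
  "eventually_periodic a \<longleftrightarrow> (\<exists>N p. p > 0 \<and> (\<forall>n\<ge>N. a (n + p) = a n))"

end

theory Submission
  imports Defs "Jordan_Normal_Form.Char_Poly"
begin

text \<open>
  The coefficients satisfy \<open>\<Sum>\<^sub>l q\<^sub>l(n) a\<^sub>n\<^sub>+\<^sub>l = 0\<close> for polynomials \<open>q\<^sub>0, \<dots>, q\<^sub>L\<close> with algebraic coefficients, hence
  they all lie in one number field. By a Northcott-type bound the number of elements of height at
  most \<open>H\<close> in that field is at most exponential in \<open>H\<close>, so the terms \<open>a\<^sub>n\<close> with \<open>N \<le> n \<le> 3 N\<close> take at
  most \<open>N\<^sup>\<epsilon>\<close> values, and there are few windows \<open>w = (a\<^sub>n, \<dots>, a\<^sub>n\<^sub>+\<^sub>L)\<close>. If the polynomial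
  \<open>\<Sum>\<^sub>l w\<^sub>l q\<^sub>l\<close> of a window does not vanish identically, then \<open>n\<close> is one of its few roots. So there is
  a long interval on which the window polynomials all vanish, and on it some window occurs twice. The
  periodic extension of the block between the two occurrences satisfies the recurrence with
  arbitrary values substituted for \<open>n\<close>, and therefore agrees with the sequence from there on.

  For the Northcott bound, the finite places of \<open>\<rat>(x)\<close> provide a denominator \<open>c\<close> of \<open>x\<close> with
  \<open>log c\<close> bounded by the finite part of the height, the embeddings bound the conjugates of \<open>x\<close>, and
  \<open>c x\<close> is a root of a monic integer polynomial with bounded degree and coefficients.
\<close>

section \<open>Algebraic integers\<close>

text \<open>The height is given through places of Q(x), with orders defined by
  \<open>GREATEST\<close> and \<open>THE\<close> over powers of maximal ideals, so it says nothing
  before these orders are known to be finite and additive. The valuation theory serves one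
  inequality: the height bounds a denominator from above. What carries it is the finiteness of
  \<open>OK\<close> modulo a positive integer, mostly through pigeonhole on the powers of one
  element. In the counting part a repeated window does not suffice by itself, because the
  coefficients of the recurrence change with the index; this is why polynomials are attached to
  windows. The pigeonhole argument needs an interval of length quadratic in the number of windows,
  and there are up to (number of values)^(L+1) of these. So the growth hypothesis is applied with an
  \<epsilon> depending on L and on the number field: along \<open>N = t ^ (4 * Suc L)\<close> only a
  constant multiple of \<open>t\<close> values occur, and the square of the number of windows has
  order \<open>t ^ (2 * Suc L)\<close>, well below \<open>N\<close>.\<close>

interpretation Z: Modules.module "\<lambda>(k::int) (z::complex). of_int k * z"
  by unfold_locales (simp_all add: algebra_simps)

text \<open>The scaling is written as in \<open>field_degree\<close>, so that \<open>Q.dim\<close>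
  is the degree of a number field.\<close>

interpretation Q: vector_space "\<lambda>(q::rat) (z::complex). of_rat q * z"
  by unfold_locales (simp_all add: algebra_simps of_rat_add of_rat_mult)

text \<open>Determinant trick: the nonzero vector \<open>v\<close> is an eigenvector of the integer
  matrix \<open>c\<close>, so \<open>z\<close> is a root of its characteristic polynomial, which is
  monic with integer coefficients.\<close>

lemma algebraic_int_if_eigenvalue:
  fixes z :: complex and v :: "nat \<Rightarrow> complex" and c :: "nat \<Rightarrow> nat \<Rightarrow> int"
  assumes eq: "\<And>i. i < n \<Longrightarrow> z * v i = (\<Sum>j<n. of_int (c i j) * v j)"
    and k: "k < n" "v k \<noteq> 0"
  shows "algebraic_int z"
proof -
  define A where "A = mat n n (\<lambda>(i,j). c i j)"
  define B :: "complex mat" where "B = map_mat of_int A"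
  have A: "A \<in> carrier_mat n n" by (simp add: A_def)
  have B: "B \<in> carrier_mat n n" by (simp add: B_def A)
  have "eigenvector B (vec n v) z"
    unfolding eigenvector_def
  proof (intro conjI)
    show "vec n v \<in> carrier_vec (dim_row B)" using B by simp
    show "vec n v \<noteq> 0\<^sub>v (dim_row B)" using k B
      by (metis carrier_matD(1) index_vec index_zero_vec(1))
    show "B *\<^sub>v vec n v = z \<cdot>\<^sub>v vec n v"
      by (rule eq_vecI)
        (auto simp: B_def A_def scalar_prod_def eq atLeast0LessThan)
  qed
  hence "eigenvalue B z" by (auto simp: eigenvalue_def)
  hence root: "poly (char_poly B) z = 0" using eigenvalue_root_char_poly[OF B] by simp
  have hom: "char_poly B = map_poly of_int (char_poly A)"
    unfolding B_def by (rule of_int_hom.char_poly_hom[OF A])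
  show ?thesis
    unfolding algebraic_int_altdef_ipoly
    using root hom degree_monic_char_poly[OF A] by auto
qed

text \<open>Generators of a module stable under multiplication by \<open>z\<close> supply the
  integer matrix; a generator different from 0 keeps the eigenvector from vanishing.\<close>

lemma algebraic_int_if_span:
  fixes z :: complex
  assumes S: "finite S" "S - {0} \<noteq> {}" and z: "\<And>s. s \<in> S \<Longrightarrow> z * s \<in> Z.span S"
  shows "algebraic_int z"
proof -
  obtain v where v: "bij_betw v {..<card S} S"
    using S(1) ex_bij_betw_nat_finite lessThan_atLeast0 by metis
  have "\<exists>u. z * v i = (\<Sum>s\<in>S. of_int (u s) * s)" if "i < card S" for i
    using z[of "v i"] v that unfolding Z.span_finite[OF S(1)] bij_betw_def by auto
  then obtain u where u: "\<And>i. i < card S \<Longrightarrow> z * v i = (\<Sum>s\<in>S. of_int (u i s) * s)"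
    by metis
  have "z * v i = (\<Sum>j<card S. of_int (u i (v j)) * v j)" if "i < card S" for i
    unfolding u[OF that] by (rule sum.reindex_bij_betw[OF v, symmetric])
  moreover obtain s where "s \<in> S" "s \<noteq> 0"
    using S(2) by auto
  moreover from this obtain k where "k < card S" "v k = s"
    using bij_betw_imp_surj_on[OF v] by (metis imageE lessThan_iff)
  ultimately show ?thesis
    by (intro algebraic_int_if_eigenvalue[of "card S" z v]) auto
qed

lemma algebraic_int_power_in_span:
  fixes x :: complex
  assumes "algebraic_int x"
  obtains m where "m > 0" "x ^ m \<in> Z.span ((\<lambda>i. x ^ i) ` {..<m})"
proof -
  obtain p where p: "poly (map_poly of_int p) x = 0" "Polynomial.lead_coeff p = 1"
    using assms unfolding algebraic_int_altdef_ipoly by auto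
  define m where "m = Polynomial.degree p"
  have "m > 0"
    using p by (auto simp: m_def elim!: degree_eq_zeroE intro!: Nat.gr0I)
  have "0 = (\<Sum>i\<le>m. of_int (Polynomial.coeff p i) * x ^ i)"
    using p(1) by (simp add: poly_altdef m_def degree_map_poly)
  also have "\<dots> = x ^ m + (\<Sum>i<m. of_int (Polynomial.coeff p i) * x ^ i)"
    using p(2) by (simp add: m_def flip: lessThan_Suc_atMost)
  finally have "x ^ m = (\<Sum>i<m. of_int (- Polynomial.coeff p i) * x ^ i)"
    by (simp add: sum_negf eq_neg_iff_add_eq_0)
  also have "\<dots> \<in> Z.span ((\<lambda>i. x ^ i) ` {..<m})"
    by (intro Z.span_sum Z.span_scale Z.span_base) auto
  finally show ?thesis using that \<open>m > 0\<close> by blast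
qed

lemma span_times:
  fixes z t :: complex
  assumes "\<And>s. s \<in> S \<Longrightarrow> z * s \<in> Z.span T" "t \<in> Z.span S"
  shows "z * t \<in> Z.span T"
  using assms(2)
proof (induction t rule: Z.span_induct_alt)
  case base
  then show ?case by (simp add: Z.span_zero)
next
  case (step c x y)
  have "z * (of_int c * x + y) = of_int c * (z * x) + z * y" by (simp add: algebra_simps)
  then show ?case using assms(1) step by (simp add: Z.span_add Z.span_scale)
qed

text \<open>The monomials \<open>x ^ i * y ^ j\<close> below both degrees generate Z[x, y]. One
  module stable under both numbers gives closure of the algebraic integers under sums and products
  at once.\<close>

lemma algebraic_int_common_span:
  fixes x y :: complex
  assumes "algebraic_int x" "algebraic_int y"
  obtains S where "finite S" "1 \<in> S" "\<And>s. s \<in> S \<Longrightarrow> x * s \<in> Z.span S" "\<And>s. s \<in> S \<Longrightarrow> y * s \<in> Z.span S"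
proof -
  obtain m where m: "m > 0" "x ^ m \<in> Z.span ((\<lambda>i. x ^ i) ` {..<m})"
    using algebraic_int_power_in_span[OF assms(1)] .
  obtain n where n: "n > 0" "y ^ n \<in> Z.span ((\<lambda>i. y ^ i) ` {..<n})"
    using algebraic_int_power_in_span[OF assms(2)] .
  define S where "S = (\<lambda>(i,j). x ^ i * y ^ j) ` ({..<m} \<times> {..<n})"
  have in_S: "x ^ i * y ^ j \<in> Z.span S" if "i < m" "j < n" for i j
    using that by (intro Z.span_base) (auto simp: S_def)
  show ?thesis
  proof
    show "finite S" by (simp add: S_def)
    show "1 \<in> S" using m(1) n(1) by (force simp: S_def)
  next
    fix s assume "s \<in> S"
    then obtain i j where ij: "s = x ^ i * y ^ j" "i < m" "j < n" by (auto simp: S_def)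
    show "x * s \<in> Z.span S"
    proof (cases "Suc i < m")
      case True
      then show ?thesis using in_S[of "Suc i" j] ij by (simp add: mult_ac)
    next
      case False
      hence "Suc i = m" using ij by simp
      hence "x * s = y ^ j * x ^ m" using ij by auto
      also have "\<dots> \<in> Z.span S"
        by (rule span_times[OF _ m(2)]) (use in_S ij in \<open>auto simp: mult.commute\<close>)
      finally show ?thesis .
    qed
    show "y * s \<in> Z.span S"
    proof (cases "Suc j < n")
      case True
      then show ?thesis using in_S[of i "Suc j"] ij by (simp add: mult_ac)
    next
      case False
      hence "Suc j = n" using ij by simp
      hence "y * s = x ^ i * y ^ n" using ij by auto
      also have "\<dots> \<in> Z.span S"
        by (rule span_times[OF _ n(2)]) (use in_S ij in auto)
      finally show ?thesis .
    qed
  qed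
qed

lemma algebraic_int_add [intro]:
  fixes x y :: complex
  assumes "algebraic_int x" "algebraic_int y"
  shows "algebraic_int (x + y)"
proof -
  obtain S where S: "finite S" "1 \<in> S" "\<And>s. s \<in> S \<Longrightarrow> x * s \<in> Z.span S" "\<And>s. s \<in> S \<Longrightarrow> y * s \<in> Z.span S"
    using algebraic_int_common_span[OF assms] by blast
  show ?thesis
    by (rule algebraic_int_if_span[OF S(1)]) (use S in \<open>auto simp: distrib_right Z.span_add\<close>)
qed

lemma algebraic_int_mult [intro]:
  fixes x y :: complex
  assumes "algebraic_int x" "algebraic_int y"
  shows "algebraic_int (x * y)"
proof -
  obtain S where S: "finite S" "1 \<in> S" "\<And>s. s \<in> S \<Longrightarrow> x * s \<in> Z.span S" "\<And>s. s \<in> S \<Longrightarrow> y * s \<in> Z.span S"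
    using algebraic_int_common_span[OF assms] by blast
  have "x * y * s \<in> Z.span S" if "s \<in> S" for s
    unfolding mult.assoc by (rule span_times[OF S(3) S(4)[OF that]])
  thus ?thesis
    by (intro algebraic_int_if_span[OF S(1)]) (use S in auto)
qed

lemma algebraic_int_diff [intro]:
  fixes x y :: complex
  assumes "algebraic_int x" "algebraic_int y"
  shows "algebraic_int (x - y)"
  using algebraic_int_add[of x "- y"] assms by simp

lemma algebraic_int_power [intro]: "algebraic_int (x::complex) \<Longrightarrow> algebraic_int (x ^ n)"
  by (induction n) auto

lemma algebraic_int_multiple:
  fixes y :: complex
  assumes "algebraic y"
  obtains c :: nat where "c > 0" "algebraic_int (of_nat c * y)"
proof -
  obtain p where p: "\<And>i. Polynomial.coeff p i \<in> \<int>" "p \<noteq> 0" "poly p y = 0"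
    using assms unfolding algebraic_def by auto
  define n where "n = Polynomial.degree p"
  define l where "l = Polynomial.lead_coeff p"
  have n: "n > 0" using p(2,3) by (auto simp: n_def elim!: degree_eq_zeroE intro!: Nat.gr0I)
  \<comment> \<open>This is \<open>l ^ (n - 1)\<close> times p(X / l), which is monic; its value at
    \<open>l * y\<close> is \<open>l ^ (n - 1) * poly p y\<close>.\<close>
  define q where "q = (\<Sum>i<n. Polynomial.monom (Polynomial.coeff p i * l ^ (n - 1 - i)) i) + Polynomial.monom 1 n"
  have coeff_q: "Polynomial.coeff q i = (if i < n then Polynomial.coeff p i * l ^ (n - 1 - i) else if i = n then 1 else 0)" for i
    by (auto simp: q_def Polynomial.coeff_sum)
  have "Polynomial.degree q = n"
    by (rule antisym[OF degree_le le_degree]) (auto simp: coeff_q)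
  hence lead: "Polynomial.lead_coeff q = 1" by (simp add: coeff_q)
  have l: "l \<in> \<int>" "l \<noteq> 0" using p by (auto simp: l_def)
  have "poly q (l * y) = (\<Sum>i<n. Polynomial.coeff p i * l ^ (n - 1 - i) * (l * y) ^ i) + (l * y) ^ n"
    by (simp add: q_def poly_sum poly_monom)
  also have "(\<Sum>i<n. Polynomial.coeff p i * l ^ (n - 1 - i) * (l * y) ^ i) = (\<Sum>i<n. l ^ (n - 1) * (Polynomial.coeff p i * y ^ i))"
  proof (rule sum.cong, goal_cases)
    case (2 i)
    hence "l ^ (n - 1) = l ^ (n - 1 - i) * l ^ i" by (simp flip: power_add)
    then show ?case by (simp add: power_mult_distrib)
  qed auto
  also have "(l * y) ^ n = l ^ (n - 1) * (Polynomial.coeff p n * y ^ n)"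
  proof -
    have "l ^ n = l ^ (n - 1) * l" using n by (metis power_minus_mult)
    thus ?thesis by (simp add: power_mult_distrib l_def n_def)
  qed
  also have "(\<Sum>i<n. l ^ (n - 1) * (Polynomial.coeff p i * y ^ i)) + \<dots> = l ^ (n - 1) * poly p y"
    unfolding poly_altdef n_def[symmetric] lessThan_Suc_atMost[symmetric]
    by (simp add: sum_distrib_left distrib_left)
  finally have root: "poly q (l * y) = 0" using p(3) by simp
  have "algebraic_int (l * y)"
    by (rule algebraic_int.intros[OF lead _ root]) (use p(1) l in \<open>auto simp: coeff_q\<close>)
  moreover obtain k where k: "l = of_int k" using l(1) by (auto elim: Ints_cases)
  ultimately have "algebraic_int (of_nat (nat \<bar>k\<bar>) * y)"
    by (cases "k \<ge> 0") auto
  moreover have "nat \<bar>k\<bar> > 0" using k l by auto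
  ultimately show ?thesis using that by blast
qed

section \<open>Finiteness of residue rings of number fields\<close>

lemma rat_dependence:
  fixes f :: "nat \<Rightarrow> complex"
  assumes B: "finite B" "card B \<le> n" and f: "\<And>i. i \<le> n \<Longrightarrow> f i \<in> Q.span B"
  obtains u :: "nat \<Rightarrow> rat" where "\<exists>i\<le>n. u i \<noteq> 0" "(\<Sum>i\<le>n. of_rat (u i) * f i) = 0"
proof (cases "inj_on f {..n}")
  case True
  have "Q.dependent (f ` {..n})"
  proof (rule ccontr)
    assume "\<not> Q.dependent (f ` {..n})"
    hence "card (f ` {..n}) \<le> card B"
      using Q.independent_span_bound[OF B(1)] f by blast
    thus False using True B(2) by (simp add: card_image)
  qed
  then obtain u where u: "\<exists>v\<in>f ` {..n}. u v \<noteq> 0" "(\<Sum>v\<in>f ` {..n}. of_rat (u v) * v) = 0"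
    using Q.dependent_finite by blast
  show ?thesis
    using u True by (intro that[of "u \<circ> f"]) (auto simp: sum.reindex)
next
  case False
  \<comment> \<open>\<open>Q.dependent\<close> speaks of sets, so a repeated value of
    \<open>f\<close> has to provide its own relation, with coefficients 1 and -1.\<close>
  then obtain i j where ij: "i \<le> n" "j \<le> n" "i \<noteq> j" "f i = f j" by (auto simp: inj_on_def)
  define u :: "nat \<Rightarrow> rat" where "u = (\<lambda>k. if k = i then 1 else if k = j then -1 else 0)"
  have "(\<Sum>k\<le>n. of_rat (u k) * f k) = (\<Sum>k\<in>{i,j}. of_rat (u k) * f k)"
    using ij by (intro sum.mono_neutral_right) (auto simp: u_def)
  also have "\<dots> = 0" using ij by (simp add: u_def)
  finally show ?thesis using ij(1) by (intro that[of u]) (auto simp: u_def)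
qed

text \<open>Cleared of denominators and divided by their gcd, the coefficients of a rational
  relation cannot all be divisible by a non-unit. So independence modulo \<open>p\<close> is limited
  by the rational dimension.\<close>

lemma int_dependence_mod:
  fixes f :: "nat \<Rightarrow> complex" and p :: int
  assumes B: "finite B" "card B \<le> n" and f: "\<And>i. i \<le> n \<Longrightarrow> f i \<in> Q.span B" and p: "\<not> is_unit p"
  obtains w :: "nat \<Rightarrow> int" where "\<exists>i\<le>n. \<not> p dvd w i" "(\<Sum>i\<le>n. of_int (w i) * f i) = 0"
proof -
  obtain u where u: "\<exists>i\<le>n. u i \<noteq> 0" "(\<Sum>i\<le>n. of_rat (u i) * f i) = 0"
    by (rule rat_dependence[OF B f])
  define num den where "num = (\<lambda>i. fst (quotient_of (u i)))" and "den = (\<lambda>i. snd (quotient_of (u i)))"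
  have den: "den i > 0" for i by (simp add: den_def quotient_of_denom_pos')
  have u_eq: "u i = of_int (num i) / of_int (den i)" for i
    by (simp add: num_def den_def quotient_of_div)
  define D where "D = (\<Prod>i\<le>n. den i)"
  have D: "D > 0" using den by (simp add: D_def prod_pos)
  define w where "w = (\<lambda>i. num i * (D div den i))"
  have w: "(of_int (w i) :: complex) = of_int D * of_rat (u i)" if "i \<le> n" for i
  proof -
    have "den i dvd D" unfolding D_def using that by (intro dvd_prodI) auto
    thus ?thesis using den[of i]
      by (auto simp: w_def u_eq of_rat_divide dvd_def)
  qed
  have w_sum: "(\<Sum>i\<le>n. of_int (w i) * f i) = 0"
  proof -
    have "(\<Sum>i\<le>n. of_int (w i) * f i) = of_int D * (\<Sum>i\<le>n. of_rat (u i) * f i)"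
      unfolding sum_distrib_left by (intro sum.cong) (auto simp: w)
    thus ?thesis using u(2) by simp
  qed
  obtain k where k: "k \<le> n" "w k \<noteq> 0"
    using u(1) w D by (metis mult_eq_0_iff of_int_0_eq_iff of_int_0 of_rat_eq_0_iff less_irrefl)
  define g where "g = Gcd (w ` {..n})"
  have g: "g \<noteq> 0" using k by (auto simp: g_def)
  have gw: "g dvd w i" if "i \<le> n" for i using that by (auto simp: g_def)
  show ?thesis
  proof (rule that[of "\<lambda>i. w i div g"])
    show "\<exists>i\<le>n. \<not> p dvd w i div g"
    proof (rule ccontr)
      assume "\<not> ?thesis"
      hence "p * g dvd w i" if "i \<le> n" for i
        using that gw[OF that] by (metis dvd_div_mult_self mult_dvd_mono dvd_refl)
      hence "p * g dvd g" unfolding g_def by (intro Gcd_greatest) auto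
      thus False using p g by simp
    qed
    have "of_int g * (\<Sum>i\<le>n. of_int (w i div g) * f i) = (\<Sum>i\<le>n. of_int (w i) * f i)"
      unfolding sum_distrib_left
    proof (rule sum.cong)
      fix i assume "i \<in> {..n}"
      hence "w i = g * (w i div g)" using gw by simp
      thus "of_int g * (of_int (w i div g) * f i) = of_int (w i) * f i"
        by (metis mult.assoc of_int_mult)
    qed simp
    thus "(\<Sum>i\<le>n. of_int (w i div g) * f i) = 0" using w_sum g by simp
  qed
qed

text \<open>Number fields are handled through their carriers: closure under difference, product and
  \<open>inverse\<close> (with \<open>inverse 0 = 0\<close>) makes a subfield, and finite degree is
  stated as containment in the span of a finite set, which passes directly to subfields.\<close>

locale number_field =
  fixes K :: "complex set"
  assumes one_in: "1 \<in> K"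
    and diff_in: "x \<in> K \<Longrightarrow> y \<in> K \<Longrightarrow> x - y \<in> K"
    and mult_in: "x \<in> K \<Longrightarrow> y \<in> K \<Longrightarrow> x * y \<in> K"
    and inverse_in: "x \<in> K \<Longrightarrow> inverse x \<in> K"
    and finite_dim: "\<exists>B. finite B \<and> K \<subseteq> Q.span B"
begin

lemma zero_in: "0 \<in> K" using diff_in[OF one_in one_in] by simp
lemma minus_in: "x \<in> K \<Longrightarrow> - x \<in> K" using diff_in[OF zero_in] by simp
lemma add_in: "x \<in> K \<Longrightarrow> y \<in> K \<Longrightarrow> x + y \<in> K" using diff_in[OF _ minus_in] by simp
lemma divide_in: "x \<in> K \<Longrightarrow> y \<in> K \<Longrightarrow> x / y \<in> K" by (simp add: mult_in inverse_in divide_inverse)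
lemma of_nat_in: "of_nat n \<in> K" by (induction n) (auto intro: zero_in one_in add_in)
lemma of_int_in: "of_int n \<in> K"
  by (cases n) (simp_all add: of_nat_in del: of_nat_Suc, metis minus_in of_nat_in of_int_of_nat_eq of_int_minus)
lemma sum_in: "(\<And>i. i \<in> A \<Longrightarrow> f i \<in> K) \<Longrightarrow> sum f A \<in> K"
  by (induction A rule: infinite_finite_induct) (auto intro: zero_in add_in)
lemma power_in: "x \<in> K \<Longrightarrow> x ^ n \<in> K" by (induction n) (auto intro: one_in mult_in)

lemma algebraic_in:
  assumes z: "z \<in> K"
  shows "algebraic z"
proof -
  obtain B where B: "finite B" "K \<subseteq> Q.span B" using finite_dim by blast
  obtain u where u: "\<exists>i\<le>card B. u i \<noteq> 0" "(\<Sum>i\<le>card B. of_rat (u i) * z ^ i) = 0"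
    by (rule rat_dependence[OF B(1) order_refl, of "\<lambda>i. z ^ i"]) (use power_in[OF z] B(2) in blast)+
  define q where "q = (\<Sum>i\<le>card B. Polynomial.monom (of_rat (u i) :: complex) i)"
  have coeff: "Polynomial.coeff q i = (if i \<le> card B then of_rat (u i) else 0)" for i
    by (auto simp: q_def Polynomial.coeff_sum)
  show ?thesis
  proof (rule algebraicI')
    show "Polynomial.coeff q i \<in> \<rat>" for i by (simp add: coeff)
    show "q \<noteq> 0" using u(1) by (metis coeff Polynomial.coeff_0 of_rat_eq_0_iff)
    show "poly q z = 0" using u(2) by (simp add: q_def poly_sum poly_monom)
  qed
qed

definition OK :: "complex set" where "OK = {x \<in> K. algebraic_int x}"

lemma OK_K: "x \<in> OK \<Longrightarrow> x \<in> K" by (simp add: OK_def)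
lemma OK_0: "0 \<in> OK" by (simp add: OK_def zero_in)
lemma OK_1: "1 \<in> OK" by (auto simp: OK_def one_in)
lemma OK_diff: "x \<in> OK \<Longrightarrow> y \<in> OK \<Longrightarrow> x - y \<in> OK" by (auto simp: OK_def diff_in)
lemma OK_add: "x \<in> OK \<Longrightarrow> y \<in> OK \<Longrightarrow> x + y \<in> OK" by (auto simp: OK_def add_in)
lemma OK_minus: "x \<in> OK \<Longrightarrow> - x \<in> OK" by (auto simp: OK_def minus_in)
lemma OK_mult: "x \<in> OK \<Longrightarrow> y \<in> OK \<Longrightarrow> x * y \<in> OK" by (auto simp: OK_def mult_in)
lemma OK_power: "x \<in> OK \<Longrightarrow> x ^ n \<in> OK" by (auto simp: OK_def power_in)
lemma OK_of_nat: "of_nat n \<in> OK" by (auto simp: OK_def of_nat_in)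
lemma OK_of_int: "of_int n \<in> OK" by (auto simp: OK_def of_int_in)
lemma OK_sum: "(\<And>i. i \<in> A \<Longrightarrow> f i \<in> OK) \<Longrightarrow> sum f A \<in> OK"
  by (induction A rule: infinite_finite_induct) (auto intro: OK_0 OK_add)

lemmas OK_intros = OK_0 OK_1 OK_diff OK_add OK_minus OK_mult OK_power OK_of_nat OK_of_int OK_sum

lemma K_multiple_in_OK:
  assumes "x \<in> K"
  obtains c :: nat where "c > 0" "of_nat c * x \<in> OK"
  using algebraic_int_multiple[OF algebraic_in[OF assms]] mult_in[OF of_nat_in assms] OK_def by auto

text \<open>An integral multiple of the inverse of \<open>a\<close> is the cofactor. Questions about
  ideals thereby reduce to residues modulo positive integers.\<close>

lemma OK_dvd_nat:
  assumes "a \<in> OK" "a \<noteq> 0"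
  obtains c :: nat and b where "c > 0" "b \<in> OK" "of_nat c = a * b"
proof -
  obtain c :: nat where c: "c > 0" "of_nat c * inverse a \<in> OK"
    using K_multiple_in_OK[OF inverse_in[OF OK_K[OF assms(1)]]] .
  show ?thesis using that[OF c] assms by simp
qed

text \<open>\<open>OK\<close> modulo \<open>p\<close> is a vector space over the field with
  \<open>p\<close> elements, of dimension at most \<open>card B\<close>: a longer family has, by
  \<open>int_dependence_mod\<close>, a relation that is nontrivial modulo \<open>p\<close>. The set
  \<open>T\<close> consists of the combinations of a maximal independent family with digits below
  \<open>p\<close>.\<close>

lemma finite_index_prime:
  fixes p :: nat
  assumes p: "Factorial_Ring.prime p"
  shows "\<exists>T. finite T \<and> T \<subseteq> OK \<and> (\<forall>r\<in>OK. \<exists>t\<in>T. \<exists>s\<in>OK. r = t + of_nat p * s)"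
proof -
  obtain B where B: "finite B" "K \<subseteq> Q.span B" using finite_dim by blast
  \<comment> \<open>\<open>ind m f\<close> is linear independence of
    \<open>f 0, ..., f (m - 1)\<close> modulo \<open>p\<close> times \<open>OK\<close>.\<close>
  define ind where "ind = (\<lambda>m f. (\<forall>i<m. f i \<in> OK) \<and>
     (\<forall>w::nat\<Rightarrow>int. (\<exists>s\<in>OK. (\<Sum>i<m. of_int (w i) * f i) = of_nat p * s) \<longrightarrow> (\<forall>i<m. int p dvd w i)))"
  have bound: "m \<le> card B" if "ind m f" for m f
  proof (rule ccontr)
    assume "\<not> m \<le> card B"
    then obtain n where n: "m = Suc n" "card B \<le> n" by (cases m) auto
    have f: "f i \<in> Q.span B" if "i \<le> n" for i
      using \<open>ind m f\<close> that n(1) B(2) OK_K by (auto simp: ind_def)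
    have unit: "\<not> is_unit (int p)" using prime_gt_1_nat[OF p] by auto
    obtain w where w: "\<exists>i\<le>n. \<not> int p dvd w i" "(\<Sum>i\<le>n. of_int (w i) * f i) = 0"
      by (rule int_dependence_mod[OF B(1) n(2) f unit])
    have "\<exists>s\<in>OK. (\<Sum>i<m. of_int (w i) * f i) = of_nat p * s"
      using w(2) OK_0 by (auto simp: n lessThan_Suc_atMost intro!: bexI[of _ 0])
    hence "\<forall>i<m. int p dvd w i" using \<open>ind m f\<close> unfolding ind_def by blast
    thus False using w(1) n(1) by auto
  qed
  have "ind 0 (\<lambda>_. 0)" by (simp add: ind_def)
  hence "\<exists>f. ind 0 f" by blast
  then obtain m where m: "\<exists>f. ind m f" "\<And>k. \<exists>f. ind k f \<Longrightarrow> k \<le> m"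
    using ex_has_greatest_nat[of "\<lambda>m. \<exists>f. ind m f" 0 "\<lambda>m. m" "Suc (card B)"] bound
    by (metis le_imp_less_Suc)
  then obtain f where f: "ind m f" by blast
  define T where "T = (\<lambda>c. \<Sum>i<m. of_nat (c i) * f i) ` ({..<m} \<rightarrow>\<^sub>E {..<p})"
  have "\<exists>t\<in>T. \<exists>s\<in>OK. r = t + of_nat p * s" if r: "r \<in> OK" for r
  proof -
    \<comment> \<open>By maximality of \<open>m\<close>, adjoining \<open>r\<close> destroys
      independence. The coefficient of \<open>r\<close> in the resulting relation turns out to be
      invertible modulo \<open>p\<close>, so the relation can be solved for
      \<open>r\<close>.\<close>
    have "\<not> ind (Suc m) (f(m := r))" using m(2)[of "Suc m"] by auto
    moreover have "\<forall>i<Suc m. (f(m := r)) i \<in> OK" using f r by (auto simp: ind_def)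
    ultimately obtain w s where w: "s \<in> OK" "(\<Sum>i<Suc m. of_int (w i) * (f(m := r)) i) = of_nat p * s"
      "\<not> (\<forall>i<Suc m. int p dvd w i)"
      unfolding ind_def by blast
    have eq: "(\<Sum>i<m. of_int (w i) * f i) + of_int (w m) * r = of_nat p * s"
      using w(2) by simp
    have ndvd: "\<not> int p dvd w m"
    proof
      assume "int p dvd w m"
      then obtain k where k: "w m = int p * k" by auto
      have "(\<Sum>i<m. of_int (w i) * f i) = of_nat p * (s - of_int k * r)"
        using eq k by (simp add: algebra_simps)
      moreover have "s - of_int k * r \<in> OK" using w(1) r by (intro OK_intros)
      ultimately have "\<forall>i<m. int p dvd w i" using f unfolding ind_def by blast
      thus False using w(3) \<open>int p dvd w m\<close> by (auto simp: less_Suc_eq)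
    qed
    have "coprime (w m) (int p)"
      using p ndvd by (metis prime_imp_coprime coprime_commute prime_nat_int_transfer)
    then obtain u v where "u * w m + v * int p = 1"
      using bezout_int[of "w m" "int p"] by (auto simp: coprime_iff_gcd_eq_1)
    then obtain k where k: "w m * u = 1 + int p * k"
      by (intro that[of "- v"]) (simp add: algebra_simps)
    \<comment> \<open>Solving for \<open>r\<close> multiplies the other coefficients by
      \<open>- u\<close>, where \<open>u\<close> inverts \<open>w m\<close> modulo \<open>p\<close>;
      \<open>c\<close> and \<open>e\<close> are the remainders and quotients of the results.\<close>
    define c where "c = (\<lambda>i\<in>{..<m}. nat ((- u * w i) mod int p))"
    define e where "e = (\<lambda>i. (- u * w i) div int p)"
    have p0: "int p > 0" using p by (simp add: prime_gt_0_nat)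
    have ce: "(- u * w i) = int (c i) + int p * e i" if "i < m" for i
      using that p0 by (simp add: c_def e_def)
    have "of_int (w m * u) * r = (1 + of_nat p * of_int k) * r" using k by simp
    hence "r = of_int u * (of_int (w m) * r) - of_nat p * (of_int k * r)" by (simp add: algebra_simps)
    also have "of_int (w m) * r = of_nat p * s - (\<Sum>i<m. of_int (w i) * f i)" using eq by (simp add: algebra_simps)
    also have "of_int u * (of_nat p * s - (\<Sum>i<m. of_int (w i) * f i))
      = of_nat p * (of_int u * s) + (\<Sum>i<m. of_int (- u * w i) * f i)"
      by (simp add: algebra_simps sum_distrib_left sum_negf)
    also have "(\<Sum>i<m. of_int (- u * w i) * f i) = (\<Sum>i<m. of_nat (c i) * f i) + of_nat p * (\<Sum>i<m. of_int (e i) * f i)"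
      unfolding sum_distrib_left sum.distrib[symmetric]
    proof (rule sum.cong)
      fix i assume "i \<in> {..<m}"
      hence i: "i < m" by simp
      show "of_int (- u * w i) * f i = of_nat (c i) * f i + of_nat p * (of_int (e i) * f i)"
        unfolding ce[OF i] by (simp add: algebra_simps)
    qed simp
    finally have "r = (\<Sum>i<m. of_nat (c i) * f i) + of_nat p * (of_int u * s + (\<Sum>i<m. of_int (e i) * f i) - of_int k * r)"
      by (simp add: algebra_simps)
    moreover have "of_int u * s + (\<Sum>i<m. of_int (e i) * f i) - of_int k * r \<in> OK"
      using w(1) r f by (intro OK_intros) (auto simp: ind_def)
    moreover have "(\<Sum>i<m. of_nat (c i) * f i) \<in> T"
      unfolding T_def
    proof (intro imageI PiE_I)
      show "c i \<in> {..<p}" if "i \<in> {..<m}" for i using that p0 by (simp add: c_def nat_less_iff)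
      show "c i = undefined" if "i \<notin> {..<m}" for i using that by (simp add: c_def)
    qed
    ultimately show ?thesis by blast
  qed
  moreover have "finite T" by (auto simp: T_def intro!: finite_PiE)
  moreover have "T \<subseteq> OK" using f by (auto simp: T_def ind_def intro!: OK_intros)
  ultimately show ?thesis by blast
qed

text \<open>A residue modulo \<open>p * M\<close> is a residue modulo \<open>M\<close> plus
  \<open>M\<close> times a residue modulo \<open>p\<close>.\<close>

lemma finite_index:
  fixes N :: nat
  assumes "N > 0"
  shows "\<exists>T. finite T \<and> T \<subseteq> OK \<and> (\<forall>r\<in>OK. \<exists>t\<in>T. \<exists>s\<in>OK. r = t + of_nat N * s)"
  using assms
proof (induction N rule: less_induct)
  case (less N)
  show ?case
  proof (cases "N = 1")
    case True
    then show ?thesis using OK_0 by (intro exI[of _ "{0}"]) auto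
  next
    case False
    then obtain p where p: "Factorial_Ring.prime p" "p dvd N" using prime_factor_nat by blast
    then obtain M where M: "N = p * M" by auto
    hence "M > 0" "M < N" using less.prems p(1) prime_gt_1_nat by auto
    then obtain S where S: "finite S" "S \<subseteq> OK" "\<And>r. r \<in> OK \<Longrightarrow> \<exists>t\<in>S. \<exists>s\<in>OK. r = t + of_nat M * s"
      using less.IH by metis
    obtain T where T: "finite T" "T \<subseteq> OK" "\<And>r. r \<in> OK \<Longrightarrow> \<exists>t\<in>T. \<exists>s\<in>OK. r = t + of_nat p * s"
      using finite_index_prime[OF p(1)] by metis
    have "\<exists>u\<in>(\<lambda>(s,t). s + of_nat M * t) ` (S \<times> T). \<exists>s\<in>OK. r = u + of_nat N * s" if "r \<in> OK" for r
    proof -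
      obtain x y where xy: "x \<in> S" "y \<in> OK" "r = x + of_nat M * y" using S(3) \<open>r \<in> OK\<close> by blast
      obtain x' y' where xy': "x' \<in> T" "y' \<in> OK" "y = x' + of_nat p * y'" using T(3) xy(2) by blast
      have "r = (x + of_nat M * x') + of_nat N * y'"
        unfolding xy(3) xy'(3) M by (simp add: algebra_simps)
      thus ?thesis using xy(1) xy'(1,2) by auto
    qed
    moreover have "(\<lambda>(s,t). s + of_nat M * t) ` (S \<times> T) \<subseteq> OK"
      using S(2) T(2) by (auto intro!: OK_intros)
    moreover have "finite ((\<lambda>(s,t). s + of_nat M * t) ` (S \<times> T))"
      using S(1) T(1) by simp
    ultimately show ?thesis by blast
  qed
qed

text \<open>Since \<open>O\<^sub>K\<close> has finite index in \<open>N\<inverse> O\<^sub>K\<close>, two powers of \<open>y\<close> differ by an element of \<open>O\<^sub>K\<close>.\<close>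

lemma OK_if_powers_bounded:
  assumes y: "y \<in> K" and a: "a \<in> OK" "a \<noteq> 0" and ya: "\<And>n. y ^ n * a \<in> OK"
  shows "y \<in> OK"
proof -
  obtain N b where N: "N > 0" "b \<in> OK" "of_nat N = a * b" using OK_dvd_nat[OF a] .
  obtain T where T: "finite T" "\<And>r. r \<in> OK \<Longrightarrow> \<exists>t\<in>T. \<exists>s\<in>OK. r = t + of_nat N * s"
    using finite_index[OF N(1)] by metis
  \<comment> \<open>The cofactor \<open>b\<close> of \<open>a\<close> replaces the common
    denominator \<open>a\<close> of all powers by the integer \<open>N\<close>.\<close>
  have "of_nat N * y ^ n \<in> OK" for n
    using OK_mult[OF ya[of n] N(2)] by (simp add: N(3) mult_ac)
  hence "\<exists>t\<in>T. \<exists>s\<in>OK. of_nat N * y ^ n = t + of_nat N * s" for n by (rule T(2))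
  then obtain t s where ts: "\<And>n. t n \<in> T" "\<And>n. s n \<in> OK" "\<And>n. of_nat N * y ^ n = t n + of_nat N * s n"
    by metis
  have "\<not> inj t"
    using T(1) ts(1) by (meson finite_subset image_subsetI infinite_UNIV_nat finite_imageD)
  then obtain i j where ij: "i < j" "t i = t j"
    unfolding inj_def by (metis linorder_neqE_nat)
  have "of_nat N * (y ^ j - y ^ i) = of_nat N * (s j - s i)"
    using ts(3)[of i] ts(3)[of j] ij(2) by (simp add: right_diff_distrib)
  hence eq: "y ^ j - y ^ i = s j - s i" using N(1) by simp
  \<comment> \<open>The monic integer polynomial X^j - X^i takes an algebraic integer as its value
    at \<open>y\<close>, and this forces \<open>y\<close> to be integral.\<close>
  define p :: "complex poly" where "p = Polynomial.monom 1 j - Polynomial.monom 1 i"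
  have deg: "Polynomial.degree p = j"
    by (rule antisym[OF degree_le le_degree]) (use ij(1) in \<open>auto simp: p_def\<close>)
  have "algebraic_int y"
  proof (rule algebraic_int_root)
    show "algebraic_int (s j - s i)" using ts(2) by (auto simp: OK_def)
    show "poly p y = s j - s i" using eq by (simp add: p_def poly_monom)
    show "\<forall>i. Polynomial.coeff p i \<in> \<int>" by (simp add: p_def)
    show "Polynomial.lead_coeff p = 1" unfolding deg using ij(1) by (simp add: p_def)
    show "Polynomial.degree p > 0" using deg ij(1) by simp
  qed
  thus ?thesis using y by (simp add: OK_def)
qed

end

section \<open>Ideals of the ring of integers\<close>

interpretation CR: cring complex_ring
  by (rule cring_from_type_algebra)

lemma complex_ring_simps [simp]:
  "carrier complex_ring = UNIV" "mult complex_ring = (*)" "one complex_ring = 1"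
  "zero complex_ring = 0" "add complex_ring = (+)"
  by (simp_all add: ring_of_type_algebra_def)

lemma complex_ring_a_inv [simp]: "a_inv complex_ring x = - x"
  using CR.minus_equality[of "- x" x] by simp

lemma complex_ring_m_inv:
  assumes "x \<noteq> 0" shows "m_inv complex_ring x = inverse x"
  using CR.comm_inv_char[of x "inverse x"] assms by simp

context number_field
begin

lemma ring_of_integers_simps [simp]:
  "carrier (ring_of_integers K) = OK" "mult (ring_of_integers K) = (*)" "one (ring_of_integers K) = 1"
  "zero (ring_of_integers K) = 0" "add (ring_of_integers K) = (+)"
  by (simp_all add: ring_of_integers_def OK_def)

lemma ring_ring_of_integers: "ring (ring_of_integers K)"
proof -
  have "subring OK complex_ring"
    by (rule CR.subringI) (auto intro: OK_intros)
  thus ?thesis using CR.subring_is_ring by (simp add: ring_of_integers_def OK_def)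
qed

text \<open>Ideals in plain complex arithmetic, matched with the abstract notion in
  \<open>ideal_iff\<close>; negatives come from multiplication by -1 in \<open>OK\<close>.\<close>

definition is_ideal :: "complex set \<Rightarrow> bool" where
  "is_ideal I \<longleftrightarrow> I \<subseteq> OK \<and> 0 \<in> I \<and> (\<forall>x\<in>I. \<forall>y\<in>I. x + y \<in> I) \<and> (\<forall>x\<in>I. \<forall>r\<in>OK. r * x \<in> I)"

lemma ideal_iff: "ideal I (ring_of_integers K) \<longleftrightarrow> is_ideal I"
proof
  assume "ideal I (ring_of_integers K)"
  then interpret ideal I "ring_of_integers K" .
  show "is_ideal I"
    using a_subset additive_subgroup.zero_closed[OF is_additive_subgroup]
      additive_subgroup.a_closed[OF is_additive_subgroup] I_l_closed
    by (auto simp: is_ideal_def)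
next
  interpret R: ring "ring_of_integers K" by (rule ring_ring_of_integers)
  assume I: "is_ideal I"
  have inv: "a_inv (ring_of_integers K) x = - x" if "x \<in> OK" for x
    using R.minus_equality[of "- x" x] that by (simp add: OK_minus)
  have "- x \<in> I" if "x \<in> I" for x
    using I that OK_minus[OF OK_1] unfolding is_ideal_def by (metis mult_minus1)
  thus "ideal I (ring_of_integers K)"
    using I inv[unfolded a_inv_def]
    by (intro idealI ring_ring_of_integers subgroup.intro)
      (auto simp: is_ideal_def mult.commute subset_iff)
qed

lemma is_ideal_add: "is_ideal I \<Longrightarrow> x \<in> I \<Longrightarrow> y \<in> I \<Longrightarrow> x + y \<in> I"
  and is_ideal_mult: "is_ideal I \<Longrightarrow> x \<in> I \<Longrightarrow> r \<in> OK \<Longrightarrow> r * x \<in> I"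
  and is_ideal_0: "is_ideal I \<Longrightarrow> 0 \<in> I"
  and is_ideal_OK: "is_ideal I \<Longrightarrow> x \<in> I \<Longrightarrow> x \<in> OK"
  by (auto simp: is_ideal_def)

lemma is_ideal_mult_right: "is_ideal I \<Longrightarrow> x \<in> I \<Longrightarrow> r \<in> OK \<Longrightarrow> x * r \<in> I"
  using is_ideal_mult[of I x r] by (simp add: mult.commute)

lemma is_ideal_diff: "is_ideal I \<Longrightarrow> x \<in> I \<Longrightarrow> y \<in> I \<Longrightarrow> x - y \<in> I"
  using is_ideal_add[of I x "(-1) * y"] is_ideal_mult[of I y "-1"] by (simp add: OK_minus OK_1)

lemma is_ideal_eq_OK: "is_ideal I \<Longrightarrow> 1 \<in> I \<Longrightarrow> I = OK"
  using is_ideal_mult[of I 1] by (auto dest: is_ideal_OK)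

definition max_ideal :: "complex set \<Rightarrow> bool" where
  "max_ideal P \<longleftrightarrow> is_ideal P \<and> 1 \<notin> P \<and> (\<forall>J. is_ideal J \<longrightarrow> P \<subseteq> J \<longrightarrow> J = P \<or> 1 \<in> J)"

lemma finite_places_eq: "finite_places K = Collect max_ideal"
proof -
  have "maximalideal P (ring_of_integers K) \<longleftrightarrow> max_ideal P" for P
    unfolding maximalideal_def maximalideal_axioms_def ideal_iff ring_of_integers_simps max_ideal_def
    using is_ideal_eq_OK OK_1 is_ideal_OK by (metis subsetI)
  thus ?thesis by (simp add: finite_places_def)
qed

section \<open>Maximal ideals: primality, their positive integers, existence\<close>

lemma max_ideal_is_ideal: "max_ideal P \<Longrightarrow> is_ideal P" by (simp add: max_ideal_def)
lemma max_ideal_1: "max_ideal P \<Longrightarrow> 1 \<notin> P" by (simp add: max_ideal_def)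

text \<open>The ideal generated by \<open>P\<close> and \<open>t\<close> is strictly larger than
  \<open>P\<close>, so maximality puts 1 into it.\<close>

lemma max_ideal_unit:
  assumes P: "max_ideal P" and t: "t \<in> OK" "t \<notin> P"
  obtains u where "u \<in> OK" "1 - t * u \<in> P"
proof -
  note Pi = max_ideal_is_ideal[OF P]
  define J where "J = {p + t * u | p u. p \<in> P \<and> u \<in> OK}"
  have "is_ideal J"
    unfolding is_ideal_def
  proof (intro conjI ballI)
    show "J \<subseteq> OK" using t is_ideal_OK[OF Pi] by (auto simp: J_def intro!: OK_intros)
    show "0 \<in> J" using is_ideal_0[OF Pi] OK_0 by (force simp: J_def)
    show "x + y \<in> J" if xy: "x \<in> J" "y \<in> J" for x y
    proof -
      obtain p u p' u' where eq: "x = p + t * u" "y = p' + t * u'" and mem: "p \<in> P" "p' \<in> P" "u \<in> OK" "u' \<in> OK"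
        using xy unfolding J_def by blast
      have "x + y = (p + p') + t * (u + u')" using eq by (simp add: algebra_simps)
      thus ?thesis using is_ideal_add[OF Pi mem(1,2)] OK_add[OF mem(3,4)] unfolding J_def by blast
    qed
    show "r * x \<in> J" if rx: "x \<in> J" "r \<in> OK" for r x
    proof -
      obtain p u where eq: "x = p + t * u" and mem: "p \<in> P" "u \<in> OK" using rx by (auto simp: J_def)
      have "r * x = r * p + t * (r * u)" using eq by (simp add: algebra_simps)
      thus ?thesis using is_ideal_mult[OF Pi mem(1) rx(2)] OK_mult[OF rx(2) mem(2)] unfolding J_def by blast
    qed
  qed
  moreover have "P \<subseteq> J" using OK_0 by (force simp: J_def)
  moreover have "t \<in> J" using is_ideal_0[OF Pi] OK_1 by (force simp: J_def)
  ultimately have "1 \<in> J" using P t(2) unfolding max_ideal_def by blast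
  then obtain p u where pu: "1 = p + t * u" "p \<in> P" "u \<in> OK" by (auto simp: J_def)
  hence "1 - t * u = p" by (simp add: algebra_simps)
  thus ?thesis using that[of u] pu by simp
qed

lemma max_ideal_prime:
  assumes P: "max_ideal P" and ab: "a \<in> OK" "b \<in> OK" "a * b \<in> P"
  shows "a \<in> P \<or> b \<in> P"
proof (rule disjCI)
  note Pi = max_ideal_is_ideal[OF P]
  assume "b \<notin> P"
  then obtain u where u: "u \<in> OK" "1 - b * u \<in> P" using max_ideal_unit[OF P ab(2)] by blast
  have "a * (1 - b * u) + u * (a * b) \<in> P"
    by (intro is_ideal_add[OF Pi] is_ideal_mult[OF Pi] u ab)
  thus "a \<in> P" by (simp add: algebra_simps)
qed

lemma max_ideal_power:
  assumes P: "max_ideal P" and a: "a \<in> OK" "a ^ n \<in> P"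
  shows "a \<in> P"
  using a(2)
proof (induction n)
  case 0
  then show ?case using max_ideal_1[OF P] by simp
next
  case (Suc n)
  then show ?case using max_ideal_prime[OF P a(1) OK_power[OF a(1), of n]] by auto
qed

text \<open>Keeps the ring of integers from being a field, and so the zero ideal from being
  maximal.\<close>

lemma half_not_in_OK: "1 / 2 \<notin> OK"
proof
  assume "1 / 2 \<in> OK"
  hence "(1 / 2 :: complex) \<in> \<int>"
    by (intro rational_algebraic_int_is_int) (auto simp: OK_def)
  then obtain k where "(1 / 2 :: complex) = of_int k" by (auto elim: Ints_cases)
  hence "(of_int 1 :: complex) = of_int (2 * k)" by (simp add: field_simps)
  hence "1 = 2 * k" by (simp only: of_int_eq_iff)
  thus False by presburger
qed

text \<open>Either 2 is a member, or 2 is invertible modulo \<open>P\<close> and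
  \<open>1 - 2 * u\<close> is a member, which is nonzero because 1/2 is not integral.\<close>

lemma max_ideal_nonzero:
  assumes P: "max_ideal P"
  obtains a where "a \<in> P" "a \<noteq> 0"
proof (cases "2 \<in> P")
  case True
  then show ?thesis using that[of 2] by simp
next
  case False
  moreover have "2 \<in> OK" using OK_of_nat[of 2] by simp
  ultimately obtain u where u: "u \<in> OK" "1 - 2 * u \<in> P" using max_ideal_unit[OF P] by blast
  have "1 - 2 * u \<noteq> 0"
  proof
    assume "1 - 2 * u = 0"
    hence "u = 1 / 2" by (simp add: field_simps)
    thus False using u(1) half_not_in_OK by (simp only:)
  qed
  thus ?thesis using that u by blast
qed

lemma max_ideal_nat:
  assumes P: "max_ideal P"
  obtains N :: nat where "N > 0" "of_nat N \<in> P"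
proof -
  obtain a where a: "a \<in> P" "a \<noteq> 0" using max_ideal_nonzero[OF P] .
  note Pi = max_ideal_is_ideal[OF P]
  obtain N b where "N > 0" "b \<in> OK" "of_nat N = a * b" using OK_dvd_nat[OF is_ideal_OK[OF Pi a(1)] a(2)] .
  thus ?thesis using that is_ideal_mult_right[OF Pi a(1)] by auto
qed

text \<open>An ideal containing \<open>N\<close> is a union of cosets of \<open>N\<close> times
  \<open>OK\<close>, so it is determined by its intersection with the finite set \<open>T\<close> of
  representatives. A proper ideal above \<open>I\<close> with the largest such intersection is
  therefore maximal.\<close>

lemma ex_max_ideal:
  assumes I: "is_ideal I" "1 \<notin> I" and N: "N > 0" "of_nat N \<in> I"
  obtains P where "max_ideal P" "I \<subseteq> P"
proof -
  obtain T where T: "finite T" "T \<subseteq> OK" "\<And>r. r \<in> OK \<Longrightarrow> \<exists>t\<in>T. \<exists>s\<in>OK. r = t + of_nat N * s"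
    using finite_index[OF N(1)] by metis
  define good where "good = (\<lambda>J. is_ideal J \<and> 1 \<notin> J \<and> I \<subseteq> J)"
  have "\<exists>J. good J \<and> (\<forall>J'. good J' \<longrightarrow> card (J' \<inter> T) \<le> card (J \<inter> T))"
    using I T(1)
    by (intro ex_has_greatest_nat[of good I _ "Suc (card T)"]) (auto simp: good_def less_Suc_eq_le card_mono)
  then obtain J where J: "good J" "\<And>J'. good J' \<Longrightarrow> card (J' \<inter> T) \<le> card (J \<inter> T)" by blast
  have "max_ideal J"
    unfolding max_ideal_def
  proof (intro conjI allI impI)
    fix J' assume J': "is_ideal J'" "J \<subseteq> J'"
    show "J' = J \<or> 1 \<in> J'"
    proof (rule ccontr)
      assume neg: "\<not> ?thesis"
      hence "good J'" using J' J(1) by (auto simp: good_def)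
      obtain x where x: "x \<in> J'" "x \<notin> J" using neg J' by blast
      obtain t s where ts: "t \<in> T" "s \<in> OK" "x = t + of_nat N * s"
        using T(3) is_ideal_OK[OF J'(1) x(1)] by blast
      have Ns: "of_nat N * s \<in> J" using J(1) N(2) ts(2) is_ideal_mult_right by (auto simp: good_def)
      have "t = x - of_nat N * s" using ts by simp
      hence "t \<in> J'" using is_ideal_diff[OF J'(1) x(1)] Ns J'(2) by auto
      moreover have "t \<notin> J" using x(2) ts Ns J(1) is_ideal_add by (auto simp: good_def)
      ultimately have "J \<inter> T \<subset> J' \<inter> T" using J'(2) ts(1) by blast
      hence "card (J \<inter> T) < card (J' \<inter> T)" using T(1) by (intro psubset_card_mono) auto
      thus False using J(2)[OF \<open>good J'\<close>] by simp
    qed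
  qed (use J(1) in \<open>auto simp: good_def\<close>)
  thus ?thesis using that J(1) by (auto simp: good_def)
qed

text \<open>The element \<open>y\<close> is a nontrivial element of the inverse of \<open>P\<close>; it is found in \<open>N\<inverse> O\<^sub>K\<close> as one whose
  colon ideal is as large as possible among those contained in \<open>P\<close>.\<close>

lemma ex_inverse_element:
  assumes P: "max_ideal P"
  obtains y where "y \<in> K" "y \<notin> OK" "\<And>p. p \<in> P \<Longrightarrow> y * p \<in> OK"
proof -
  note Pi = max_ideal_is_ideal[OF P]
  obtain N :: nat where N: "N > 0" "of_nat N \<in> P" using max_ideal_nat[OF P] .
  obtain T where T: "finite T" "T \<subseteq> OK" "\<And>r. r \<in> OK \<Longrightarrow> \<exists>t\<in>T. \<exists>s\<in>OK. r = t + of_nat N * s"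
    using finite_index[OF N(1)] by metis
  \<comment> \<open>\<open>good y\<close> says that \<open>N\<close> is a denominator of
    \<open>y\<close> and that the colon ideal of \<open>y\<close>, the \<open>t\<close> in
    \<open>OK\<close> with \<open>t * y\<close> integral, lies in \<open>P\<close>. For
    \<open>1 / N\<close> this holds because \<open>N\<close> is in \<open>P\<close>.\<close>
  define good where "good = (\<lambda>y. of_nat N * y \<in> OK \<and> (\<forall>t\<in>OK. t * y \<in> OK \<longrightarrow> t \<in> P))"
  have "good (1 / of_nat N)"
    unfolding good_def
  proof (intro conjI ballI impI)
    show "of_nat N * (1 / of_nat N) \<in> OK" using N(1) OK_1 by simp
    fix t assume "t \<in> OK" "t * (1 / of_nat N) \<in> OK"
    from is_ideal_mult[OF Pi N(2) this(2)] show "t \<in> P" using N(1) by simp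
  qed
  \<comment> \<open>The colon ideal of a good element contains \<open>N\<close>, so its intersection
    with \<open>T\<close> measures its size.\<close>
  hence "\<exists>y. good y \<and> (\<forall>y'. good y' \<longrightarrow> card {t\<in>T. t * y' \<in> OK} \<le> card {t\<in>T. t * y \<in> OK})"
    using T(1)
    by (intro ex_has_greatest_nat[of good _ _ "Suc (card T)"]) (auto simp: less_Suc_eq_le card_mono)
  then obtain y where y: "good y" "\<And>y'. good y' \<Longrightarrow> card {t\<in>T. t * y' \<in> OK} \<le> card {t\<in>T. t * y \<in> OK}"
    by blast
  have Ny: "of_nat N * y \<in> OK" using y(1) by (simp add: good_def)
  have yP: "y * p \<in> OK" if p: "p \<in> P" for p
  proof (rule ccontr)
    assume py: "y * p \<notin> OK"
    have pO: "p \<in> OK" by (rule is_ideal_OK[OF Pi p])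
    \<comment> \<open>By finiteness of \<open>T\<close>, two of the elements
      \<open>p ^ n * y\<close> differ by an element of \<open>OK\<close>. The colon ideal of the one
      with the lower exponent then contains \<open>1 - p ^ (j - i)\<close>, which is outside
      \<open>P\<close>, so this element is not good.\<close>
    have "of_nat N * (p ^ n * y) \<in> OK" for n
      using OK_mult[OF OK_power[OF pO, of n] Ny] by (simp add: mult_ac)
    hence "\<exists>t\<in>T. \<exists>s\<in>OK. of_nat N * (p ^ n * y) = t + of_nat N * s" for n by (rule T(3))
    then obtain t s where ts: "\<And>n. t n \<in> T" "\<And>n. s n \<in> OK" "\<And>n. of_nat N * (p ^ n * y) = t n + of_nat N * s n"
      by metis
    have "\<not> inj t"
      using T(1) ts(1) by (meson finite_subset image_subsetI infinite_UNIV_nat finite_imageD)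
    then obtain i j where ij: "i < j" "t i = t j"
      unfolding inj_def by (metis linorder_neqE_nat)
    have "of_nat N * (p ^ i * y - p ^ j * y) = of_nat N * (s i - s j)"
      using ts(3)[of i] ts(3)[of j] ij(2) by (simp add: right_diff_distrib)
    hence "p ^ i * y - p ^ j * y = s i - s j" using N(1) by simp
    moreover have "p ^ j = p ^ (j - i) * p ^ i" using ij(1) by (simp flip: power_add)
    ultimately have "(1 - p ^ (j - i)) * (p ^ i * y) = s i - s j" by (simp add: algebra_simps)
    hence in_OK: "(1 - p ^ (j - i)) * (p ^ i * y) \<in> OK" using ts(2) by (simp add: OK_diff)
    obtain m where m: "j - i = Suc m" using ij(1) by (metis Suc_diff_Suc)
    have "p ^ (j - i) \<in> P"
      using is_ideal_mult_right[OF Pi p OK_power[OF pO, of m]] by (simp add: m)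
    hence "1 - p ^ (j - i) \<notin> P" using is_ideal_add[OF Pi, of "1 - p ^ (j - i)" "p ^ (j - i)"] max_ideal_1[OF P] by auto
    hence "\<exists>i. \<not> good (p ^ i * y)"
      using in_OK OK_diff[OF OK_1 OK_power[OF pO]] unfolding good_def by blast
    \<comment> \<open>\<open>k\<close> is the last exponent before goodness fails for the first
      time; it exists because exponent 0 gives \<open>y\<close>.\<close>
    then obtain k where k: "\<not> good (p ^ Suc k * y)" "good (p ^ k * y)"
      using y(1) ex_least_nat_less[of "\<lambda>i. \<not> good (p ^ i * y)"] by (metis mult_1 power_0 less_Suc_eq_le order_refl not_less)
    have "of_nat N * (p ^ Suc k * y) \<in> OK"
      using OK_mult[OF OK_power[OF pO, of "Suc k"] Ny] by (simp add: mult_ac)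
    then obtain c where c: "c \<in> OK" "c * (p ^ Suc k * y) \<in> OK" "c \<notin> P"
      using k(1) unfolding good_def by blast
    \<comment> \<open>\<open>y'\<close> is still good, since \<open>c\<close> is outside the prime
      ideal \<open>P\<close>, and its colon ideal contains that of \<open>y\<close> together with
      \<open>p\<close>, against the choice of \<open>y\<close>.\<close>
    define y' where "y' = c * p ^ k * y"
    have colon: "r * y' \<in> OK" if "r * y \<in> OK" "r \<in> OK" for r
      using OK_mult[OF OK_mult[OF c(1) OK_power[OF pO, of k]] that(1)] by (simp add: y'_def mult_ac)
    have Ny': "of_nat N * y' \<in> OK" using colon[OF Ny OK_of_nat] .
    have "good y'"
      unfolding good_def
    proof (intro conjI ballI impI)
      show "of_nat N * y' \<in> OK" by (rule Ny')
      fix r assume r: "r \<in> OK" "r * y' \<in> OK"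
      hence "(r * c) * (p ^ k * y) \<in> OK" by (simp add: y'_def mult_ac)
      hence "r * c \<in> P" using k(2) OK_mult[OF r(1) c(1)] by (simp add: good_def)
      thus "r \<in> P" using max_ideal_prime[OF P r(1) c(1)] c(3) by blast
    qed
    \<comment> \<open>Sizes are measured on \<open>T\<close>, so the representative
      \<open>t0\<close> stands in for \<open>p\<close>; both act alike because \<open>N * y\<close>
      and \<open>N * y'\<close> are integral.\<close>
    obtain t0 s0 where t0: "t0 \<in> T" "s0 \<in> OK" "p = t0 + of_nat N * s0" using T(3)[OF pO] by blast
    have "t0 * y' = c * (p ^ Suc k * y) - s0 * (of_nat N * y')"
      unfolding y'_def using t0(3) by (simp add: algebra_simps)
    hence 1: "t0 * y' \<in> OK" using c(2) t0(2) Ny' by (simp add: OK_diff OK_mult)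
    have "y * p = t0 * y + s0 * (of_nat N * y)" using t0(3) by (simp add: algebra_simps)
    hence 2: "t0 * y \<notin> OK" using py OK_add OK_mult[OF t0(2) Ny] by metis
    have "{t\<in>T. t * y \<in> OK} \<subset> {t\<in>T. t * y' \<in> OK}"
      using 1 2 t0(1) colon T(2) by blast
    hence "card {t\<in>T. t * y \<in> OK} < card {t\<in>T. t * y' \<in> OK}"
      using T(1) by (intro psubset_card_mono) auto
    thus False using y(2)[OF \<open>good y'\<close>] by simp
  qed
  have "y \<notin> OK" using y(1) OK_1 max_ideal_1[OF P] by (auto simp: good_def)
  moreover have "y \<in> K" using divide_in[OF OK_K[OF Ny] of_nat_in[of N]] N(1) by simp
  ultimately show ?thesis using that yP by blast
qed

end

section \<open>Valuations and denominators\<close>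

context number_field
begin

definition ideal_pow :: "complex set \<Rightarrow> nat \<Rightarrow> complex set" where
  "ideal_pow P n = P [^]\<^bsub>ideals_set (ring_of_integers K)\<^esub> n"

lemma ideal_pow_0 [simp]: "ideal_pow P 0 = OK"
  by (simp add: ideal_pow_def nat_pow_def ideals_set_def)

lemma ideal_pow_Suc: "ideal_pow P (Suc n) = ideal_prod (ring_of_integers K) (ideal_pow P n) P"
  by (simp add: ideal_pow_def nat_pow_def ideals_set_def)

lemma is_ideal_ideal_pow:
  assumes "is_ideal P"
  shows "is_ideal (ideal_pow P n)"
proof (induction n)
  case 0
  show ?case by (auto simp: is_ideal_def intro: OK_intros)
next
  case (Suc n)
  thus ?case
    using assms ring.ideal_prod_is_ideal[OF ring_ring_of_integers] by (simp add: ideal_pow_Suc flip: ideal_iff)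
qed

lemma ideal_pow_Suc_mult: "a \<in> ideal_pow P n \<Longrightarrow> b \<in> P \<Longrightarrow> a * b \<in> ideal_pow P (Suc n)"
  using ideal_prod.prod[of a "ideal_pow P n" b P "ring_of_integers K"] by (simp add: ideal_pow_Suc)

lemma power_in_ideal_pow: "p \<in> P \<Longrightarrow> p ^ n \<in> ideal_pow P n"
proof (induction n)
  case (Suc n)
  thus ?case using ideal_pow_Suc_mult[of "p ^ n" P n p] by (simp add: mult.commute)
qed (simp add: OK_1)

text \<open>Inverses are lifted from \<open>P\<close> to its powers: the product of
  \<open>1 - t * u\<close> in the n-th power and \<open>1 - t * v\<close> in \<open>P\<close> is
  again 1 minus a multiple of \<open>t\<close>.\<close>

lemma ideal_pow_unit:
  assumes P: "max_ideal P" and t: "t \<in> OK" "t \<notin> P"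
  shows "\<exists>u\<in>OK. 1 - t * u \<in> ideal_pow P n"
proof (induction n)
  case 0
  show ?case by (rule bexI[of _ 0]) (auto simp: OK_0 OK_1)
next
  case (Suc n)
  then obtain u where u: "u \<in> OK" "1 - t * u \<in> ideal_pow P n" by blast
  obtain v where v: "v \<in> OK" "1 - t * v \<in> P" using max_ideal_unit[OF P t] .
  have "(1 - t * u) * (1 - t * v) = 1 - t * (u + v - t * u * v)" by (simp add: algebra_simps)
  moreover have "u + v - t * u * v \<in> OK" by (intro OK_intros u v t)
  ultimately show ?case using ideal_pow_Suc_mult[OF u(2) v(2)] by auto
qed

text \<open>Each of the \<open>n\<close> factors from \<open>P\<close> absorbs one factor
  \<open>y\<close>; elements of a product ideal are sums of products, whence the induction over
  \<open>ideal_prod\<close>.\<close>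

lemma ideal_pow_denominator:
  assumes y: "\<And>p. p \<in> P \<Longrightarrow> y * p \<in> OK" and a: "a \<in> ideal_pow P n"
  shows "y ^ n * a \<in> OK"
  using a
proof (induction n arbitrary: a)
  case (Suc n)
  from Suc.prems have "a \<in> ideal_prod (ring_of_integers K) (ideal_pow P n) P" by (simp only: ideal_pow_Suc)
  thus ?case
  proof (induction rule: ideal_prod.induct)
    case (prod i j)
    have "(y ^ n * i) * (y * j) \<in> OK" by (intro OK_mult Suc.IH y prod)
    thus ?case by (simp add: mult_ac)
  next
    case (sum s1 s2)
    thus ?case by (simp add: distrib_left OK_add)
  qed
qed simp

end

text \<open>Here \<open>y\<close> lies in the inverse of \<open>P\<close>, and
  \<open>y * \<pi>\<close> is a unit at \<open>P\<close>. For \<open>p\<close> in \<open>P\<close>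
  the identity \<open>(y * \<pi>) * p = (y * p) * \<pi>\<close> shows that \<open>\<pi>\<close>
  generates \<open>P\<close> after localisation: it is a uniformizer.\<close>

locale uniformized_place = number_field +
  fixes P :: "complex set" and y \<pi> :: complex
  assumes max_P: "max_ideal P"
    and y_notin: "y \<notin> OK" and y_in: "y \<in> K" and yP: "\<And>p. p \<in> P \<Longrightarrow> y * p \<in> OK"
    and \<pi>_mem: "\<pi> \<in> P" "y * \<pi> \<notin> P"
begin

lemmas ideal_P = max_ideal_is_ideal[OF max_P]

lemma \<pi>_OK: "\<pi> \<in> OK" using is_ideal_OK[OF ideal_P \<pi>_mem(1)] .

lemma \<pi>_nonzero: "\<pi> \<noteq> 0" using \<pi>_mem(2) is_ideal_0[OF ideal_P] by auto

text \<open>In the localisation at \<open>P\<close> the n-th power of \<open>P\<close> is generated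
  by \<open>\<pi> ^ n\<close>; the elements \<open>t\<close> outside \<open>P\<close> are the
  denominators. From left to right \<open>t\<close> is \<open>(y * \<pi>) ^ n\<close>; from right to
  left \<open>t\<close> is inverted modulo the n-th power.\<close>

lemma mem_ideal_pow_iff:
  assumes a: "a \<in> OK"
  shows "a \<in> ideal_pow P n \<longleftrightarrow> (\<exists>t\<in>OK - P. \<exists>r\<in>OK. t * a = r * \<pi> ^ n)"
proof
  assume "a \<in> ideal_pow P n"
  hence "y ^ n * a \<in> OK" using ideal_pow_denominator[OF yP] by blast
  moreover have "(y * \<pi>) ^ n \<in> OK - P"
    using max_ideal_power[OF max_P yP[OF \<pi>_mem(1)]] \<pi>_mem(2) OK_power[OF yP[OF \<pi>_mem(1)]] by blast
  moreover have "(y * \<pi>) ^ n * a = (y ^ n * a) * \<pi> ^ n" by (simp add: power_mult_distrib mult_ac)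
  ultimately show "\<exists>t\<in>OK - P. \<exists>r\<in>OK. t * a = r * \<pi> ^ n" by blast
next
  note Ii = is_ideal_ideal_pow[OF ideal_P, of n]
  assume "\<exists>t\<in>OK - P. \<exists>r\<in>OK. t * a = r * \<pi> ^ n"
  then obtain t r where tr: "t \<in> OK" "t \<notin> P" "r \<in> OK" "t * a = r * \<pi> ^ n" by blast
  obtain u where u: "u \<in> OK" "1 - t * u \<in> ideal_pow P n" using ideal_pow_unit[OF max_P tr(1,2)] by blast
  have "a = a * (1 - t * u) + u * (t * a)" by (simp add: algebra_simps)
  also have "\<dots> = a * (1 - t * u) + u * (r * \<pi> ^ n)" unfolding tr(4) ..
  also have "\<dots> \<in> ideal_pow P n"
    by (intro is_ideal_add[OF Ii] is_ideal_mult[OF Ii] u a tr power_in_ideal_pow \<pi>_mem)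
  finally show "a \<in> ideal_pow P n" .
qed

lemma ideal_pow_antimono:
  assumes a: "a \<in> ideal_pow P n" and "m \<le> n"
  shows "a \<in> ideal_pow P m"
proof -
  have aO: "a \<in> OK" using a is_ideal_OK[OF is_ideal_ideal_pow[OF ideal_P]] by blast
  obtain t r where tr: "t \<in> OK - P" "r \<in> OK" "t * a = r * \<pi> ^ n"
    using a mem_ideal_pow_iff[OF aO] by blast
  have "\<pi> ^ n = \<pi> ^ (n - m) * \<pi> ^ m" using \<open>m \<le> n\<close> by (simp flip: power_add)
  hence "t * a = (r * \<pi> ^ (n - m)) * \<pi> ^ m" using tr(3) by simp
  moreover have "r * \<pi> ^ (n - m) \<in> OK" by (intro OK_intros tr \<pi>_OK)
  ultimately show ?thesis using mem_ideal_pow_iff[OF aO] tr(1) by blast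
qed

text \<open>Gives the \<open>GREATEST\<close> in \<open>int_ord\<close> its meaning. If
  \<open>a\<close> were in all powers, every \<open>y ^ n * a\<close> would be integral, and then so
  would \<open>y\<close>.\<close>

lemma ideal_pow_bounded:
  assumes a: "a \<in> OK" "a \<noteq> 0"
  shows "\<exists>b. \<forall>n. a \<in> ideal_pow P n \<longrightarrow> n \<le> b"
proof (rule ccontr)
  assume "\<not> ?thesis"
  hence "a \<in> ideal_pow P n" for n
    using ideal_pow_antimono by (metis nat_le_linear)
  hence "y ^ n * a \<in> OK" for n using ideal_pow_denominator[OF yP] by blast
  hence "y \<in> OK" by (rule OK_if_powers_bounded[OF y_in a])
  thus False using y_notin by simp
qed

lemma int_ord_ge:
  assumes "a \<in> OK" "a \<noteq> 0" "a \<in> ideal_pow P n"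
  shows "n \<le> int_ord K P a"
  using ideal_pow_bounded[OF assms(1,2)] assms(3)
  unfolding int_ord_def ideal_pow_def[symmetric] by (metis Greatest_le_nat)

text \<open>Up to the local unit \<open>r / t\<close>, the element \<open>a\<close> is the power of
  \<open>\<pi>\<close> given by its order.\<close>

lemma int_ord_decomp:
  assumes a: "a \<in> OK" "a \<noteq> 0"
  obtains t r where "t \<in> OK - P" "r \<in> OK - P" "t * a = r * \<pi> ^ int_ord K P a"
proof -
  define n where "n = int_ord K P a"
  obtain b where b: "\<And>n. a \<in> ideal_pow P n \<Longrightarrow> n \<le> b" using ideal_pow_bounded[OF a] by blast
  have "a \<in> ideal_pow P n"
    unfolding n_def int_ord_def ideal_pow_def[symmetric]
    by (rule GreatestI_nat[of "\<lambda>n. a \<in> ideal_pow P n" 0 b]) (use a b in auto)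
  then obtain t r where tr: "t \<in> OK - P" "r \<in> OK" "t * a = r * \<pi> ^ n"
    using mem_ideal_pow_iff[OF a(1)] by blast
  \<comment> \<open>Otherwise \<open>y * r\<close> would be integral, and multiplying by
    \<open>y * \<pi>\<close> would trade \<open>r\<close> for one more factor \<open>\<pi>\<close>,
    putting \<open>a\<close> into the next power.\<close>
  have "r \<notin> P"
  proof
    assume "r \<in> P"
    have "(y * \<pi>) * t * a = (y * r) * \<pi> ^ Suc n" using tr(3) by (simp add: mult_ac)
    moreover have "y * \<pi> * t \<in> OK - P"
      using max_ideal_prime[OF max_P yP[OF \<pi>_mem(1)], of t] \<pi>_mem(2) tr(1) OK_mult[OF yP[OF \<pi>_mem(1)]] by blast
    ultimately have "a \<in> ideal_pow P (Suc n)"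
      using mem_ideal_pow_iff[OF a(1)] yP[OF \<open>r \<in> P\<close>] by blast
    from int_ord_ge[OF a this] show False by (simp add: n_def)
  qed
  thus ?thesis using that tr by (auto simp: n_def)
qed

text \<open>If \<open>m\<close> exceeded \<open>n\<close>, a factor \<open>\<pi>\<close> would
  remain in \<open>t' * r\<close>, a product of two elements outside the prime ideal
  \<open>P\<close>.\<close>

lemma uniformizer_exponent_le:
  assumes "t \<in> OK - P" "r \<in> OK - P" "t' \<in> OK - P" "r' \<in> OK - P"
    and "t * a = r * \<pi> ^ n" "t' * a = r' * \<pi> ^ m"
  shows "m \<le> n"
proof (rule ccontr)
  assume "\<not> m \<le> n"
  then obtain k where k: "m = n + Suc k" by (metis add_Suc_right less_imp_Suc_add not_le)
  have "(t' * r) * \<pi> ^ n = t' * (t * a)" using assms(5) by (simp add: mult_ac)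
  also have "\<dots> = t * (t' * a)" by (simp add: mult_ac)
  also have "\<dots> = (t * r' * \<pi> ^ k * \<pi>) * \<pi> ^ n" unfolding assms(6) k by (simp add: power_add mult_ac)
  finally have "t' * r = (t * r' * \<pi> ^ k) * \<pi>" using \<pi>_nonzero by simp
  moreover have "(t * r' * \<pi> ^ k) * \<pi> \<in> P"
    using assms by (intro is_ideal_mult[OF ideal_P \<pi>_mem(1)] OK_intros \<pi>_OK) auto
  ultimately show False using max_ideal_prime[OF max_P, of t' r] assms by auto
qed

lemma int_ord_eqI:
  assumes a: "a \<in> OK" "a \<noteq> 0" and tr: "t \<in> OK - P" "r \<in> OK - P" "t * a = r * \<pi> ^ n"
  shows "int_ord K P a = n"
proof -
  obtain t' r' where "t' \<in> OK - P" "r' \<in> OK - P" "t' * a = r' * \<pi> ^ int_ord K P a"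
    using int_ord_decomp[OF a] .
  thus ?thesis
    using uniformizer_exponent_le[of t r t' r' a n "int_ord K P a"]
      uniformizer_exponent_le[of t' r' t r a "int_ord K P a" n] tr by simp
qed

lemma int_ord_mult:
  assumes a: "a \<in> OK" "a \<noteq> 0" and b: "b \<in> OK" "b \<noteq> 0"
  shows "int_ord K P (a * b) = int_ord K P a + int_ord K P b"
proof -
  obtain t r where tr: "t \<in> OK - P" "r \<in> OK - P" "t * a = r * \<pi> ^ int_ord K P a"
    using int_ord_decomp[OF a] .
  obtain t' r' where tr': "t' \<in> OK - P" "r' \<in> OK - P" "t' * b = r' * \<pi> ^ int_ord K P b"
    using int_ord_decomp[OF b] .
  have "(t * t') * (a * b) = (t * a) * (t' * b)" by (simp add: mult_ac)
  also have "\<dots> = (r * r') * \<pi> ^ (int_ord K P a + int_ord K P b)"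
    unfolding tr(3) tr'(3) by (simp add: power_add mult_ac)
  finally show ?thesis
    using max_ideal_prime[OF max_P] tr tr' a b
    by (intro int_ord_eqI[of "a * b" "t * t'" "r * r'"]) (auto intro: OK_mult)
qed

lemma int_ord_pos:
  assumes a: "a \<in> OK" "a \<noteq> 0" and "int_ord K P a > 0"
  shows "a \<in> P"
proof -
  obtain t r where tr: "t \<in> OK - P" "r \<in> OK - P" "t * a = r * \<pi> ^ int_ord K P a"
    using int_ord_decomp[OF a] .
  obtain k where k: "int_ord K P a = Suc k" using assms(3) gr0_implies_Suc by blast
  have "t * a = r * \<pi> ^ k * \<pi>" using tr(3) by (simp add: k mult_ac)
  also have "\<dots> \<in> P" using tr(2) by (intro is_ideal_mult[OF ideal_P \<pi>_mem(1)] OK_intros \<pi>_OK) auto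
  finally show ?thesis using max_ideal_prime[OF max_P, of t a] tr(1) a(1) by blast
qed

text \<open>Additivity of \<open>int_ord\<close> makes the order independent of the chosen fraction,
  so the \<open>THE\<close> in \<open>place_ord\<close> is well defined.\<close>

lemma place_ord_divide:
  assumes a: "a \<in> OK" "a \<noteq> 0" and b: "b \<in> OK" "b \<noteq> 0"
  shows "place_ord K P (a / b) = int (int_ord K P a) - int (int_ord K P b)"
  unfolding place_ord_def ring_of_integers_simps
proof (rule the_equality)
  fix k
  assume "\<exists>a' b'. a' \<in> OK - {0} \<and> b' \<in> OK - {0} \<and> a / b = a' / b' \<and> k = int (int_ord K P a') - int (int_ord K P b')"
  then obtain a' b' where ab': "a' \<in> OK" "a' \<noteq> 0" "b' \<in> OK" "b' \<noteq> 0" "a / b = a' / b'"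
    "k = int (int_ord K P a') - int (int_ord K P b')" by blast
  have "a * b' = a' * b" using ab' a b by (simp add: field_simps)
  hence "int_ord K P a + int_ord K P b' = int_ord K P a' + int_ord K P b"
    using int_ord_mult[OF a ab'(3,4)] int_ord_mult[OF ab'(1,2) b] by simp
  thus "k = int (int_ord K P a) - int (int_ord K P b)" using ab'(6) by simp
qed (use a b in blast)

end

section \<open>Integrality from local orders, finiteness of poles, denominators\<close>

context number_field
begin

text \<open>If multiplication by \<open>y\<close> mapped \<open>P\<close> into itself, all
  \<open>y ^ n * a\<close> with \<open>a\<close> in \<open>P\<close> would be integral, and so would
  \<open>y\<close>.\<close>

lemma ex_uniformized_place:
  assumes P: "max_ideal P"
  obtains y \<pi> where "uniformized_place K P y \<pi>"
proof -
  note Pi = max_ideal_is_ideal[OF P]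
  obtain y where y: "y \<in> K" "y \<notin> OK" "\<And>p. p \<in> P \<Longrightarrow> y * p \<in> OK" using ex_inverse_element[OF P] by metis
  obtain a where a: "a \<in> P" "a \<noteq> 0" using max_ideal_nonzero[OF P] .
  have "\<exists>\<pi>\<in>P. y * \<pi> \<notin> P"
  proof (rule ccontr)
    assume "\<not> ?thesis"
    hence yP: "y * p \<in> P" if "p \<in> P" for p using that by blast
    have "y ^ n * a \<in> P" for n
      by (induction n) (use a(1) yP in \<open>auto simp: mult.assoc\<close>)
    hence "y \<in> OK"
      using is_ideal_OK[OF Pi] by (intro OK_if_powers_bounded[OF y(1) _ a(2)]) (auto simp: a(1))
    thus False using y(2) by simp
  qed
  then obtain \<pi> where "\<pi> \<in> P" "y * \<pi> \<notin> P" by blast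
  thus ?thesis
    using y P by (intro that[of y \<pi>] uniformized_place.intro uniformized_place_axioms.intro number_field_axioms) auto
qed

lemma ex_fraction:
  assumes "x \<in> K" "x \<noteq> 0"
  obtains a b where "a \<in> OK" "a \<noteq> 0" "b \<in> OK" "b \<noteq> 0" "x = a / b"
proof -
  obtain c :: nat where c: "c > 0" "of_nat c * x \<in> OK" using K_multiple_in_OK[OF assms(1)] .
  thus ?thesis using assms(2) by (intro that[of "of_nat c * x" "of_nat c"]) (auto simp: OK_of_nat)
qed

text \<open>The denominators of \<open>x\<close> form an ideal \<open>I\<close> containing a
  positive integer. If \<open>x\<close> is not integral, \<open>I\<close> is proper and lies in a
  maximal ideal \<open>P\<close>; but nonnegative order at \<open>P\<close> yields a denominator
  \<open>r' * t\<close> outside \<open>P\<close>.\<close>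

lemma OK_if_place_ord_nonneg:
  assumes x: "x \<in> K" "x \<noteq> 0" and ord: "\<And>P. max_ideal P \<Longrightarrow> place_ord K P x \<ge> 0"
  shows "x \<in> OK"
proof (rule ccontr)
  assume "x \<notin> OK"
  obtain a b where ab: "a \<in> OK" "a \<noteq> 0" "b \<in> OK" "b \<noteq> 0" "x = a / b" using ex_fraction[OF x] .
  obtain c :: nat where c: "c > 0" "of_nat c * x \<in> OK" using K_multiple_in_OK[OF x(1)] .
  define I where "I = {t \<in> OK. t * x \<in> OK}"
  have "is_ideal I"
    by (auto simp: I_def is_ideal_def distrib_right mult.assoc intro: OK_intros)
  moreover have "1 \<notin> I" using \<open>x \<notin> OK\<close> by (simp add: I_def)
  moreover have "of_nat c \<in> I" using c by (simp add: I_def OK_of_nat)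
  ultimately obtain P where P: "max_ideal P" "I \<subseteq> P" using ex_max_ideal[OF _ _ c(1)] by blast
  obtain y \<pi> where "uniformized_place K P y \<pi>" using ex_uniformized_place[OF P(1)] .
  then interpret uniformized_place K P y \<pi> .
  obtain t r where tr: "t \<in> OK - P" "r \<in> OK - P" "t * a = r * \<pi> ^ int_ord K P a"
    using int_ord_decomp[OF ab(1,2)] .
  obtain t' r' where tr': "t' \<in> OK - P" "r' \<in> OK - P" "t' * b = r' * \<pi> ^ int_ord K P b"
    using int_ord_decomp[OF ab(3,4)] .
  have "int_ord K P a \<ge> int_ord K P b"
    using ord[OF P(1)] unfolding ab(5) place_ord_divide[OF ab(1-4)] by simp
  then obtain k where k: "int_ord K P a = int_ord K P b + k" by (metis le_iff_add)
  have "r' * t * x * (\<pi> ^ int_ord K P b * b) = (t * a) * (r' * \<pi> ^ int_ord K P b)"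
    using ab(4,5) by (simp add: field_simps)
  also have "\<dots> = (r * \<pi> ^ (int_ord K P b + k)) * (t' * b)" unfolding tr(3) tr'(3) k ..
  also have "\<dots> = (r * t' * \<pi> ^ k) * (\<pi> ^ int_ord K P b * b)" by (simp add: power_add mult_ac)
  finally have "r' * t * x = r * t' * \<pi> ^ k" using ab(4) \<pi>_nonzero by simp
  also have "\<dots> \<in> OK" using tr(2) tr'(1) by (intro OK_intros \<pi>_OK) auto
  finally have "r' * t \<in> I" using tr(1) tr'(2) by (simp add: I_def OK_mult)
  thus False using P(2) max_ideal_prime[OF P(1), of r' t] tr(1) tr'(2) by blast
qed

text \<open>Such an ideal is recovered from its intersection with the finite set \<open>T\<close> of
  representatives modulo \<open>N\<close>.\<close>

lemma finite_max_ideals_containing: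
  assumes N: "(N::nat) > 0"
  shows "finite {P. max_ideal P \<and> of_nat N \<in> P}"
proof -
  obtain T where T: "finite T" "T \<subseteq> OK" "\<And>r. r \<in> OK \<Longrightarrow> \<exists>t\<in>T. \<exists>s\<in>OK. r = t + of_nat N * s"
    using finite_index[OF N(1)] by metis
  have sub: "P \<subseteq> P'" if P: "max_ideal P" "of_nat N \<in> P" and P': "max_ideal P'" "of_nat N \<in> P'" and eq: "P \<inter> T = P' \<inter> T" for P P'
  proof
    fix x assume x: "x \<in> P"
    note Pi = max_ideal_is_ideal[OF P(1)] and Pi' = max_ideal_is_ideal[OF P'(1)]
    obtain t s where ts: "t \<in> T" "s \<in> OK" "x = t + of_nat N * s" using T(3) is_ideal_OK[OF Pi x] by blast
    have "t = x - of_nat N * s" using ts(3) by simp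
    also have "\<dots> \<in> P" by (intro is_ideal_diff[OF Pi] x is_ideal_mult_right[OF Pi] P ts)
    finally have "t \<in> P'" using ts(1) eq by blast
    thus "x \<in> P'" unfolding ts(3) by (intro is_ideal_add[OF Pi'] is_ideal_mult_right[OF Pi'] P' ts)
  qed
  hence "inj_on (\<lambda>P. P \<inter> T) {P. max_ideal P \<and> of_nat N \<in> P}"
    by (intro inj_onI) (use sub in blast)
  moreover have "(\<lambda>P. P \<inter> T) ` {P. max_ideal P \<and> of_nat N \<in> P} \<subseteq> Pow T" by auto
  ultimately show ?thesis using T(1) by (meson finite_Pow_iff finite_imageD finite_subset)
qed

lemma finite_int_ord_pos:
  assumes a: "a \<in> OK" "a \<noteq> 0"
  shows "finite {P. max_ideal P \<and> int_ord K P a > 0}"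
proof -
  obtain N b where N: "N > 0" "b \<in> OK" "of_nat N = a * b" using OK_dvd_nat[OF a] .
  have "of_nat N \<in> P" if P: "max_ideal P" "int_ord K P a > 0" for P
  proof -
    obtain y \<pi> where "uniformized_place K P y \<pi>" using ex_uniformized_place[OF P(1)] .
    then interpret uniformized_place K P y \<pi> .
    show ?thesis using is_ideal_mult_right[OF ideal_P int_ord_pos[OF a P(2)] N(2)] N(3) by simp
  qed
  thus ?thesis by (intro finite_subset[OF _ finite_max_ideals_containing[OF N(1)]]) auto
qed

lemma finite_place_ord_neg:
  assumes x: "x \<in> K" "x \<noteq> 0"
  shows "finite {P. max_ideal P \<and> place_ord K P x < 0}"
proof -
  obtain a b where ab: "a \<in> OK" "a \<noteq> 0" "b \<in> OK" "b \<noteq> 0" "x = a / b" using ex_fraction[OF x] .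
  have "int_ord K P b > 0" if P: "max_ideal P" "place_ord K P x < 0" for P
  proof -
    obtain y \<pi> where "uniformized_place K P y \<pi>" using ex_uniformized_place[OF P(1)] .
    then interpret uniformized_place K P y \<pi> .
    show ?thesis using P(2) unfolding ab(5) place_ord_divide[OF ab(1-4)] by linarith
  qed
  thus ?thesis by (intro finite_subset[OF _ finite_int_ord_pos[OF ab(3,4)]]) auto
qed

text \<open>The witness is the residue characteristic, the least positive integer in
  \<open>P\<close>: smaller natural numbers lie in distinct cosets. It supplies an integer in
  \<open>P\<close> whose logarithm is at most the weight of \<open>P\<close> in the height.\<close>

lemma residue_field_card:
  assumes P: "max_ideal P"
  obtains p :: nat where "p > 0" "of_nat p \<in> P" "p \<le> card (carrier (ring_of_integers K Quot P))"
proof -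
  note Pi = max_ideal_is_ideal[OF P]
  define coset where "coset = (\<lambda>a. {h + a | h. h \<in> P})"
  have carr: "carrier (ring_of_integers K Quot P) = coset ` OK"
    by (auto simp: FactRing_def A_RCOSETS_def RCOSETS_def r_coset_def coset_def)
  obtain N :: nat where N: "N > 0" "of_nat N \<in> P" using max_ideal_nat[OF P] .
  obtain T where T: "finite T" "T \<subseteq> OK" "\<And>r. r \<in> OK \<Longrightarrow> \<exists>t\<in>T. \<exists>s\<in>OK. r = t + of_nat N * s"
    using finite_index[OF N(1)] by metis
  have coset_eqI: "coset a = coset b" if "a - b \<in> P" for a b
  proof -
    have sub: "coset a \<subseteq> coset b" if "a - b \<in> P" for a b
    proof
      fix x assume "x \<in> coset a"
      then obtain h where h: "x = h + a" "h \<in> P" by (auto simp: coset_def)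
      have "x = (h + (a - b)) + b" using h by simp
      thus "x \<in> coset b" using is_ideal_add[OF Pi h(2) that] unfolding coset_def by blast
    qed
    have "b - a \<in> P" using is_ideal_diff[OF Pi is_ideal_0[OF Pi] that] by simp
    thus ?thesis using sub that by blast
  qed
  have coset_eqD: "a - b \<in> P" if "coset a = coset b" for a b
  proof -
    have "a \<in> coset a" using is_ideal_0[OF Pi] by (force simp: coset_def)
    hence "a \<in> coset b" using that by simp
    thus ?thesis by (auto simp: coset_def)
  qed
  have "coset ` OK \<subseteq> coset ` T"
  proof safe
    fix r assume "r \<in> OK"
    then obtain t s where ts: "t \<in> T" "s \<in> OK" "r = t + of_nat N * s" using T(3) by blast
    have "r - t \<in> P" using ts is_ideal_mult_right[OF Pi N(2)] by simp
    thus "coset r \<in> coset ` T" using coset_eqI ts(1) by blast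
  qed
  \<comment> \<open>Finiteness matters for the lower bound: the \<open>card\<close> of an infinite
    set is 0.\<close>
  hence fin: "finite (coset ` OK)" using T(1) by (meson finite_imageI finite_subset)
  define p where "p = (LEAST p::nat. p > 0 \<and> of_nat p \<in> P)"
  have p: "p > 0 \<and> of_nat p \<in> P" unfolding p_def by (rule LeastI[of _ N]) (use N in auto)
  have least: "p \<le> m" if "m > 0" "of_nat m \<in> P" for m
    unfolding p_def by (rule Least_le) (use that in auto)
  have "inj_on (\<lambda>i. coset (of_nat i)) {..<p}"
  proof (rule linorder_inj_onI)
    fix i j assume ij: "i < j" "i \<in> {..<p}" "j \<in> {..<p}"
    show "coset (of_nat i) \<noteq> coset (of_nat j)"
    proof
      assume "coset (of_nat i) = coset (of_nat j)"
      hence "of_nat j - of_nat i \<in> P" using coset_eqD by metis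
      hence "of_nat (j - i) \<in> P" using ij(1) by (simp add: of_nat_diff)
      thus False using least[of "j - i"] ij by auto
    qed
  qed auto
  hence "p \<le> card (coset ` OK)"
    using card_inj_on_le[of "\<lambda>i. coset (of_nat i)" "{..<p}" "coset ` OK"] fin OK_of_nat by auto
  thus ?thesis using that p carr by auto
qed

text \<open>At each place in \<open>F\<close> the number \<open>x\<close> has a pole, of order
  \<open>k P\<close>; the factor \<open>p P ^ k P\<close> of \<open>c\<close> clears it. Since
  \<open>p P\<close> is at most the size of the residue field, the logarithm of this factor is at
  most the contribution of \<open>P\<close> to the height.\<close>

lemma ex_denominator:
  assumes x: "x \<in> K"
  obtains c :: nat where "c > 0" "of_nat c * x \<in> OK"
    "ln (real c) \<le> (\<Sum>\<^sub>\<infinity>P\<in>finite_places K. ln (max 1 (place_abs K P x)))"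
proof (cases "x = 0")
  case True
  show ?thesis by (rule that[of 1]) (auto simp: True OK_0 place_abs_def)
next
  case False
  define F where "F = {P. max_ideal P \<and> place_ord K P x < 0}"
  have F: "finite F" unfolding F_def by (rule finite_place_ord_neg[OF x False])
  define q where "q = (\<lambda>P. card (carrier (ring_of_integers K Quot P)))"
  have "\<exists>p::nat. p > 0 \<and> of_nat p \<in> P \<and> p \<le> q P" if "max_ideal P" for P
    by (rule residue_field_card[OF that]) (auto simp: q_def)
  then obtain p :: "complex set \<Rightarrow> nat" where p: "\<And>P. max_ideal P \<Longrightarrow> p P > 0 \<and> of_nat (p P) \<in> P \<and> p P \<le> q P"
    by metis
  define k where "k = (\<lambda>P. nat (- place_ord K P x))"
  define c where "c = (\<Prod>P\<in>F. p P ^ k P)"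
  have c: "c > 0" unfolding c_def using p by (auto simp: F_def intro!: prod_pos)
  have place: "place_abs K P x = real (q P) powi (- place_ord K P x)" for P
    using False by (simp add: place_abs_def q_def)
  \<comment> \<open>Outside \<open>F\<close> the absolute value is at most 1, which turns the sum
    over all places into a finite one.\<close>
  have "ln (max 1 (place_abs K P x)) = 0" if "P \<in> finite_places K - F" for P
  proof -
    have P: "max_ideal P" "place_ord K P x \<ge> 0" using that by (auto simp: finite_places_eq F_def)
    have "real (q P) \<ge> 1" using p[OF P(1)] by linarith
    hence "real (q P) powi (- place_ord K P x) \<le> 1"
      using P(2) by (auto simp: power_int_minus power_int_def field_simps)
    thus ?thesis by (simp add: place max_def)
  qed
  hence "(\<Sum>\<^sub>\<infinity>P\<in>finite_places K. ln (max 1 (place_abs K P x))) = (\<Sum>\<^sub>\<infinity>P\<in>F. ln (max 1 (place_abs K P x)))"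
    by (intro infsum_cong_neutral) (auto simp: F_def finite_places_eq)
  also have "\<dots> = (\<Sum>P\<in>F. ln (max 1 (place_abs K P x)))" using F by simp
  finally have sum: "(\<Sum>\<^sub>\<infinity>P\<in>finite_places K. ln (max 1 (place_abs K P x))) = \<dots>" .
  have "ln (real c) = (\<Sum>P\<in>F. ln (real (p P) ^ k P))"
    unfolding c_def of_nat_prod of_nat_power using F p by (intro ln_prod) (auto simp: F_def)
  also have "\<dots> \<le> (\<Sum>P\<in>F. ln (max 1 (place_abs K P x)))"
  proof (rule sum_mono)
    fix P assume "P \<in> F"
    hence P: "max_ideal P" "place_ord K P x < 0" by (auto simp: F_def)
    have "real (p P) ^ k P \<le> real (q P) ^ k P" using p[OF P(1)] by (intro power_mono) auto
    also have "\<dots> = place_abs K P x" using P(2) by (simp add: place power_int_def k_def)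
    finally show "ln (real (p P) ^ k P) \<le> ln (max 1 (place_abs K P x))"
      using p[OF P(1)] by (subst ln_le_cancel_iff) auto
  qed
  finally have ln_c: "ln (real c) \<le> (\<Sum>\<^sub>\<infinity>P\<in>finite_places K. ln (max 1 (place_abs K P x)))" by (simp add: sum)
  have "of_nat c * x \<in> OK"
  proof (rule OK_if_place_ord_nonneg)
    show "of_nat c * x \<in> K" by (intro mult_in of_nat_in x)
    show "of_nat c * x \<noteq> 0" using c False by simp
    fix P assume P: "max_ideal P"
    obtain y \<pi> where "uniformized_place K P y \<pi>" using ex_uniformized_place[OF P] .
    then interpret uniformized_place K P y \<pi> .
    obtain a b where ab: "a \<in> OK" "a \<noteq> 0" "b \<in> OK" "b \<noteq> 0" "x = a / b" using ex_fraction[OF x False] .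
    have c0: "of_nat c \<in> OK" "of_nat c \<noteq> (0::complex)" using c by (auto simp: OK_of_nat)
    have "place_ord K P (of_nat c * x) = int (int_ord K P (of_nat c)) + place_ord K P x"
      using place_ord_divide[OF OK_mult[OF c0(1) ab(1)] _ ab(3,4)] place_ord_divide[OF ab(1-4)]
        int_ord_mult[OF c0 ab(1,2)] c0(2) ab(2)
      by (simp add: ab(5))
    moreover have "int (int_ord K P (of_nat c)) \<ge> - place_ord K P x"
    proof (cases "P \<in> F")
      case True
      \<comment> \<open>The other factors of \<open>c\<close> are integers, so the factor belonging
        to \<open>P\<close> alone puts \<open>c\<close> into the required power of
        \<open>P\<close>.\<close>
      have "(of_nat c :: complex) = of_nat (p P) ^ k P * of_nat (\<Prod>P\<in>F - {P}. p P ^ k P)"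
        unfolding c_def prod.remove[OF F True] by simp
      also have "\<dots> \<in> ideal_pow P (k P)"
        using p[OF P] by (intro is_ideal_mult_right[OF is_ideal_ideal_pow[OF ideal_P]] power_in_ideal_pow OK_of_nat) auto
      finally have "k P \<le> int_ord K P (of_nat c)" by (intro int_ord_ge c0)
      thus ?thesis by (simp add: k_def)
    next
      case False
      thus ?thesis using P by (simp add: F_def)
    qed
    ultimately show "place_ord K P (of_nat c * x) \<ge> 0" by simp
  qed
  thus ?thesis using that c ln_c by blast
qed

end

section \<open>Finite-dimensional algebras of algebraic numbers\<close>

lemma Q_span_mult:
  assumes "a \<in> Q.span A" "b \<in> Q.span B"
  shows "a * b \<in> Q.span ((\<lambda>(a, b). a * b) ` (A \<times> B))"
  using assms(1)
proof (induction a rule: Q.span_induct_alt)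
  case base
  show ?case by (simp add: Q.span_zero)
next
  case (step c x y)
  have "x * b \<in> Q.span ((\<lambda>(a, b). a * b) ` (A \<times> B))"
    using assms(2)
  proof (induction b rule: Q.span_induct_alt)
    case base
    show ?case by (simp add: Q.span_zero)
  next
    case (step c' x' y')
    have "x * x' \<in> Q.span ((\<lambda>(a, b). a * b) ` (A \<times> B))"
      using \<open>x \<in> A\<close> step by (intro Q.span_base) force
    moreover have "x * (of_rat c' * x' + y') = of_rat c' * (x * x') + x * y'" by (simp add: algebra_simps)
    ultimately show ?case using step by (simp add: Q.span_add Q.span_scale)
  qed
  moreover have "(of_rat c * x + y) * b = of_rat c * (x * b) + y * b" by (simp add: algebra_simps)
  ultimately show ?case using step by (simp add: Q.span_add Q.span_scale)
qed

text \<open>Inverses come for free, since a finite-dimensional domain over the rationals is a field.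
  This makes number fields available as spans of products.\<close>

locale finite_algebra =
  fixes S :: "complex set"
  assumes subspace: "Q.subspace S"
    and one: "1 \<in> S"
    and mult: "x \<in> S \<Longrightarrow> y \<in> S \<Longrightarrow> x * y \<in> S"
    and fin_dim: "\<exists>B. finite B \<and> S \<subseteq> Q.span B"
begin

lemma power: "x \<in> S \<Longrightarrow> x ^ n \<in> S"
  by (induction n) (auto intro: one mult)

lemma inverse:
  assumes u: "u \<in> S"
  shows "inverse u \<in> S"
proof (cases "u = 0")
  case True
  thus ?thesis using Q.subspace_0[OF subspace] by simp
next
  case False
  obtain B where B: "finite B" "S \<subseteq> Q.span B" using fin_dim by blast
  obtain r where r: "\<exists>i\<le>card B. r i \<noteq> 0" "(\<Sum>i\<le>card B. of_rat (r i) * u ^ i) = 0"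
    by (rule rat_dependence[OF B(1) order_refl, of "\<lambda>i. u ^ i"]) (use power[OF u] B(2) in blast)+
  \<comment> \<open>Dividing the relation by \<open>u ^ j\<close>, where \<open>j\<close> is the
    lowest index with nonzero coefficient, leaves a nonzero rational constant plus
    \<open>u * w\<close>, so \<open>w\<close> is a rational multiple of the inverse.\<close>
  define j where "j = (LEAST i. r i \<noteq> 0)"
  have j: "r j \<noteq> 0" unfolding j_def using r(1) by (metis (mono_tags, lifting) LeastI)
  have less_j: "r i = 0" if "i < j" for i using not_less_Least[of i "\<lambda>i. r i \<noteq> 0"] that by (auto simp: j_def)
  have "j \<le> card B" using r(1) less_j by (meson le_less_trans not_le order_trans)
  define w where "w = (\<Sum>i\<in>{Suc j..card B}. of_rat (r i) * u ^ (i - Suc j))"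
  have "w \<in> S" unfolding w_def
    by (intro Q.subspace_sum[OF subspace] Q.subspace_scale[OF subspace] power u)
  have "0 = (\<Sum>i\<in>{..card B}. of_rat (r i) * u ^ i)" using r(2) by simp
  also have "\<dots> = (\<Sum>i\<in>{j..card B}. of_rat (r i) * u ^ i)"
    by (rule sum.mono_neutral_right) (auto simp: less_j not_le)
  also have "\<dots> = of_rat (r j) * u ^ j + (\<Sum>i\<in>{Suc j..card B}. of_rat (r i) * u ^ i)"
    using \<open>j \<le> card B\<close> by (rule sum.atLeast_Suc_atMost)
  also have "(\<Sum>i\<in>{Suc j..card B}. of_rat (r i) * u ^ i) = u ^ Suc j * w"
    unfolding w_def sum_distrib_left
  proof (rule sum.cong)
    fix i assume "i \<in> {Suc j..card B}"
    hence "u ^ i = u ^ Suc j * u ^ (i - Suc j)" by (simp flip: power_add del: power_Suc)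
    thus "of_rat (r i) * u ^ i = u ^ Suc j * (of_rat (r i) * u ^ (i - Suc j))" by simp
  qed simp
  finally have "u ^ j * (of_rat (r j) + u * w) = 0" by (simp add: algebra_simps)
  hence "of_rat (r j) + u * w = 0" using False by simp
  hence "u * w = - of_rat (r j)" by (simp add: eq_neg_iff_add_eq_0 add.commute)
  hence "- inverse (of_rat (r j)) * w = inverse u"
    using False j by (simp add: field_simps)
  hence "of_rat (- inverse (r j)) * w = inverse u"
    by (simp only: of_rat_minus of_rat_inverse)
  moreover have "of_rat (- inverse (r j)) * w \<in> S"
    using Q.subspace_scale[OF subspace \<open>w \<in> S\<close>] .
  ultimately show ?thesis by simp
qed

lemma number_field: "number_field S"
  by unfold_locales (auto intro: one mult inverse fin_dim Q.subspace_diff[OF subspace])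

end

lemma finite_algebra_rat: "finite_algebra (Q.span {1})"
proof
  fix x y assume "x \<in> Q.span {1}" "y \<in> Q.span {1}"
  from Q_span_mult[OF this] show "x * y \<in> Q.span {1}" by simp
qed (auto intro: Q.span_base)

text \<open>An integral multiple \<open>\<beta>\<close> of \<open>\<alpha>\<close> satisfies a monic
  relation; rescaled, it expresses \<open>\<alpha> ^ m\<close> by lower powers, whose rational span
  is then stable under multiplication by \<open>\<alpha>\<close>.\<close>

lemma algebraic_powers_in_span:
  assumes "algebraic \<alpha>"
  obtains e where "\<And>i. \<alpha> ^ i \<in> Q.span ((\<lambda>j. \<alpha> ^ j) ` {..<e})"
proof -
  obtain c :: nat where c: "c > 0" "algebraic_int (of_nat c * \<alpha>)" using algebraic_int_multiple[OF assms] .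
  define \<beta> where "\<beta> = of_nat c * \<alpha>"
  obtain m where m: "m > 0" "\<beta> ^ m \<in> Z.span ((\<lambda>i. \<beta> ^ i) ` {..<m})"
    using algebraic_int_power_in_span[OF c(2)] by (metis \<beta>_def)
  define V where "V = Q.span ((\<lambda>j. \<alpha> ^ j) ` {..<m})"
  have \<beta>V: "\<beta> ^ i \<in> V" if "i < m" for i
  proof -
    have "\<beta> ^ i = of_rat (of_nat c ^ i) * \<alpha> ^ i" by (simp add: \<beta>_def power_mult_distrib of_rat_power)
    also have "\<dots> \<in> V" unfolding V_def using that by (intro Q.span_scale Q.span_base) auto
    finally show ?thesis .
  qed
  have "t \<in> V" if "t \<in> Z.span ((\<lambda>i. \<beta> ^ i) ` {..<m})" for t
    using that
  proof (induction t rule: Z.span_induct_alt)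
    case base
    show ?case by (simp add: V_def Q.span_zero)
  next
    case (step k x y)
    have "of_int k * x = of_rat (of_int k) * x" by simp
    thus ?case using step \<beta>V unfolding V_def by (metis Q.span_add Q.span_scale imageE lessThan_iff)
  qed
  hence "\<beta> ^ m \<in> V" using m(2) by blast
  moreover have "\<alpha> ^ m = of_rat (inverse (of_nat c ^ m)) * \<beta> ^ m"
    using c(1) by (simp add: \<beta>_def power_mult_distrib of_rat_power of_rat_inverse)
  ultimately have \<alpha>m: "\<alpha> ^ m \<in> V" unfolding V_def by (simp only: Q.span_scale)
  have step: "\<alpha> * t \<in> V" if "t \<in> V" for t
    using that unfolding V_def
  proof (induction t rule: Q.span_induct_alt)
    case base
    show ?case by (simp add: Q.span_zero)
  next
    case (step k x y)
    then obtain j where j: "x = \<alpha> ^ j" "j < m" by auto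
    have "\<alpha> * x \<in> V"
    proof (cases "Suc j = m")
      case True
      thus ?thesis using \<alpha>m j(1) by auto
    next
      case False
      thus ?thesis unfolding V_def using j by (intro Q.span_base) (auto intro!: image_eqI[of _ _ "Suc j"])
    qed
    moreover have "\<alpha> * (of_rat k * x + y) = of_rat k * (\<alpha> * x) + \<alpha> * y" by (simp add: algebra_simps)
    ultimately show ?case using step by (simp add: V_def Q.span_add Q.span_scale)
  qed
  have "\<alpha> ^ i \<in> V" for i
  proof (induction i)
    case 0
    show ?case unfolding V_def using m(1) by (intro Q.span_base) (auto intro!: image_eqI[of _ _ 0])
  qed (use step in auto)
  thus ?thesis using that[of m] by (simp add: V_def)
qed

text \<open>The products \<open>s * \<alpha> ^ i\<close> are closed under multiplication, and their
  span is finite-dimensional because finitely many powers of \<open>\<alpha>\<close> span the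
  others.\<close>

lemma finite_algebra_adjoin:
  assumes S: "finite_algebra S" and \<alpha>: "algebraic \<alpha>"
  obtains S' where "finite_algebra S'" "S \<subseteq> S'" "\<alpha> \<in> S'"
proof -
  interpret finite_algebra S by fact
  define A where "A = range (\<lambda>i::nat. \<alpha> ^ i)"
  define G where "G = (\<lambda>(s, t). s * t) ` (S \<times> A)"
  obtain e where e: "\<And>i. \<alpha> ^ i \<in> Q.span ((\<lambda>j. \<alpha> ^ j) ` {..<e})" using algebraic_powers_in_span[OF \<alpha>] by blast
  obtain B where B: "finite B" "S \<subseteq> Q.span B" using fin_dim by blast
  show ?thesis
  proof (rule that[of "Q.span G"])
    have in_G: "s * \<alpha> ^ i \<in> G" if "s \<in> S" for s i using that by (force simp: G_def A_def)
    show "S \<subseteq> Q.span G" using in_G[of _ 0] by (auto intro: Q.span_base)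
    show "\<alpha> \<in> Q.span G" using in_G[OF one, of 1] by (auto intro: Q.span_base)
    show "finite_algebra (Q.span G)"
    proof
      show "Q.subspace (Q.span G)" by (rule Q.subspace_span)
      show "1 \<in> Q.span G" using in_G[OF one, of 0] by (auto intro: Q.span_base)
      fix x y assume "x \<in> Q.span G" "y \<in> Q.span G"
      from Q_span_mult[OF this] have "x * y \<in> Q.span ((\<lambda>(a, b). a * b) ` (G \<times> G))" .
      also have "(\<lambda>(a, b). a * b) ` (G \<times> G) \<subseteq> G"
      proof safe
        fix g g' assume "g \<in> G" "g' \<in> G"
        then obtain s i s' i' where *: "g = s * \<alpha> ^ i" "g' = s' * \<alpha> ^ i'" "s \<in> S" "s' \<in> S"
          by (auto simp: G_def A_def)
        have "g * g' = (s * s') * \<alpha> ^ (i + i')" unfolding * by (simp add: power_add mult_ac)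
        thus "g * g' \<in> G" using in_G[OF mult[OF *(3,4)]] by simp
      qed
      hence "Q.span ((\<lambda>(a, b). a * b) ` (G \<times> G)) \<subseteq> Q.span G" by (rule Q.span_mono)
      finally show "x * y \<in> Q.span G" .
    next
      define B' where "B' = (\<lambda>(a, b). a * b) ` (B \<times> (\<lambda>j. \<alpha> ^ j) ` {..<e})"
      have "G \<subseteq> Q.span B'"
        unfolding G_def A_def B'_def using B(2) e by (auto intro!: Q_span_mult)
      hence "Q.span G \<subseteq> Q.span B'" by (simp add: Q.span_minimal)
      moreover have "finite B'" using B(1) by (simp add: B'_def)
      ultimately show "\<exists>B. finite B \<and> Q.span G \<subseteq> Q.span B" by blast
    qed
  qed
qed

lemma finite_algebra_contains:
  assumes "finite A" "\<And>\<alpha>. \<alpha> \<in> A \<Longrightarrow> algebraic \<alpha>"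
  obtains S where "finite_algebra S" "A \<subseteq> S"
  using assms
proof (induction A arbitrary: thesis rule: finite_induct)
  case empty
  show ?case using empty(1) finite_algebra_rat by blast
next
  case (insert \<alpha> A)
  obtain S where S: "finite_algebra S" "A \<subseteq> S" using insert.IH insert.prems(2) by blast
  obtain S' where "finite_algebra S'" "S \<subseteq> S'" "\<alpha> \<in> S'"
    using finite_algebra_adjoin[OF S(1)] insert.prems(2) by blast
  thus ?case using insert.prems(1) S(2) by blast
qed

section \<open>Rational polynomials and the minimal polynomial\<close>

abbreviation rat_eval :: "rat poly \<Rightarrow> complex \<Rightarrow> complex" where
  "rat_eval p x \<equiv> poly (map_poly of_rat p) x"

lemma rat_eval_simps [simp]:
  "rat_eval 0 x = 0" "rat_eval 1 x = 1"
  "rat_eval (p + q) x = rat_eval p x + rat_eval q x"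
  "rat_eval (p - q) x = rat_eval p x - rat_eval q x"
  "rat_eval (p * q) x = rat_eval p x * rat_eval q x"
  "rat_eval (pCons c p) x = of_rat c + x * rat_eval p x"
  "rat_eval (Polynomial.smult c p) x = of_rat c * rat_eval p x"
proof -
  have "map_poly of_rat (p + q) = (map_poly of_rat p + map_poly of_rat q :: complex poly)"
    "map_poly of_rat (p - q) = (map_poly of_rat p - map_poly of_rat q :: complex poly)"
    "map_poly of_rat (p * q) = (map_poly of_rat p * map_poly of_rat q :: complex poly)"
    "map_poly of_rat (Polynomial.smult c p) = (Polynomial.smult (of_rat c) (map_poly of_rat p) :: complex poly)"
    by (rule poly_eqI, simp add: coeff_map_poly Polynomial.coeff_mult of_rat_add of_rat_diff of_rat_mult of_rat_sum)+
  thus "rat_eval (p + q) x = rat_eval p x + rat_eval q x"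
    "rat_eval (p - q) x = rat_eval p x - rat_eval q x"
    "rat_eval (p * q) x = rat_eval p x * rat_eval q x"
    "rat_eval (Polynomial.smult c p) x = of_rat c * rat_eval p x" by simp_all
  show "rat_eval (pCons c p) x = of_rat c + x * rat_eval p x" by (cases "pCons c p = 0") (auto simp: map_poly_pCons)
qed simp_all

lemma ex_minimal_polynomial:
  assumes "algebraic x"
  obtains g :: "rat poly" where "Polynomial.lead_coeff g = 1" "rat_eval g x = 0"
    "\<And>p. rat_eval p x = 0 \<Longrightarrow> g dvd p"
proof -
  obtain p where p: "\<And>i. Polynomial.coeff p i \<in> \<rat>" "p \<noteq> 0" "poly p x = 0"
    using assms unfolding algebraic_altdef by auto
  obtain q1 where "p = map_poly of_rat q1" using ratpolyE[OF p(1)] .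
  hence "q1 \<noteq> 0 \<and> rat_eval q1 x = 0" using p(2,3) by auto
  from ex_has_least_nat[of "\<lambda>q. q \<noteq> 0 \<and> rat_eval q x = 0", OF this, of Polynomial.degree]
  obtain q0 where q0: "q0 \<noteq> 0" "rat_eval q0 x = 0"
    "\<And>q. q \<noteq> 0 \<Longrightarrow> rat_eval q x = 0 \<Longrightarrow> Polynomial.degree q0 \<le> Polynomial.degree q"
    by blast
  define g where "g = Polynomial.smult (inverse (Polynomial.lead_coeff q0)) q0"
  show ?thesis
  proof (rule that[of g])
    show "Polynomial.lead_coeff g = 1" using q0(1) by (simp add: g_def)
    show root: "rat_eval g x = 0" using q0(2) by (simp add: g_def)
    fix p assume p: "rat_eval p x = 0"
    have g0: "g \<noteq> 0" "Polynomial.degree g = Polynomial.degree q0" using q0(1) by (auto simp: g_def)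
    have "rat_eval (p mod g) x = rat_eval (p - g * (p div g)) x" by (simp add: minus_mult_div_eq_mod)
    also have "\<dots> = 0" using p root by simp
    finally have "p mod g = 0 \<or> Polynomial.degree g \<le> Polynomial.degree (p mod g)" using q0(3) g0(2) by metis
    thus "g dvd p" using degree_mod_less[OF g0(1), of p] by auto
  qed
qed

section \<open>Embeddings and bounds from the height\<close>

lemma (in number_field) of_rat_in: "of_rat q \<in> K"
proof -
  have "of_rat q = (of_int (fst (quotient_of q)) / of_int (snd (quotient_of q)) :: complex)"
  proof -
    have "q = of_int (fst (quotient_of q)) / of_int (snd (quotient_of q))"
      by (rule quotient_of_div) simp
    hence "(of_rat q :: complex) = of_rat (of_int (fst (quotient_of q)) / of_int (snd (quotient_of q)))" by simp
    thus ?thesis by (simp add: of_rat_divide)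
  qed
  thus ?thesis using divide_in[OF of_int_in of_int_in] by simp
qed

lemma (in number_field) generate_field_subset:
  assumes "x \<in> K"
  shows "generate_field complex_ring {x} \<subseteq> K"
proof
  fix h assume "h \<in> generate_field complex_ring {x}"
  thus "h \<in> K"
    by (induction rule: generate_field.induct)
      (auto simp: assms complex_ring_m_inv intro: one_in minus_in inverse_in add_in mult_in)
qed

lemma number_field_generate_field:
  assumes "algebraic x"
  shows "number_field (generate_field complex_ring {x})"
proof -
  let ?F = "generate_field complex_ring {x}"
  obtain S where S: "finite_algebra S" "{x} \<subseteq> S"
    by (rule finite_algebra_contains[of "{x}"]) (use assms in auto)
  interpret S: number_field S by (rule finite_algebra.number_field[OF S(1)])
  have one: "1 \<in> ?F" using generate_field.one[of complex_ring "{x}"] by simp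
  have minus: "- a \<in> ?F" if "a \<in> ?F" for a using generate_field.a_inv[OF that] by simp
  have add: "a + b \<in> ?F" if "a \<in> ?F" "b \<in> ?F" for a b using generate_field.eng_add[OF that] by simp
  show ?thesis
  proof
    show "1 \<in> ?F" by (rule one)
    show "a - b \<in> ?F" if "a \<in> ?F" "b \<in> ?F" for a b using add[OF that(1) minus[OF that(2)]] by simp
    show "a * b \<in> ?F" if "a \<in> ?F" "b \<in> ?F" for a b using generate_field.eng_mult[OF that] by simp
    show "inverse a \<in> ?F" if "a \<in> ?F" for a
    proof (cases "a = 0")
      case True
      thus ?thesis using that by simp
    next
      case False
      thus ?thesis using generate_field.m_inv[OF that] by (simp add: complex_ring_m_inv)
    qed
    show "\<exists>B. finite B \<and> ?F \<subseteq> Q.span B"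
    proof -
      obtain B where "finite B" "S \<subseteq> Q.span B" using S.finite_dim by blast
      moreover have "?F \<subseteq> S" using S(2) by (intro S.generate_field_subset) simp
      ultimately show ?thesis by blast
    qed
  qed
qed

text \<open>The values of rational polynomials at \<open>x\<close> form a finite-dimensional
  algebra, hence already a field.\<close>

lemma generate_field_eq:
  assumes "algebraic x"
  shows "generate_field complex_ring {x} = range (\<lambda>p. rat_eval p x)"
proof
  interpret F: number_field "generate_field complex_ring {x}" by (rule number_field_generate_field[OF assms])
  have x: "x \<in> generate_field complex_ring {x}" by (rule generate_field.incl) simp
  have sub: "rat_eval p x \<in> generate_field complex_ring {x}" for p
    by (induction p) (auto intro: F.zero_in F.add_in F.mult_in F.of_rat_in x)
  thus "range (\<lambda>p. rat_eval p x) \<subseteq> generate_field complex_ring {x}" by auto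
  have "finite_algebra (range (\<lambda>p. rat_eval p x))"
  proof
    show "Q.subspace (range (\<lambda>p. rat_eval p x))"
    proof (rule Q.subspaceI)
      show "0 \<in> range (\<lambda>p. rat_eval p x)" by (rule image_eqI[of _ _ 0]) auto
      show "a + b \<in> range (\<lambda>p. rat_eval p x)" if "a \<in> range (\<lambda>p. rat_eval p x)" "b \<in> range (\<lambda>p. rat_eval p x)" for a b
        using that by (auto simp flip: rat_eval_simps(3))
      show "of_rat c * a \<in> range (\<lambda>p. rat_eval p x)" if "a \<in> range (\<lambda>p. rat_eval p x)" for c a
        using that by (auto simp flip: rat_eval_simps(7))
    qed
    show "1 \<in> range (\<lambda>p. rat_eval p x)" by (rule image_eqI[of _ _ 1]) auto
    show "a * b \<in> range (\<lambda>p. rat_eval p x)" if "a \<in> range (\<lambda>p. rat_eval p x)" "b \<in> range (\<lambda>p. rat_eval p x)" for a b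
      using that by (auto simp flip: rat_eval_simps(5))
    obtain B where "finite B" "generate_field complex_ring {x} \<subseteq> Q.span B" using F.finite_dim by blast
    thus "\<exists>B. finite B \<and> range (\<lambda>p. rat_eval p x) \<subseteq> Q.span B" using sub by (intro exI[of _ B]) auto
  qed
  from number_field.generate_field_subset[OF finite_algebra.number_field[OF this], of x]
  show "generate_field complex_ring {x} \<subseteq> range (\<lambda>p. rat_eval p x)"
    by (metis (no_types, lifting) add_0 mult.right_neutral of_rat_0 rangeI rat_eval_simps(2,6))
qed

text \<open>A ring homomorphism fixes the rationals, hence commutes with evaluation of rational
  polynomials; so an embedding is determined by its value at \<open>x\<close>.\<close>

lemma field_embedding_rat_eval:
  assumes x: "algebraic x" and \<sigma>: "\<sigma> \<in> field_embeddings (generate_field complex_ring {x})"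
  shows "\<sigma> (rat_eval p x) = rat_eval p (\<sigma> x)"
proof -
  let ?F = "generate_field complex_ring {x}"
  interpret F: number_field ?F by (rule number_field_generate_field[OF assms(1)])
  have mult: "\<sigma> (a * b) = \<sigma> a * \<sigma> b" and add: "\<sigma> (a + b) = \<sigma> a + \<sigma> b" if "a \<in> ?F" "b \<in> ?F" for a b
    using \<sigma> that by (auto simp: field_embeddings_def Ring.ring_hom_def)
  have one: "\<sigma> 1 = 1" using \<sigma> by (auto simp: field_embeddings_def Ring.ring_hom_def)
  have zero: "\<sigma> 0 = 0" using add[OF F.zero_in F.zero_in] by simp
  have nat: "\<sigma> (of_nat n) = of_nat n" for n
    by (induction n) (auto simp: zero one add F.of_nat_in F.one_in)
  have minus: "\<sigma> (- a) = - \<sigma> a" if "a \<in> ?F" for a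
    using add[OF that F.minus_in[OF that]] zero by (simp add: eq_neg_iff_add_eq_0 add.commute)
  have int: "\<sigma> (of_int n) = of_int n" for n
  proof (cases "n \<ge> 0")
    case True
    then obtain m where "n = int m" using nonneg_int_cases by blast
    thus ?thesis using nat by simp
  next
    case False
    then obtain m where "n = - int m" by (intro that[of "nat (- n)"]) simp
    thus ?thesis using nat minus[OF F.of_nat_in] by simp
  qed
  have rat: "\<sigma> (of_rat q) = of_rat q" for q
  proof -
    obtain a b where q: "q = of_int a / of_int b" "b \<noteq> 0"
      by (metis quotient_of_div prod.collapse quotient_of_denom_pos' less_irrefl)
    have "of_int b * of_rat q = (of_int a :: complex)" using q by (simp add: of_rat_divide)
    hence "\<sigma> (of_int b) * \<sigma> (of_rat q) = \<sigma> (of_int a)" using mult[OF F.of_int_in F.of_rat_in] by metis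
    thus ?thesis using q(2) by (simp add: int q of_rat_divide field_simps)
  qed
  have x_in: "x \<in> ?F" by (rule generate_field.incl) simp
  show ?thesis
  proof (induction p)
    case 0
    show ?case by (simp add: zero)
  next
    case (pCons c p)
    have "rat_eval p x \<in> ?F" using generate_field_eq[OF x] by blast
    thus ?case using pCons by (simp add: add mult rat F.of_rat_in F.mult_in x_in)
  qed
qed

text \<open>Embeddings inject into the roots of the minimal polynomial. Finiteness gives the
  archimedean part of the height its meaning, as a sum over an infinite set would be 0.\<close>

lemma finite_field_embeddings:
  assumes x: "algebraic x"
  shows "finite (field_embeddings (generate_field complex_ring {x}))"
proof -
  let ?F = "generate_field complex_ring {x}"
  obtain g where g: "Polynomial.lead_coeff g = 1" "rat_eval g x = 0" using ex_minimal_polynomial[OF x] by blast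
  have "g \<noteq> 0" using g(1) by auto
  have "map_poly of_rat g \<noteq> (0 :: complex poly)" using \<open>g \<noteq> 0\<close> by (simp add: map_poly_eq_0_iff)
  hence "finite {z. rat_eval g z = 0}" by (rule poly_roots_finite)
  moreover have "(\<lambda>\<sigma>. \<sigma> x) ` field_embeddings ?F \<subseteq> {z. rat_eval g z = 0}"
  proof safe
    fix \<sigma> assume \<sigma>: "\<sigma> \<in> field_embeddings ?F"
    have "\<sigma> 0 = 0" using field_embedding_rat_eval[OF x \<sigma>, of 0] by simp
    thus "rat_eval g (\<sigma> x) = 0" using field_embedding_rat_eval[OF x \<sigma>, of g] g(2) by simp
  qed
  moreover have "inj_on (\<lambda>\<sigma>. \<sigma> x) (field_embeddings ?F)"
  proof (rule inj_onI)
    fix \<sigma> \<tau> assume \<sigma>: "\<sigma> \<in> field_embeddings ?F" and \<tau>: "\<tau> \<in> field_embeddings ?F" and eq: "\<sigma> x = \<tau> x"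
    show "\<sigma> = \<tau>"
    proof (rule extensionalityI)
      show "\<sigma> \<in> extensional ?F" "\<tau> \<in> extensional ?F" using \<sigma> \<tau> by (auto simp: field_embeddings_def)
      fix z assume "z \<in> ?F"
      then obtain p where "z = rat_eval p x" using generate_field_eq[OF x] by auto
      thus "\<sigma> z = \<tau> z"
        using field_embedding_rat_eval[OF x \<sigma>, of p] field_embedding_rat_eval[OF x \<tau>, of p] eq by simp
    qed
  qed
  ultimately show ?thesis by (meson finite_imageD finite_subset)
qed

text \<open>Writing an element as a polynomial in \<open>x\<close> and evaluating it at
  \<open>x'\<close> does not depend on the polynomial, because a difference vanishing at
  \<open>x\<close> is a multiple of \<open>g\<close>. So every conjugate contributes a term to the
  archimedean sum.\<close>

lemma ex_field_embedding:
  assumes x: "algebraic x" and g: "\<And>p. rat_eval p x = 0 \<Longrightarrow> g dvd p" and x': "rat_eval g x' = 0"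
  obtains \<sigma> where "\<sigma> \<in> field_embeddings (generate_field complex_ring {x})" "\<sigma> x = x'"
proof -
  let ?F = "generate_field complex_ring {x}"
  interpret F: number_field ?F by (rule number_field_generate_field[OF assms(1)])
  have wd: "rat_eval p x' = rat_eval q x'" if "rat_eval p x = rat_eval q x" for p q
  proof -
    have "g dvd p - q" using that by (intro g) simp
    then obtain r where "p - q = g * r" by auto
    hence "rat_eval (p - q) x' = 0" using x' by simp
    thus ?thesis by simp
  qed
  define \<sigma> where "\<sigma> = (\<lambda>z\<in>?F. rat_eval (SOME p. rat_eval p x = z) x')"
  have \<sigma>: "\<sigma> (rat_eval p x) = rat_eval p x'" for p
  proof -
    have "rat_eval (SOME q. rat_eval q x = rat_eval p x) x = rat_eval p x" by (rule someI) simp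
    hence "rat_eval (SOME q. rat_eval q x = rat_eval p x) x' = rat_eval p x'" by (rule wd)
    thus ?thesis using generate_field_eq[OF x] by (auto simp: \<sigma>_def)
  qed
  have "\<sigma> \<in> field_embeddings ?F"
    unfolding field_embeddings_def
  proof (intro IntI)
    show "\<sigma> \<in> extensional ?F" by (simp add: \<sigma>_def)
    show "\<sigma> \<in> Ring.ring_hom (complex_ring\<lparr>carrier := ?F\<rparr>) complex_ring"
    proof (rule Ring.ring_hom_memI)
      fix a b assume "a \<in> carrier (complex_ring\<lparr>carrier := ?F\<rparr>)" "b \<in> carrier (complex_ring\<lparr>carrier := ?F\<rparr>)"
      then obtain p q where "a = rat_eval p x" "b = rat_eval q x" using generate_field_eq[OF x] by auto
      thus "\<sigma> (a \<otimes>\<^bsub>complex_ring\<lparr>carrier := ?F\<rparr>\<^esub> b) = \<sigma> a \<otimes>\<^bsub>complex_ring\<^esub> \<sigma> b"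
        "\<sigma> (a \<oplus>\<^bsub>complex_ring\<lparr>carrier := ?F\<rparr>\<^esub> b) = \<sigma> a \<oplus>\<^bsub>complex_ring\<^esub> \<sigma> b"
        using \<sigma>[of "p * q"] \<sigma>[of "p + q"] \<sigma>[of p] \<sigma>[of q] by simp_all
    qed (use \<sigma>[of 1] in simp_all)
  qed
  moreover have "\<sigma> x = x'" using \<sigma>[of "[:0, 1:]"] by simp
  ultimately show ?thesis using that by blast
qed

lemma field_degree_bounds:
  assumes x: "algebraic x" and B: "finite B" "generate_field complex_ring {x} \<subseteq> Q.span B"
  shows "field_degree (generate_field complex_ring {x}) \<le> card B"
    and "field_degree (generate_field complex_ring {x}) > 0"
proof -
  let ?F = "generate_field complex_ring {x}"
  show "field_degree ?F \<le> card B" unfolding field_degree_def by (rule Q.dim_le_card[OF B(2,1)])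
  obtain A where A: "A \<subseteq> ?F" "Q.independent A" "?F \<subseteq> Q.span A" "card A = Q.dim ?F"
    using Q.basis_exists by blast
  have "finite A" using Q.independent_span_bound[OF B(1) A(2)] A(1) B(2) by auto
  moreover have "A \<noteq> {}"
  proof
    assume "A = {}"
    hence "?F \<subseteq> {0}" using A(3) by simp
    moreover have "1 \<in> ?F" using generate_field.one[of complex_ring "{x}"] by simp
    ultimately show False by auto
  qed
  ultimately show "field_degree ?F > 0" using A(4) unfolding field_degree_def by (metis card_gt_0_iff)
qed

text \<open>The archimedean and the finite part are both nonnegative, so each is at most the degree
  times \<open>H\<close>. The degree is replaced by \<open>card B\<close>, a bound that serves all
  \<open>x\<close> of an ambient number field.\<close>

lemma weil_height_bounds:
  assumes x: "algebraic x" and B: "finite B" "generate_field complex_ring {x} \<subseteq> Q.span B"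
    and h: "weil_height x \<le> H" "H \<ge> 0"
    and g: "\<And>p. rat_eval p x = 0 \<Longrightarrow> g dvd p"
  obtains c :: nat where "c > 0" "real c \<le> exp (real (card B) * H)" "algebraic_int (of_nat c * x)"
    "\<And>x'. rat_eval g x' = 0 \<Longrightarrow> cmod x' \<le> exp (real (card B) * H)"
proof -
  let ?F = "generate_field complex_ring {x}"
  interpret F: number_field ?F by (rule number_field_generate_field[OF assms(1)])
  have x_in: "x \<in> ?F" by (rule generate_field.incl) simp
  define A where "A = (\<Sum>\<sigma>\<in>field_embeddings ?F. ln (max 1 (cmod (\<sigma> x))))"
  define N where "N = (\<Sum>\<^sub>\<infinity>P\<in>finite_places ?F. ln (max 1 (place_abs ?F P x)))"
  obtain c :: nat where c: "c > 0" "of_nat c * x \<in> F.OK" "ln (real c) \<le> N"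
    using F.ex_denominator[OF x_in] unfolding N_def by blast
  have ln_max: "0 \<le> ln (max 1 (cmod (\<sigma> x)))" for \<sigma> :: "complex \<Rightarrow> complex" by simp
  have A: "A \<ge> 0" unfolding A_def by (intro sum_nonneg ln_max)
  have N: "N \<ge> 0" using c by (metis One_nat_def Suc_leI ln_ge_zero of_nat_1 of_nat_mono order_trans)
  have "(A + N) / real (field_degree ?F) \<le> H"
    using h(1) by (simp add: weil_height_def weil_height_over_def A_def N_def)
  hence "A + N \<le> H * real (field_degree ?F)"
    using field_degree_bounds(2)[OF x B] by (simp add: pos_divide_le_eq)
  also have "\<dots> \<le> H * real (card B)"
    using field_degree_bounds(1)[OF x B] h(2) by (intro mult_left_mono) auto
  finally have AN: "A + N \<le> real (card B) * H" by (simp add: mult.commute)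
  show ?thesis
  proof (rule that[OF c(1)])
    have "ln (real c) \<le> real (card B) * H" using c(3) A AN by linarith
    thus "real c \<le> exp (real (card B) * H)" using c(1) by (metis exp_le_cancel_iff exp_ln of_nat_0_less_iff)
    show "algebraic_int (of_nat c * x)" using c(2) by (simp add: F.OK_def)
    fix x' assume "rat_eval g x' = 0"
    then obtain \<sigma> where \<sigma>: "\<sigma> \<in> field_embeddings ?F" "\<sigma> x = x'" using ex_field_embedding[OF x g] by blast
    have "ln (max 1 (cmod x')) \<le> A"
      unfolding A_def \<sigma>(2)[symmetric] by (rule member_le_sum[OF \<sigma>(1)]) (auto simp: finite_field_embeddings[OF x])
    hence "ln (max 1 (cmod x')) \<le> real (card B) * H" using N AN by linarith
    hence "exp (ln (max 1 (cmod x'))) \<le> exp (real (card B) * H)" by (simp only: exp_le_cancel_iff)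
    thus "cmod x' \<le> exp (real (card B) * H)" by simp
  qed
qed

section \<open>Counting numbers of bounded height\<close>

text \<open>A further linear factor with root of modulus at most \<open>R\<close> enlarges the
  coefficients at most by the factor \<open>1 + R\<close>.\<close>

lemma coeff_prod_linear_bound:
  fixes A :: "complex multiset"
  assumes "\<And>a. a \<in># A \<Longrightarrow> cmod a \<le> R" "R \<ge> 0"
  shows "cmod (Polynomial.coeff (\<Prod>a\<in>#A. [:- a, 1:]) i) \<le> (1 + R) ^ size A"
  using assms(1)
proof (induction A arbitrary: i)
  case empty
  show ?case by (auto simp: Polynomial.coeff_1)
next
  case (add a A)
  let ?p = "\<Prod>a\<in>#A. [:- a, 1:]"
  have IH: "cmod (Polynomial.coeff ?p j) \<le> (1 + R) ^ size A" for j using add by auto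
  have "Polynomial.coeff (\<Prod>a\<in>#add_mset a A. [:- a, 1:]) i
      = - a * Polynomial.coeff ?p i + (case i of 0 \<Rightarrow> 0 | Suc j \<Rightarrow> Polynomial.coeff ?p j)"
    by (simp add: mult_pCons_left Polynomial.coeff_pCons split: nat.splits)
  also have "cmod \<dots> \<le> cmod a * cmod (Polynomial.coeff ?p i) + cmod (case i of 0 \<Rightarrow> 0 | Suc j \<Rightarrow> Polynomial.coeff ?p j)"
    by (rule order_trans[OF norm_triangle_ineq]) (simp add: norm_mult)
  also have "\<dots> \<le> R * (1 + R) ^ size A + (1 + R) ^ size A"
    using IH add.prems assms(2) by (intro add_mono mult_mono) (auto split: nat.splits)
  also have "\<dots> = (1 + R) ^ size (add_mset a A)" by (simp add: algebra_simps)
  finally show ?case .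
qed

lemma coeff_prod_linear_algebraic_int:
  fixes A :: "complex multiset"
  assumes "\<And>a. a \<in># A \<Longrightarrow> algebraic_int a"
  shows "algebraic_int (Polynomial.coeff (\<Prod>a\<in>#A. [:- a, 1:]) i)"
  using assms
proof (induction A arbitrary: i)
  case empty
  show ?case by (auto simp: Polynomial.coeff_1)
next
  case (add a A)
  let ?p = "\<Prod>a\<in>#A. [:- a, 1:]"
  have IH: "algebraic_int (Polynomial.coeff ?p j)" for j using add by auto
  have "Polynomial.coeff (\<Prod>a\<in>#add_mset a A. [:- a, 1:]) i
      = (case i of 0 \<Rightarrow> 0 | Suc j \<Rightarrow> Polynomial.coeff ?p j) - a * Polynomial.coeff ?p i"
    by (simp add: mult_pCons_left Polynomial.coeff_pCons split: nat.splits)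
  also have "algebraic_int \<dots>"
    using IH add.prems by (intro algebraic_int_diff algebraic_int_mult) (auto split: nat.splits)
  finally show ?case .
qed

lemma minimal_polynomial_degree_le:
  assumes B: "finite B" "generate_field complex_ring {x} \<subseteq> Q.span B" and x: "algebraic x"
    and g: "\<And>p. rat_eval p x = 0 \<Longrightarrow> g dvd p"
  shows "Polynomial.degree g \<le> card B"
proof -
  interpret F: number_field "generate_field complex_ring {x}" by (rule number_field_generate_field[OF x])
  have x_in: "x \<in> generate_field complex_ring {x}" by (rule generate_field.incl) simp
  obtain u where u: "\<exists>i\<le>card B. u i \<noteq> 0" "(\<Sum>i\<le>card B. of_rat (u i) * x ^ i) = 0"
    by (rule rat_dependence[OF B(1) order_refl, of "\<lambda>i. x ^ i"]) (use F.power_in[OF x_in] B(2) in blast)+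
  define q where "q = (\<Sum>i\<le>card B. Polynomial.monom (u i) i)"
  have coeff: "Polynomial.coeff q i = (if i \<le> card B then u i else 0)" for i
    by (auto simp: q_def Polynomial.coeff_sum)
  have deg: "Polynomial.degree q \<le> card B" by (rule degree_le) (simp add: coeff)
  have "rat_eval q x = (\<Sum>i\<le>card B. of_rat (u i) * x ^ i)"
  proof -
    have "map_poly of_rat q = (\<Sum>i\<le>card B. Polynomial.monom (of_rat (u i)) i :: complex poly)"
      by (rule poly_eqI) (auto simp: coeff_map_poly coeff Polynomial.coeff_sum)
    thus ?thesis by (simp add: poly_sum poly_monom)
  qed
  hence "g dvd q" using u(2) by (intro g) simp
  moreover have "q \<noteq> 0" using u(1) by (metis coeff Polynomial.coeff_0)
  ultimately show ?thesis using dvd_imp_degree_le deg order_trans by blast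
qed

text \<open>The polynomial is \<open>c ^ e\<close> times g(X / c), with the multiples by
  \<open>c\<close> of the conjugates of \<open>x\<close> as roots. Its coefficients are rational
  because those of \<open>g\<close> are, and algebraic integers because its roots are; hence they
  are integers, bounded in terms of the roots.\<close>

lemma integral_multiple_polynomial:
  assumes g: "Polynomial.lead_coeff g = 1" "rat_eval g x = 0" "\<And>p. rat_eval p x = 0 \<Longrightarrow> g dvd p"
    and c: "(c::nat) > 0" "algebraic_int (of_nat c * x)"
    and E: "\<And>x'. rat_eval g x' = 0 \<Longrightarrow> cmod x' \<le> E" "E \<ge> 0"
  obtains k :: "nat \<Rightarrow> int" where "\<And>i. \<bar>real_of_int (k i)\<bar> \<le> (1 + real c * E) ^ Polynomial.degree g"
    "k (Polynomial.degree g) = 1" "(\<Sum>i\<le>Polynomial.degree g. of_int (k i) * (of_nat c * x) ^ i) = 0"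
proof -
  define e where "e = Polynomial.degree g"
  define G where "G = (map_poly of_rat g :: complex poly)"
  have lead: "Polynomial.lead_coeff G = 1" and deg: "Polynomial.degree G = e"
    using g(1) by (auto simp: G_def e_def degree_map_poly coeff_map_poly)
  then obtain A where A: "size A = e" "G = (\<Prod>a\<in>#A. [:- a, 1:])"
    using alg_closed_imp_factorization[of G] by fastforce
  have root: "rat_eval g a = 0" if "a \<in># A" for a
    using that by (auto simp: A(2) poly_prod_mset simp flip: G_def)
  define A' where "A' = image_mset (\<lambda>a. of_nat c * a) A"
  define P where "P = (\<Prod>a\<in>#A'. [:- a, 1:])"
  have "cmod a \<le> real c * E" if "a \<in># A'" for a
    using that E(1)[OF root] by (auto simp: A'_def norm_mult intro!: mult_left_mono)
  hence bound: "cmod (Polynomial.coeff P i) \<le> (1 + real c * E) ^ e" for i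
    using coeff_prod_linear_bound[of A' "real c * E" i] E(2) by (simp add: P_def A'_def A(1))
  obtain f where f: "poly (map_poly of_int f) (of_nat c * x) = 0" "Polynomial.lead_coeff f = 1"
    using c(2) unfolding algebraic_int_altdef_ipoly by auto
  have "algebraic_int a'" if a': "a' \<in># A'" for a'
  proof -
    obtain a where a: "a \<in># A" "a' = of_nat c * a" using a' by (auto simp: A'_def)
    \<comment> \<open>f(c X) has rational coefficients and vanishes at \<open>x\<close>, so
      \<open>g\<close> divides it; thus \<open>c\<close> times any conjugate is a root of the monic
      integer polynomial \<open>f\<close>.\<close>
    define h where "h = pcompose (map_poly of_int f) [:0, of_nat c :: rat:]"
    have h: "rat_eval h z = poly (map_poly of_int f) (of_nat c * z)" for z
    proof -
      have "map_poly of_rat h = pcompose (map_poly of_int f) [:0, of_nat c :: complex:]"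
        by (rule poly_eqI) (simp add: h_def coeff_map_poly coeff_pcompose_linear of_rat_mult of_rat_power)
      thus ?thesis by (simp add: poly_pcompose mult.commute)
    qed
    have "g dvd h" using f(1) by (intro g(3)) (simp add: h)
    hence "rat_eval h a = 0" using root[OF a(1)] by auto
    thus ?thesis using f(2) h a(2) unfolding algebraic_int_altdef_ipoly by auto
  qed
  hence alg: "algebraic_int (Polynomial.coeff P i)" for i
    unfolding P_def by (rule coeff_prod_linear_algebraic_int)
  have comp: "pcompose P [:0, of_nat c:] = Polynomial.smult (of_nat c ^ e) G"
    unfolding P_def A'_def A(2) A(1)[symmetric]
  proof (induction A)
    case empty
    show ?case by (simp add: pcompose_1)
  next
    case (add a A)
    have "pcompose [:- (of_nat c * a), 1:] [:0, of_nat c:] = Polynomial.smult (of_nat c) [:- a, 1:]"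
      by (simp add: pcompose_pCons)
    thus ?case
      using add by (simp only: image_mset_add_mset prod_mset.add_mset pcompose_mult size_add_mset power_Suc
          mult_smult_left mult_smult_right smult_smult mult.commute)
  qed
  have coeff_P: "Polynomial.coeff P i = of_nat c ^ e * of_rat (Polynomial.coeff g i) / of_nat c ^ i" for i
  proof -
    have "of_nat c ^ i * Polynomial.coeff P i = of_nat c ^ e * of_rat (Polynomial.coeff g i)"
      using arg_cong[OF comp, of "\<lambda>p. Polynomial.coeff p i"]
      by (simp add: coeff_pcompose_linear G_def coeff_map_poly)
    thus ?thesis using c(1) by (simp add: field_simps)
  qed
  have "Polynomial.coeff P i \<in> \<int>" for i
  proof (rule rational_algebraic_int_is_int[OF alg])
    show "Polynomial.coeff P i \<in> \<rat>" by (simp add: coeff_P)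
  qed
  hence "\<exists>k. Polynomial.coeff P i = of_int k" for i by (auto elim: Ints_cases)
  then obtain k where k: "\<And>i. Polynomial.coeff P i = of_int (k i)" by metis
  show ?thesis
  proof (rule that[of k])
    show "\<bar>real_of_int (k i)\<bar> \<le> (1 + real c * E) ^ Polynomial.degree g" for i
      using bound[of i] by (simp add: k e_def)
    have "(of_int (k e) :: complex) = 1" using c(1) g(1) by (simp add: k[symmetric] coeff_P e_def)
    thus "k (Polynomial.degree g) = 1" by (simp add: e_def)
    have "(\<Sum>i\<le>e. of_int (k i) * (of_nat c * x) ^ i) = (\<Sum>i\<le>e. of_nat c ^ e * (of_rat (Polynomial.coeff g i) * x ^ i))"
      using c(1) by (intro sum.cong) (auto simp: k[symmetric] coeff_P power_mult_distrib)
    also have "\<dots> = of_nat c ^ e * rat_eval g x"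
      unfolding G_def[symmetric] poly_altdef deg sum_distrib_left by (simp add: G_def coeff_map_poly)
    finally show "(\<Sum>i\<le>Polynomial.degree g. of_int (k i) * (of_nat c * x) ^ i) = 0" using g(2) by (simp add: e_def)
  qed
qed

text \<open>There are \<open>(2 * m + 1) ^ Suc d\<close> coefficient vectors, and each nonzero one
  has at most \<open>d\<close> roots.\<close>

lemma card_int_poly_roots:
  fixes d :: nat and m :: int
  defines "Z \<equiv> {z :: complex. \<exists>k. (\<forall>i\<le>d. \<bar>k i\<bar> \<le> m) \<and> (\<exists>i\<le>d. k i \<noteq> 0) \<and> (\<Sum>i\<le>d. of_int (k i) * z ^ i) = 0}"
  assumes m: "m \<ge> 0"
  shows "finite Z" "card Z \<le> nat (2 * m + 1) ^ Suc d * d"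
proof -
  define pol where "pol = (\<lambda>k::nat\<Rightarrow>int. \<Sum>i\<le>d. Polynomial.monom (of_int (k i) :: complex) i)"
  have coeff: "Polynomial.coeff (pol k) i = (if i \<le> d then of_int (k i) else 0)" for k i
    by (auto simp: pol_def Polynomial.coeff_sum)
  have poly: "poly (pol k) z = (\<Sum>i\<le>d. of_int (k i) * z ^ i)" for k z
    by (simp add: pol_def poly_sum poly_monom)
  have deg: "Polynomial.degree (pol k) \<le> d" for k by (rule degree_le) (simp add: coeff)
  define I where "I = {..d} \<rightarrow>\<^sub>E {- m..m}"
  have I: "finite I" "card I = nat (2 * m + 1) ^ Suc d"
    using m by (auto simp: I_def card_PiE intro!: finite_PiE arg_cong[of _ _ "\<lambda>x. nat x ^ d"])
  define J where "J = {k \<in> I. pol k \<noteq> 0}"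
  have J: "finite J" "card J \<le> card I" using I(1) by (auto simp: J_def intro: card_mono)
  have sub: "Z \<subseteq> (\<Union>k\<in>J. {z. poly (pol k) z = 0})"
  proof
    fix z assume "z \<in> Z"
    then obtain k where k: "\<forall>i\<le>d. \<bar>k i\<bar> \<le> m" "\<exists>i\<le>d. k i \<noteq> 0" "(\<Sum>i\<le>d. of_int (k i) * z ^ i) = 0"
      by (auto simp: Z_def)
    define k' where "k' = restrict k {..d}"
    have "k' \<in> I" using k(1) by (auto simp: k'_def I_def abs_le_iff minus_le_iff)
    moreover have "pol k' \<noteq> 0" using k(2) coeff[of k'] by (metis Polynomial.coeff_0 of_int_eq_0_iff k'_def restrict_apply' atMost_iff)
    moreover have "poly (pol k') z = 0" using k(3) by (simp add: poly k'_def)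
    ultimately show "z \<in> (\<Union>k\<in>J. {z. poly (pol k) z = 0})" by (auto simp: J_def)
  qed
  have fin: "finite {z. poly (pol k) z = 0}" if "k \<in> J" for k using that by (auto simp: J_def poly_roots_finite)
  have finU: "finite (\<Union>k\<in>J. {z. poly (pol k) z = 0})" using J(1) fin by auto
  show "finite Z" using finite_subset[OF sub finU] .
  have "card Z \<le> card (\<Union>k\<in>J. {z. poly (pol k) z = 0})" by (rule card_mono[OF finU sub])
  also have "\<dots> \<le> (\<Sum>k\<in>J. card {z. poly (pol k) z = 0})" by (rule card_UN_le[OF J(1)])
  also have "\<dots> \<le> (\<Sum>k\<in>J. d)"
    by (intro sum_mono order_trans[OF card_poly_roots_bound deg]) (auto simp: J_def)
  also have "\<dots> \<le> card I * d" using J(2) by simp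
  finally show "card Z \<le> nat (2 * m + 1) ^ Suc d * d" by (simp add: I(2))
qed

text \<open>Each \<open>x\<close> is written as \<open>z / c\<close>, with \<open>c\<close> at most
  \<open>E\<close> and \<open>z\<close> a root of an integer polynomial of bounded degree and
  coefficients. \<open>C\<close> and \<open>\<kappa>\<close> are fixed before \<open>H\<close>,
  which later grows with the index.\<close>

lemma northcott_bound:
  assumes S: "number_field S"
  obtains C \<kappa> :: real where "C > 0" "\<kappa> > 0"
    "\<And>H. H \<ge> 0 \<Longrightarrow> finite {x \<in> S. weil_height x \<le> H}"
    "\<And>H. H \<ge> 0 \<Longrightarrow> real (card {x \<in> S. weil_height x \<le> H}) \<le> C * exp (\<kappa> * H)"
proof -
  interpret S: number_field S by fact
  obtain B where B: "finite B" "S \<subseteq> Q.span B" using S.finite_dim by blast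
  define d where "d = card B"
  \<comment> \<open>The count is at most \<open>E * d * (3 * (2 * E ^ 2) ^ d) ^ Suc d\<close> with
    \<open>E = exp (d * H)\<close>; collecting the powers of \<open>E\<close> gives the rate
    \<open>\<kappa>\<close>. The added 1 in both constants makes positivity immediate.\<close>
  define C where "C = real d * (3 * 2 ^ d) ^ Suc d + 1"
  define \<kappa> where "\<kappa> = real (1 + 2 * d * Suc d) * real d + 1"
  have main: "finite {x \<in> S. weil_height x \<le> H} \<and> real (card {x \<in> S. weil_height x \<le> H}) \<le> C * exp (\<kappa> * H)"
    if H: "H \<ge> 0" for H
  proof -
    define E where "E = exp (real d * H)"
    have E: "E \<ge> 1" using H by (simp add: E_def)
    \<comment> \<open>A common bound for \<open>(1 + c * E) ^ degree g\<close>, by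
      \<open>c \<le> E\<close> and \<open>degree g \<le> d\<close>.\<close>
    define M where "M = (1 + E * E) ^ d"
    have "M \<ge> 0" using E by (simp add: M_def)
    define m where "m = \<lfloor>M\<rfloor>"
    have m: "m \<ge> 0" using \<open>M \<ge> 0\<close> by (simp add: m_def)
    define Z where "Z = {z :: complex. \<exists>k. (\<forall>i\<le>d. \<bar>k i\<bar> \<le> m) \<and> (\<exists>i\<le>d. k i \<noteq> 0) \<and> (\<Sum>i\<le>d. of_int (k i) * z ^ i) = 0}"
    note Z = card_int_poly_roots[OF m, of d, folded Z_def]
    define D where "D = {1..nat \<lfloor>E\<rfloor>}"
    have sub: "{x \<in> S. weil_height x \<le> H} \<subseteq> (\<lambda>(c, z). z / of_nat c) ` (D \<times> Z)"
    proof safe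
      fix x assume x: "x \<in> S" "weil_height x \<le> H"
      have alg: "algebraic x" by (rule S.algebraic_in[OF x(1)])
      have B': "generate_field complex_ring {x} \<subseteq> Q.span B" using S.generate_field_subset[OF x(1)] B(2) by blast
      obtain g where g: "Polynomial.lead_coeff g = 1" "rat_eval g x = 0" "\<And>p. rat_eval p x = 0 \<Longrightarrow> g dvd p"
        using ex_minimal_polynomial[OF alg] by blast
      obtain c where c: "c > 0" "real c \<le> E" "algebraic_int (of_nat c * x)" "\<And>x'. rat_eval g x' = 0 \<Longrightarrow> cmod x' \<le> E"
        by (rule weil_height_bounds[OF alg B(1) B' x(2) H g(3)]) (simp_all add: E_def d_def)
      have "E \<ge> 0" using E by simp
      obtain k where k: "\<And>i. \<bar>real_of_int (k i)\<bar> \<le> (1 + real c * E) ^ Polynomial.degree g"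
        "k (Polynomial.degree g) = 1" "(\<Sum>i\<le>Polynomial.degree g. of_int (k i) * (of_nat c * x) ^ i) = 0"
        using integral_multiple_polynomial[OF g c(1,3,4) \<open>E \<ge> 0\<close>] by blast
      have deg: "Polynomial.degree g \<le> d" unfolding d_def by (rule minimal_polynomial_degree_le[OF B(1) B' alg g(3)])
      define k' where "k' = (\<lambda>i. if i \<le> Polynomial.degree g then k i else 0)"
      have "\<bar>k' i\<bar> \<le> m" for i
      proof -
        have "\<bar>real_of_int (k i)\<bar> \<le> (1 + real c * E) ^ Polynomial.degree g" by (rule k(1))
        also have "\<dots> \<le> (1 + E * E) ^ Polynomial.degree g"
          using c(2) E by (intro power_mono add_mono mult_mono) auto
        also have "\<dots> \<le> M" unfolding M_def using deg E by (intro power_increasing) auto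
        finally have "\<bar>k i\<bar> \<le> m" unfolding m_def by (simp add: le_floor_iff)
        thus ?thesis using m by (simp add: k'_def)
      qed
      moreover have "\<exists>i\<le>d. k' i \<noteq> 0" using deg k(2) by (intro exI[of _ "Polynomial.degree g"]) (simp add: k'_def)
      moreover have "(\<Sum>i\<le>d. of_int (k' i) * (of_nat c * x) ^ i) = (\<Sum>i\<le>Polynomial.degree g. of_int (k i) * (of_nat c * x) ^ i)"
        using deg by (intro sum.mono_neutral_cong_right) (auto simp: k'_def)
      ultimately have "of_nat c * x \<in> Z" using k(3) unfolding Z_def by auto
      moreover have "c \<in> D" using c(1,2) by (simp add: D_def le_nat_floor)
      ultimately show "x \<in> (\<lambda>(c, z). z / of_nat c) ` (D \<times> Z)"
        using c(1) by (intro image_eqI[of _ _ "(c, of_nat c * x)"]) auto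
    qed
    have fin: "finite (D \<times> Z)" using Z(1) by (simp add: D_def)
    have "card {x \<in> S. weil_height x \<le> H} \<le> card ((\<lambda>(c, z). z / of_nat c) ` (D \<times> Z))"
      by (rule card_mono[OF _ sub]) (simp add: fin)
    also have "\<dots> \<le> card (D \<times> Z)" by (rule card_image_le[OF fin])
    also have "\<dots> = nat \<lfloor>E\<rfloor> * card Z" by (simp add: D_def card_cartesian_product)
    also have "\<dots> \<le> nat \<lfloor>E\<rfloor> * (nat (2 * m + 1) ^ Suc d * d)" using Z(2) by (intro mult_left_mono) auto
    finally have "real (card {x \<in> S. weil_height x \<le> H}) \<le> real (nat \<lfloor>E\<rfloor> * (nat (2 * m + 1) ^ Suc d * d))"
      by (rule of_nat_mono)
    also have "\<dots> = real (nat \<lfloor>E\<rfloor>) * (real (nat (2 * m + 1)) ^ Suc d * real d)" by (simp only: of_nat_mult of_nat_power)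
    also have "\<dots> \<le> E * ((3 * (2 ^ d * (E ^ 2) ^ d)) ^ Suc d * real d)"
    proof (intro mult_mono power_mono)
      show "real (nat \<lfloor>E\<rfloor>) \<le> E" using E by simp
      have "real (nat (2 * m + 1)) = 2 * real_of_int m + 1" using m by simp
      also have "\<dots> \<le> 2 * M + 1" by (simp add: m_def)
      also have "M \<le> (2 * E ^ 2) ^ d" unfolding M_def using E by (intro power_mono) (auto simp: power2_eq_square mult_le_one intro: order_trans[OF _ mult_mono[of 1 E 1 E]])
      also have "2 * (2 * E ^ 2) ^ d + 1 \<le> 3 * (2 * E ^ 2) ^ d"
        using one_le_power[of "2 * E ^ 2" d] one_le_power[OF E, of 2] by simp
      finally show "real (nat (2 * m + 1)) \<le> 3 * (2 ^ d * (E ^ 2) ^ d)" by (simp add: power_mult_distrib)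
    qed (use E in auto)
    also have "\<dots> = (real d * (3 * 2 ^ d) ^ Suc d) * E ^ (1 + 2 * d * Suc d)"
    proof -
      have "E ^ (1 + 2 * d * Suc d) = E * ((E ^ 2) ^ d) ^ Suc d"
        by (simp only: power_add power_one_right power_mult)
      thus ?thesis by (simp only: power_mult_distrib mult_ac)
    qed
    also have "E ^ (1 + 2 * d * Suc d) = exp (real (1 + 2 * d * Suc d) * (real d * H))"
      unfolding E_def by (rule exp_of_nat_mult[symmetric])
    also have "(real d * (3 * 2 ^ d) ^ Suc d) * \<dots> \<le> C * exp (\<kappa> * H)"
      unfolding C_def \<kappa>_def using H by (intro mult_mono) (auto simp: algebra_simps)
    finally show ?thesis using finite_subset[OF sub] fin by blast
  qed
  show ?thesis
  proof (rule that[of C \<kappa>])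
    show "C > 0" by (auto simp: C_def intro!: add_nonneg_pos)
    show "\<kappa> > 0" by (auto simp: \<kappa>_def intro!: add_nonneg_pos)
  qed (use main in blast)+
qed

section \<open>Recurrences with few values\<close>

lemma poly_of_nat_eventually_nonzero:
  fixes p :: "complex poly"
  assumes "p \<noteq> 0"
  obtains n0 where "\<And>k. k \<ge> n0 \<Longrightarrow> poly p (of_nat k) \<noteq> 0"
proof -
  have "finite {k::nat. poly p (of_nat k) = 0}"
  proof (rule finite_imageD)
    show "finite (of_nat ` {k::nat. poly p (of_nat k) = 0} :: complex set)"
      by (rule finite_subset[OF _ poly_roots_finite[OF assms]]) auto
  qed (simp add: inj_on_def)
  then obtain n0 where "\<forall>k\<in>{k::nat. poly p (of_nat k) = 0}. k < n0"
    unfolding finite_nat_set_iff_bounded by blast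
  thus ?thesis by (intro that[of n0]) fastforce
qed

lemma eventually_periodic_if_repeated_window:
  fixes a :: "nat \<Rightarrow> complex" and q :: "nat \<Rightarrow> complex poly"
  assumes rec: "\<And>k. (\<Sum>l\<le>L. poly (q l) (of_nat k) * a (k + l)) = 0"
    and lead: "\<And>k. k \<ge> m \<Longrightarrow> poly (q L) (of_nat k) \<noteq> 0"
    and good: "\<And>k. m \<le> k \<Longrightarrow> k < n \<Longrightarrow> (\<Sum>l\<le>L. Polynomial.smult (a (k + l)) (q l)) = 0"
    and mn: "m < n" and rep: "\<And>l. l \<le> L \<Longrightarrow> a (m + l) = a (n + l)"
  shows "eventually_periodic a"
proof -
  define p where "p = n - m"
  have p: "p > 0" "n = m + p" using mn by (auto simp: p_def)
  define u where "u = (\<lambda>k. a (m + k mod p))"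
  \<comment> \<open>Windows starting in the block reach up to \<open>L\<close> places beyond it.
    Agreement there comes from the equality of the two windows, applied repeatedly if
    \<open>L\<close> exceeds \<open>p\<close>.\<close>
  have init: "a (m + j) = u j" if "j \<le> p + L" for j
    using that
  proof (induction j rule: less_induct)
    case (less j)
    show ?case
    proof (cases "j < p")
      case True
      thus ?thesis by (simp add: u_def)
    next
      case False
      then obtain i where i: "j = p + i" by (metis le_iff_add not_less)
      hence "a (m + j) = a (n + i)" using p(2) by (simp add: add_ac)
      also have "\<dots> = a (m + i)" using rep[of i] less.prems i by simp
      also have "\<dots> = u i" using less.IH[of i] less.prems i p(1) by simp
      also have "\<dots> = u j" by (simp add: u_def i)
      finally show ?thesis .
    qed
  qed
  have u_rec: "(\<Sum>l\<le>L. poly (q l) z * u (k + l)) = 0" for k z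
  proof -
    have "u (k + l) = a (m + k mod p + l)" if "l \<le> L" for l
    proof -
      have "a (m + (k mod p + l)) = u (k mod p + l)"
        using that p(1) by (intro init add_mono) (simp_all add: less_imp_le)
      also have "\<dots> = u (k + l)" by (simp add: u_def mod_add_left_eq)
      finally show ?thesis by (simp add: add_ac)
    qed
    hence "(\<Sum>l\<le>L. poly (q l) z * u (k + l)) = poly (\<Sum>l\<le>L. Polynomial.smult (a (m + k mod p + l)) (q l)) z"
      by (simp add: poly_sum mult.commute)
    also have "\<dots> = 0" using good[of "m + k mod p"] p by simp
    finally show ?thesis .
  qed
  have eq: "a (m + j) = u j" for j
  proof (induction j rule: less_induct)
    case (less j)
    show ?case
    proof (cases "j \<le> p + L")
      case True
      thus ?thesis by (rule init)
    next
      case False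
      then obtain k where k: "j = k + L" by (metis add.commute le_add2 le_trans nat_le_linear le_Suc_ex)
      \<comment> \<open>The identity for \<open>u\<close> at index \<open>k\<close> is evaluated at
        \<open>m + k\<close>, which gives it the coefficients of the recurrence of \<open>a\<close>
        at the shifted index; the nonzero leading coefficient then determines the next term.\<close>
      let ?z = "of_nat (m + k) :: complex"
      have "(\<Sum>l<L. poly (q l) ?z * a (m + k + l)) + poly (q L) ?z * a (m + k + L) = 0"
        using rec[of "m + k"] by (simp flip: lessThan_Suc_atMost)
      moreover have "(\<Sum>l<L. poly (q l) ?z * u (k + l)) + poly (q L) ?z * u (k + L) = 0"
        using u_rec[of ?z k] by (simp flip: lessThan_Suc_atMost)
      moreover have "(\<Sum>l<L. poly (q l) ?z * a (m + k + l)) = (\<Sum>l<L. poly (q l) ?z * u (k + l))"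
        using less.IH k by (intro sum.cong) (auto simp: add.assoc)
      ultimately have "poly (q L) ?z * a (m + k + L) = poly (q L) ?z * u (k + L)"
        by (simp add: add_eq_0_iff2)
      thus ?thesis using lead[of "m + k"] by (simp add: k add.assoc)
    qed
  qed
  have "a (k + p) = a k" if "k \<ge> m" for k
  proof -
    obtain j where "k = m + j" using \<open>k \<ge> m\<close> le_Suc_ex by blast
    thus ?thesis using eq[of "j + p"] eq[of j] by (simp add: u_def add.assoc)
  qed
  thus ?thesis unfolding eventually_periodic_def using p(1) by blast
qed

text \<open>The condition on \<open>N\<close> is a double pigeonhole. At most \<open>V\<close>
  window polynomials are nonzero, with at most \<open>D\<close> roots each, so one of
  \<open>D * V + 1\<close> disjoint blocks contains no bad index; and a block of length
  \<open>V + 1\<close> repeats a window.\<close>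

lemma eventually_periodic_if_few_values:
  fixes a :: "nat \<Rightarrow> complex" and q :: "nat \<Rightarrow> complex poly"
  assumes rec: "\<And>k. (\<Sum>l\<le>L. poly (q l) (of_nat k) * a (k + l)) = 0"
    and lead: "\<And>k. k \<ge> N \<Longrightarrow> poly (q L) (of_nat k) \<noteq> 0"
    and deg: "\<And>l. l \<le> L \<Longrightarrow> Polynomial.degree (q l) \<le> D"
    and V: "card (a ` {N..2 * N + L}) ^ Suc L \<le> V" and N: "(D * V + 1) * (V + 1) \<le> N"
  shows "eventually_periodic a"
proof -
  define w where "w = (\<lambda>k. \<lambda>l\<in>{..L}. a (k + l))"
  define W where "W = w ` {N..<2 * N}"
  have "W \<subseteq> {..L} \<rightarrow>\<^sub>E a ` {N..2 * N + L}"
    unfolding W_def w_def by (intro image_subsetI PiE_I) auto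
  hence "card W \<le> card ({..L} \<rightarrow>\<^sub>E a ` {N..2 * N + L})"
    by (intro card_mono finite_PiE) auto
  also have "\<dots> = card (a ` {N..2 * N + L}) ^ Suc L" by (simp add: card_PiE)
  also have "\<dots> \<le> V" by (rule V)
  finally have W: "card W \<le> V" "finite W" by (auto simp: W_def)
  define pol where "pol = (\<lambda>v. \<Sum>l\<le>L. Polynomial.smult (v l) (q l))"
  have pol_w: "pol (w k) = (\<Sum>l\<le>L. Polynomial.smult (a (k + l)) (q l))" for k
    by (simp add: pol_def w_def)
  have root: "poly (pol (w k)) (of_nat k) = 0" for k
    using rec[of k] by (simp add: pol_w poly_sum mult.commute)
  have deg_pol: "Polynomial.degree (pol v) \<le> D" for v
    unfolding pol_def using deg by (intro degree_sum_le) auto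
  define Bad where "Bad = {k \<in> {N..<2 * N}. pol (w k) \<noteq> 0}"
  define R where "R = (\<lambda>v. {k::nat. poly (pol v) (of_nat k) = 0})"
  have R: "finite (R v) \<and> card (R v) \<le> D" if "pol v \<noteq> 0" for v
  proof -
    have inj: "inj_on (of_nat :: nat \<Rightarrow> complex) (R v)" by (simp add: inj_on_def)
    have sub: "of_nat ` R v \<subseteq> {z. poly (pol v) z = 0}" by (auto simp: R_def)
    have fin: "finite {z. poly (pol v) z = 0}" by (rule poly_roots_finite[OF that])
    have "finite (R v)" using inj sub fin by (meson finite_imageD finite_subset)
    moreover have "card (R v) \<le> card {z. poly (pol v) z = 0}" by (rule card_inj_on_le[OF inj sub fin])
    ultimately show ?thesis using card_poly_roots_bound[OF that] deg_pol[of v] by linarith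
  qed
  have "Bad \<subseteq> (\<Union>v\<in>{v \<in> W. pol v \<noteq> 0}. R v)"
  proof
    fix k assume "k \<in> Bad"
    hence "w k \<in> {v \<in> W. pol v \<noteq> 0}" "k \<in> R (w k)" using root by (auto simp: Bad_def W_def R_def)
    thus "k \<in> (\<Union>v\<in>{v \<in> W. pol v \<noteq> 0}. R v)" by blast
  qed
  hence "card Bad \<le> card (\<Union>v\<in>{v \<in> W. pol v \<noteq> 0}. R v)"
    using R W(2) by (intro card_mono) auto
  also have "\<dots> \<le> (\<Sum>v\<in>{v \<in> W. pol v \<noteq> 0}. card (R v))" using W(2) by (intro card_UN_le) auto
  also have "\<dots> \<le> (\<Sum>v\<in>{v \<in> W. pol v \<noteq> 0}. D)" using R by (intro sum_mono) auto
  also have "\<dots> \<le> card W * D" using W(2) by (auto intro!: mult_right_mono card_mono)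
  also have "\<dots> \<le> V * D" using W(1) by simp
  finally have Bad: "card Bad \<le> D * V" by (simp add: mult.commute)
  define blk where "blk = (\<lambda>i. {N + i * (V + 1)..<N + (i + 1) * (V + 1)})"
  have blk_sub: "blk i \<subseteq> {N..<2 * N}" if "i \<le> D * V" for i
  proof -
    have "(i + 1) * (V + 1) \<le> (D * V + 1) * (V + 1)" using that by (intro mult_right_mono) auto
    thus ?thesis using N by (auto simp: blk_def)
  qed
  have "\<exists>i\<le>D * V. blk i \<inter> Bad = {}"
  proof (rule ccontr)
    assume "\<not> ?thesis"
    hence "\<exists>k. k \<in> blk i \<inter> Bad" if "i \<le> D * V" for i using that by blast
    then obtain b where b: "\<And>i. i \<le> D * V \<Longrightarrow> b i \<in> blk i \<inter> Bad" by metis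
    \<comment> \<open>The number of a block can be read off from any member, so bad indices chosen
      in distinct blocks are distinct.\<close>
    have div: "(b i - N) div (V + 1) = i" if "i \<le> D * V" for i
    proof -
      have "i * (V + 1) \<le> b i - N" "b i - N < (i + 1) * (V + 1)"
        using b[OF that] by (auto simp: blk_def)
      thus ?thesis by (intro div_nat_eqI) (auto simp: mult.commute)
    qed
    have "inj_on b {..D * V}" by (rule inj_onI) (metis div atMost_iff)
    hence "card {..D * V} \<le> card Bad" using b by (intro card_inj_on_le) (auto simp: Bad_def)
    thus False using Bad by simp
  qed
  then obtain i where i: "i \<le> D * V" "blk i \<inter> Bad = {}" by blast
  have "card (w ` blk i) \<le> card W"
    using blk_sub[OF i(1)] W(2) by (intro card_mono) (auto simp: W_def)
  hence "\<not> inj_on w (blk i)"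
    using W(1) card_image[of w "blk i"] by (auto simp: blk_def)
  then obtain m n where mn: "m \<in> blk i" "n \<in> blk i" "m < n" "w m = w n"
    unfolding inj_on_def by (metis linorder_neqE_nat)
  show ?thesis
  proof (rule eventually_periodic_if_repeated_window[OF rec])
    show "poly (q L) (of_nat k) \<noteq> 0" if "k \<ge> m" for k
      using lead[of k] that mn(1) by (auto simp: blk_def)
    show "m < n" by (rule mn(3))
    show "a (m + l) = a (n + l)" if "l \<le> L" for l
      using fun_cong[OF mn(4), of l] that by (simp add: w_def)
    show "(\<Sum>l\<le>L. Polynomial.smult (a (k + l)) (q l)) = 0" if "m \<le> k" "k < n" for k
    proof -
      have "k \<in> blk i" using that mn(1,2) by (auto simp: blk_def)
      hence "k \<notin> Bad" "k \<in> {N..<2 * N}" using i blk_sub by blast+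
      thus ?thesis using pol_w[of k] by (auto simp: Bad_def)
    qed
  qed
qed

text \<open>With \<open>c * t\<close> values the number of windows has order
  \<open>t ^ Suc L\<close>. Its square times a constant is at most
  \<open>t ^ (2 * Suc L + 1)\<close>, where one factor \<open>t\<close> absorbs the constant, and
  this stays below \<open>t ^ (4 * Suc L)\<close>.\<close>

lemma eventually_periodic_if_slow_value_growth:
  fixes a :: "nat \<Rightarrow> complex" and q :: "nat \<Rightarrow> complex poly"
  assumes rec: "\<And>k. (\<Sum>l\<le>L. poly (q l) (of_nat k) * a (k + l)) = 0"
    and lead: "q L \<noteq> 0"
    and few: "\<forall>\<^sub>F t in at_top. card (a ` {t ^ (4 * Suc L)..3 * t ^ (4 * Suc L)}) \<le> c * t"
  shows "eventually_periodic a"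
proof -
  obtain n0 where n0: "\<And>k. k \<ge> n0 \<Longrightarrow> poly (q L) (of_nat k) \<noteq> 0"
    using poly_of_nat_eventually_nonzero[OF lead] by blast
  obtain t0 where t0: "\<And>t. t \<ge> t0 \<Longrightarrow> card (a ` {t ^ (4 * Suc L)..3 * t ^ (4 * Suc L)}) \<le> c * t"
    using few by (auto simp: eventually_at_top_linorder)
  define D where "D = Max ((\<lambda>l. Polynomial.degree (q l)) ` {..L})"
  have deg: "Polynomial.degree (q l) \<le> D" if "l \<le> L" for l using that by (simp add: D_def)
  \<comment> \<open>Taking \<open>c + 1\<close> instead of \<open>c\<close> makes \<open>V\<close>
    positive.\<close>
  define A where "A = (c + 1) ^ Suc L"
  \<comment> \<open>Beyond \<open>t0\<close> the bound on the values holds, beyond \<open>n0\<close>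
    the leading coefficient is nonzero, \<open>L\<close> ensures
    \<open>2 * N + L \<le> 3 * N\<close>, and the last summand absorbs the constant of the quadratic
    estimate.\<close>
  define t where "t = Suc (t0 + n0 + L + 2 * (D + 1) * A ^ 2)"
  define N where "N = t ^ (4 * Suc L)"
  define V where "V = A * t ^ Suc L"
  have t1: "t \<ge> 1" by (simp add: t_def)
  have tN: "t \<le> N" unfolding N_def by (rule self_le_power[OF t1]) simp
  have L: "L \<le> N" using tN by (simp add: t_def)
  show ?thesis
  proof (rule eventually_periodic_if_few_values[OF rec _ deg])
    show "poly (q L) (of_nat k) \<noteq> 0" if "k \<ge> N" for k
      using n0[of k] that tN by (simp add: t_def)
    have "card (a ` {N..2 * N + L}) \<le> card (a ` {N..3 * N})"
      using L by (intro card_mono image_mono) auto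
    also have "\<dots> \<le> c * t" unfolding N_def by (rule t0) (simp add: t_def)
    also have "\<dots> \<le> (c + 1) * t" by simp
    finally have "card (a ` {N..2 * N + L}) ^ Suc L \<le> ((c + 1) * t) ^ Suc L" by (rule power_mono) simp
    thus "card (a ` {N..2 * N + L}) ^ Suc L \<le> V" by (simp only: V_def A_def power_mult_distrib)
    have "V > 0" unfolding V_def A_def using t1 by (intro mult_pos_pos zero_less_power) auto
    hence "(D * V + 1) * (V + 1) \<le> ((D + 1) * V) * (2 * V)"
      by (intro mult_mono) auto
    also have "\<dots> = (2 * (D + 1) * A ^ 2) * (t ^ Suc L) ^ 2" by (simp only: V_def power2_eq_square mult_ac)
    also have "\<dots> \<le> t * (t ^ Suc L) ^ 2" by (intro mult_right_mono) (auto simp: t_def)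
    also have "\<dots> = t ^ (1 + Suc L * 2)" by (simp only: power_add power_mult power_one_right)
    also have "\<dots> \<le> N" unfolding N_def using t1 by (intro power_increasing) auto
    finally show "(D * V + 1) * (V + 1) \<le> N" .
  qed
qed

section \<open>The recurrence of a D-finite series\<close>

lemma fps_nth_higher_deriv:
  fixes f :: "complex fps"
  shows "fps_nth ((fps_deriv ^^ i) f) n = pochhammer (of_nat (Suc n)) i * fps_nth f (n + i)"
proof (induction i arbitrary: n)
  case (Suc i)
  have "fps_nth ((fps_deriv ^^ Suc i) f) n = of_nat (Suc n) * fps_nth ((fps_deriv ^^ i) f) (Suc n)"
    by (simp add: fps_deriv_nth)
  also have "\<dots> = (of_nat (Suc n) * pochhammer (of_nat (Suc n) + 1) i) * fps_nth f (n + Suc i)"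
    by (simp add: Suc.IH algebra_simps)
  also have "of_nat (Suc n) * pochhammer (of_nat (Suc n) + 1) i = (pochhammer (of_nat (Suc n)) (Suc i) :: complex)"
    by (simp only: pochhammer_rec)
  finally show ?case .
qed simp

text \<open>An i-fold derivative multiplies coefficients by a rising factorial, which is a monic
  polynomial in the index of degree exactly \<open>i\<close>; this degree later separates the orders
  of the equation.\<close>

lemma pochhammer_linear_poly:
  fixes b :: complex
  shows "Polynomial.degree (pochhammer [:b, 1:] i) = i" "Polynomial.lead_coeff (pochhammer [:b, 1:] i) = 1"
    "poly (pochhammer [:b, 1:] i) x = pochhammer (b + x) i"
proof -
  have *: "[:b, 1:] + of_nat n = [:b + of_nat n, 1:]" for n by (simp add: of_nat_poly)
  have "Polynomial.degree (pochhammer [:b, 1:] i) = i \<and> Polynomial.lead_coeff (pochhammer [:b, 1:] i) = 1"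
  proof (induction i)
    case (Suc i)
    have "pochhammer [:b, 1:] i \<noteq> 0" using Suc by auto
    hence "Polynomial.degree (pochhammer [:b, 1:] (Suc i)) = Suc i"
      using Suc unfolding pochhammer_Suc * by (subst degree_mult_eq) auto
    moreover have "Polynomial.lead_coeff (pochhammer [:b, 1:] (Suc i)) = 1"
    proof -
      have "Polynomial.lead_coeff [:b + of_nat i, 1:] = 1" by simp
      thus ?thesis using conjunct2[OF Suc] by (simp only: pochhammer_Suc * lead_coeff_mult mult_1_right)
    qed
    ultimately show ?case by simp
  qed simp
  thus "Polynomial.degree (pochhammer [:b, 1:] i) = i" "Polynomial.lead_coeff (pochhammer [:b, 1:] i) = 1" by auto
  show "poly (pochhammer [:b, 1:] i) x = pochhammer (b + x) i"
    by (induction i) (simp_all add: pochhammer_Suc algebra_simps)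
qed

lemma fps_to_fls_sum: "fps_to_fls (sum f A) = (\<Sum>x\<in>A. fps_to_fls (f x))"
  by (induction A rule: infinite_finite_induct) auto

text \<open>The product of all denominators clears the equation. \<open>A\<close> collects the
  coefficients of numerators and denominators, so that any number field containing \<open>A\<close>
  contains those of the cleared equation.\<close>

lemma D_finite_polynomial_coefficients:
  assumes "D_finite F"
  obtains A r P where "finite A" "\<And>\<alpha>. \<alpha> \<in> A \<Longrightarrow> algebraic \<alpha>" "\<exists>i\<le>r. P i \<noteq> 0"
    "(\<Sum>i\<le>r. fps_of_poly (P i) * (fps_deriv ^^ i) F) = 0"
    "\<And>S i j. number_field S \<Longrightarrow> A \<subseteq> S \<Longrightarrow> i \<le> r \<Longrightarrow> Polynomial.coeff (P i) j \<in> S"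
proof -
  define fl where "fl = (\<lambda>p :: complex poly. fps_to_fls (fps_of_poly p))"
  obtain r c where c: "\<forall>i\<le>r. c i \<in> algebraic_ratfuns" "\<exists>i\<le>r. c i \<noteq> 0"
    "(\<Sum>i\<le>r. c i * (fls_deriv ^^ i) (fps_to_fls F)) = 0"
    using assms unfolding D_finite_def by blast
  have "\<exists>p q. c i = fl p / fl q \<and> (\<forall>j. algebraic (Polynomial.coeff p j)) \<and>
      (\<forall>j. algebraic (Polynomial.coeff q j)) \<and> q \<noteq> 0" if "i \<le> r" for i
    using c(1) that unfolding algebraic_ratfuns_def fl_def by blast
  then obtain p q where pq: "\<And>i. i \<le> r \<Longrightarrow> c i = fl (p i) / fl (q i) \<and> (\<forall>j. algebraic (Polynomial.coeff (p i) j)) \<and>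
      (\<forall>j. algebraic (Polynomial.coeff (q i) j)) \<and> q i \<noteq> 0"
    by metis
  have fl_mult: "fl (x * y) = fl x * fl y" for x y by (simp add: fl_def fps_of_poly_mult fls_times_fps_to_fls)
  have fl_0: "fl x = 0 \<longleftrightarrow> x = 0" for x by (simp add: fl_def)
  define P where "P = (\<lambda>i. p i * (\<Prod>j\<in>{..r} - {i}. q j))"
  have flP: "fl (P i) = fl (\<Prod>j\<le>r. q j) * c i" if "i \<le> r" for i
  proof -
    have "(\<Prod>j\<le>r. q j) = q i * (\<Prod>j\<in>{..r} - {i}. q j)" using that by (intro prod.remove) auto
    thus ?thesis using pq[OF that] fl_0[of "q i"] by (simp add: P_def fl_mult)
  qed
  have q0: "(\<Prod>j\<le>r. q j) \<noteq> 0" using pq by auto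
  have fd: "(fls_deriv ^^ i) (fps_to_fls F) = fps_to_fls ((fps_deriv ^^ i) F)" for i
    by (induction i) (simp_all add: fls_deriv_fps_to_fls)
  have "fps_to_fls (\<Sum>i\<le>r. fps_of_poly (P i) * (fps_deriv ^^ i) F) = (\<Sum>i\<le>r. fl (P i) * (fls_deriv ^^ i) (fps_to_fls F))"
    by (simp add: fps_to_fls_sum fls_times_fps_to_fls fl_def fd)
  also have "\<dots> = fl (\<Prod>j\<le>r. q j) * (\<Sum>i\<le>r. c i * (fls_deriv ^^ i) (fps_to_fls F))"
    unfolding sum_distrib_left by (intro sum.cong) (auto simp: flP mult_ac)
  finally have "(\<Sum>i\<le>r. fps_of_poly (P i) * (fps_deriv ^^ i) F) = 0" using c(3) by simp
  moreover have "\<exists>i\<le>r. P i \<noteq> 0"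
  proof -
    obtain i where i: "i \<le> r" "c i \<noteq> 0" using c(2) by blast
    have "fl (P i) \<noteq> 0" using flP[OF i(1)] i(2) q0 fl_0 by simp
    thus ?thesis using i(1) fl_0 by blast
  qed
  moreover define A where "A = (\<Union>i\<le>r. (\<lambda>j. Polynomial.coeff (p i) j) ` {..Polynomial.degree (p i)} \<union> (\<lambda>j. Polynomial.coeff (q i) j) ` {..Polynomial.degree (q i)})"
  have "finite A" by (auto simp: A_def)
  moreover have "algebraic \<alpha>" if "\<alpha> \<in> A" for \<alpha> using that pq by (auto simp: A_def)
  moreover have "Polynomial.coeff (P i) j \<in> S" if S: "number_field S" "A \<subseteq> S" and i: "i \<le> r" for S i j
  proof -
    interpret S: number_field S by (rule S(1))
    have pS: "Polynomial.coeff (p i) j \<in> S" "Polynomial.coeff (q i) j \<in> S" if "i \<le> r" for i j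
    proof -
      have "Polynomial.coeff (p i) j \<in> A" if "j \<le> Polynomial.degree (p i)"
        using that \<open>i \<le> r\<close> unfolding A_def by blast
      moreover have "Polynomial.coeff (q i) j \<in> A" if "j \<le> Polynomial.degree (q i)"
        using that \<open>i \<le> r\<close> unfolding A_def by blast
      ultimately show "Polynomial.coeff (p i) j \<in> S" "Polynomial.coeff (q i) j \<in> S"
        using S(2) S.zero_in coeff_eq_0[of "p i" j] coeff_eq_0[of "q i" j] by (metis not_le subsetD)+
    qed
    have "Polynomial.coeff (\<Prod>j\<in>Y. q j) k \<in> S" if "Y \<subseteq> {..r}" for Y k
      using finite_subset[OF that finite_atMost] that
    proof (induction Y arbitrary: k rule: finite_induct)
      case empty
      show ?case by (simp add: Polynomial.coeff_1 S.zero_in S.one_in)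
    next
      case (insert x Y)
      thus ?case by (simp add: Polynomial.coeff_mult) (intro S.sum_in S.mult_in pS, auto)
    qed
    thus ?thesis unfolding P_def Polynomial.coeff_mult by (intro S.sum_in S.mult_in pS i) auto
  qed
  ultimately show ?thesis using that by blast
qed

text \<open>Compares coefficients of order \<open>m + J\<close>: multiplication of the i-th
  derivative by the j-th power of the variable brings in \<open>a (m + J - j + i)\<close>. Since
  \<open>J\<close> bounds the degrees \<open>j\<close>, the shift \<open>sh\<close> is never
  negative and the recurrence holds for every \<open>m\<close>.\<close>

lemma D_finite_recurrence:
  assumes "D_finite (Abs_fps a)"
  obtains A L q where "finite A" "\<And>\<alpha>. \<alpha> \<in> A \<Longrightarrow> algebraic \<alpha>" "q L \<noteq> 0"
    "\<And>m. (\<Sum>l\<le>L. poly (q l) (of_nat m) * a (m + l)) = 0"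
    "\<And>S l m. number_field S \<Longrightarrow> A \<subseteq> S \<Longrightarrow> poly (q l) (of_nat m) \<in> S"
proof -
  obtain A r P where A: "finite A" "\<And>\<alpha>. \<alpha> \<in> A \<Longrightarrow> algebraic \<alpha>" and P: "\<exists>i\<le>r. P i \<noteq> 0"
    "(\<Sum>i\<le>r. fps_of_poly (P i) * (fps_deriv ^^ i) (Abs_fps a)) = 0"
    "\<And>S i j. number_field S \<Longrightarrow> A \<subseteq> S \<Longrightarrow> i \<le> r \<Longrightarrow> Polynomial.coeff (P i) j \<in> S"
    by (rule D_finite_polynomial_coefficients[OF assms]) blast
  define J where "J = Max ((\<lambda>i. Polynomial.degree (P i)) ` {..r})"
  have J: "Polynomial.degree (P i) \<le> J" if "i \<le> r" for i using that by (simp add: J_def)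
  define I where "I = {..r} \<times> {..J}"
  define sh where "sh = (\<lambda>(i, j). J - j + i)"
  define tm where "tm = (\<lambda>(i, j). Polynomial.smult (Polynomial.coeff (P i) j) (pochhammer [:of_nat (Suc (J - j)), 1:] i))"
  define q where "q = (\<lambda>l. \<Sum>x\<in>{x \<in> I. sh x = l}. tm x)"
  have finI: "finite I" by (simp add: I_def)
  have poly_tm: "poly (tm (i, j)) (of_nat m) = Polynomial.coeff (P i) j * pochhammer (of_nat (Suc (m + (J - j)))) i" for i j m
    by (simp add: tm_def pochhammer_linear_poly(3) add_ac)
  have rec: "(\<Sum>l\<le>r + J. poly (q l) (of_nat m) * a (m + l)) = 0" for m
  proof -
    have "(\<Sum>l\<le>r + J. poly (q l) (of_nat m) * a (m + l))
      = (\<Sum>l\<le>r + J. \<Sum>x\<in>{x \<in> I. sh x = l}. poly (tm x) (of_nat m) * a (m + sh x))"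
      by (intro sum.cong) (auto simp: q_def poly_sum sum_distrib_right)
    also have "\<dots> = (\<Sum>x\<in>I. poly (tm x) (of_nat m) * a (m + sh x))"
      by (rule sum.group[OF finI]) (auto simp: I_def sh_def)
    also have "\<dots> = (\<Sum>i\<le>r. \<Sum>j\<le>J. poly (tm (i, j)) (of_nat m) * a (m + sh (i, j)))"
      unfolding I_def by (simp add: sum.cartesian_product)
    also have "\<dots> = (\<Sum>i\<le>r. fps_nth (fps_of_poly (P i) * (fps_deriv ^^ i) (Abs_fps a)) (m + J))"
    proof (rule sum.cong)
      fix i assume "i \<in> {..r}"
      hence i: "i \<le> r" by simp
      have "fps_nth (fps_of_poly (P i) * (fps_deriv ^^ i) (Abs_fps a)) (m + J)
          = (\<Sum>j=0..m + J. Polynomial.coeff (P i) j * (pochhammer (of_nat (Suc (m + J - j))) i * a (m + J - j + i)))"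
        by (simp add: fps_mult_nth fps_nth_higher_deriv)
      also have "\<dots> = (\<Sum>j\<le>J. Polynomial.coeff (P i) j * (pochhammer (of_nat (Suc (m + J - j))) i * a (m + J - j + i)))"
        using J[OF i] by (intro sum.mono_neutral_right) (auto simp: coeff_eq_0)
      also have "\<dots> = (\<Sum>j\<le>J. poly (tm (i, j)) (of_nat m) * a (m + sh (i, j)))"
        by (intro sum.cong) (auto simp: poly_tm sh_def mult.assoc Nat.add_diff_assoc add.assoc simp del: of_nat_Suc)
      finally show "(\<Sum>j\<le>J. poly (tm (i, j)) (of_nat m) * a (m + sh (i, j)))
          = fps_nth (fps_of_poly (P i) * (fps_deriv ^^ i) (Abs_fps a)) (m + J)" by simp
    qed simp
    also have "\<dots> = fps_nth (\<Sum>i\<le>r. fps_of_poly (P i) * (fps_deriv ^^ i) (Abs_fps a)) (m + J)"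
      by (simp add: fps_sum_nth)
    also have "\<dots> = 0" by (simp add: P(2))
    finally show ?thesis .
  qed
  have "\<exists>l\<le>r + J. q l \<noteq> 0"
  proof -
    \<comment> \<open>With \<open>i\<close> the top order and \<open>j\<close> the degree of its
      coefficient, only \<open>(i, j)\<close> contributes to the coefficient of degree
      \<open>i\<close> in \<open>q l\<close>: lower orders have smaller degree, higher ones vanish,
      and for equal order the shift fixes \<open>j\<close>. The contribution is the leading
      coefficient of \<open>P i\<close>.\<close>
    define i where "i = Max {i. i \<le> r \<and> P i \<noteq> 0}"
    have fin: "finite {i. i \<le> r \<and> P i \<noteq> 0}" by (rule finite_subset[of _ "{..r}"]) auto
    have i: "i \<le> r" "P i \<noteq> 0" using Max_in[OF fin] P(1) by (auto simp: i_def)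
    have above: "P i' = 0" if "i' \<le> r" "i' > i" for i'
      using Max_ge[OF fin, of i'] that unfolding i_def by (metis (mono_tags, lifting) mem_Collect_eq not_le)
    define j where "j = Polynomial.degree (P i)"
    define l where "l = sh (i, j)"
    have ij: "(i, j) \<in> {x \<in> I. sh x = l}" using i J by (auto simp: I_def l_def j_def)
    have "Polynomial.coeff (q l) i = (\<Sum>x\<in>{x \<in> I. sh x = l}. Polynomial.coeff (tm x) i)"
      by (simp add: q_def Polynomial.coeff_sum)
    also have "\<dots> = (\<Sum>x\<in>{(i, j)}. Polynomial.coeff (tm x) i)"
    proof (rule sum.mono_neutral_right)
      show "finite {x \<in> I. sh x = l}" using finI by simp
      show "{(i, j)} \<subseteq> {x \<in> I. sh x = l}" using ij by simp
      show "\<forall>x\<in>{x \<in> I. sh x = l} - {(i, j)}. Polynomial.coeff (tm x) i = 0"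
      proof
        fix x assume x: "x \<in> {x \<in> I. sh x = l} - {(i, j)}"
        obtain i' j' where eq: "x = (i', j')" by fastforce
        with x have 1: "(i', j') \<in> I" "sh (i', j') = l" "(i', j') \<noteq> (i, j)" by auto
        consider "i' < i" | "i' > i" | "i' = i" by linarith
        thus "Polynomial.coeff (tm x) i = 0"
        proof cases
          assume "i' < i"
          have "Polynomial.degree (tm (i', j')) \<le> Polynomial.degree (pochhammer [:of_nat (Suc (J - j')), 1 :: complex:] i')"
            unfolding tm_def prod.case by (rule degree_smult_le)
          also have "\<dots> = i'" by (rule pochhammer_linear_poly(1))
          also have "i' < i" by fact
          finally show ?thesis unfolding eq by (rule coeff_eq_0)
        next
          assume "i' > i"
          thus ?thesis using above[of i'] 1 by (simp add: eq tm_def I_def)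
        next
          assume "i' = i"
          moreover have "j' \<le> J" "j \<le> J" using 1 ij by (auto simp: I_def)
          ultimately have "j' = j" using 1 by (simp add: sh_def l_def)
          thus ?thesis using 1 \<open>i' = i\<close> by simp
        qed
      qed
    qed
    also have "\<dots> = Polynomial.lead_coeff (P i)"
      using pochhammer_linear_poly(1,2)[of "of_nat (Suc (J - j))" i] by (simp add: tm_def j_def)
    finally have "q l \<noteq> 0" using i(2) by auto
    moreover have "l \<le> r + J" using i by (auto simp: l_def sh_def)
    ultimately show ?thesis by blast
  qed
  \<comment> \<open>Cut off at the last nonzero \<open>q l\<close>, the recurrence can be solved for
    its top term at all large indices.\<close>
  define L where "L = Max {l. l \<le> r + J \<and> q l \<noteq> 0}"
  have fin: "finite {l. l \<le> r + J \<and> q l \<noteq> 0}" by (rule finite_subset[of _ "{..r + J}"]) auto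
  have L: "L \<le> r + J" "q L \<noteq> 0" using Max_in[OF fin] \<open>\<exists>l\<le>r + J. q l \<noteq> 0\<close> by (auto simp: L_def)
  have above: "q l = 0" if "l \<le> r + J" "l > L" for l
    using Max_ge[OF fin, of l] that unfolding L_def by (metis (mono_tags, lifting) mem_Collect_eq not_le)
  show ?thesis
  proof (rule that[of A q L])
    show "finite A" by (rule A(1))
    show "algebraic \<alpha>" if "\<alpha> \<in> A" for \<alpha> using A(2)[OF that] .
    show "q L \<noteq> 0" by (rule L(2))
    show "(\<Sum>l\<le>L. poly (q l) (of_nat m) * a (m + l)) = 0" for m
    proof -
      have "(\<Sum>l\<le>r + J. poly (q l) (of_nat m) * a (m + l)) = (\<Sum>l\<le>L. poly (q l) (of_nat m) * a (m + l))"
        using L(1) by (intro sum.mono_neutral_right) (auto simp: above)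
      thus ?thesis using rec[of m] by simp
    qed
    show "poly (q l) (of_nat m) \<in> S" if S: "number_field S" "A \<subseteq> S" for S l m
    proof -
      interpret S: number_field S by (rule S(1))
      have "poly (tm x) (of_nat m) \<in> S" if x: "x \<in> I" for x
      proof -
        obtain i j where ij: "x = (i, j)" "i \<le> r" using x by (auto simp: I_def)
        have "pochhammer (of_nat (Suc (m + (J - j)))) i \<in> S"
          unfolding pochhammer_of_nat by (rule S.of_nat_in)
        thus ?thesis unfolding ij(1) poly_tm by (intro S.mult_in P(3)[OF S ij(2)])
      qed
      thus ?thesis by (auto simp: q_def poly_sum intro: S.sum_in)
    qed
  qed
qed

theorem theorem1p6:
  fixes a :: "nat \<Rightarrow> complex"
  assumes "\<And>n. algebraic (a n)"
    and "D_finite (Abs_fps a)"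
    and "limsup (\<lambda>n. ereal (weil_height (a n) / ln (real n))) = 0"
  shows "eventually_periodic a"
proof -
  obtain A L q where A: "finite A" "\<And>\<alpha>. \<alpha> \<in> A \<Longrightarrow> algebraic \<alpha>" and lead: "q L \<noteq> 0"
    and rec: "\<And>m. (\<Sum>l\<le>L. poly (q l) (of_nat m) * a (m + l)) = 0"
    and qS: "\<And>S l m. number_field S \<Longrightarrow> A \<subseteq> S \<Longrightarrow> poly (q l) (of_nat m) \<in> S"
    by (rule D_finite_recurrence[OF assms(2)]) blast
  obtain n0 where n0: "\<And>k. k \<ge> n0 \<Longrightarrow> poly (q L) (of_nat k) \<noteq> 0"
    using poly_of_nat_eventually_nonzero[OF lead] by blast
  \<comment> \<open>Terms up to \<open>n0 + L\<close> are put into \<open>S\<close> directly; later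
    ones are obtained by solving the recurrence at \<open>n - L\<close>, beyond \<open>n0\<close>,
    where the leading coefficient is nonzero.\<close>
  obtain S where S: "finite_algebra S" "A \<union> a ` {..n0 + L} \<subseteq> S"
    by (rule finite_algebra_contains[of "A \<union> a ` {..n0 + L}"]) (use A assms(1) in auto)
  interpret S: number_field S by (rule finite_algebra.number_field[OF S(1)])
  have qS': "poly (q l) (of_nat m) \<in> S" for l m
    by (rule qS[OF S.number_field_axioms]) (use S(2) in auto)
  have aS: "a n \<in> S" for n
  proof (induction n rule: less_induct)
    case (less n)
    show ?case
    proof (cases "n \<le> n0 + L")
      case True
      thus ?thesis using S(2) by auto
    next
      case False
      define m where "m = n - L"
      have m: "n = m + L" "m \<ge> n0" using False by (auto simp: m_def)
      have "(\<Sum>l<L. poly (q l) (of_nat m) * a (m + l)) + poly (q L) (of_nat m) * a n = 0"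
        using rec[of m] m(1) by (simp flip: lessThan_Suc_atMost)
      hence "a n = - (\<Sum>l<L. poly (q l) (of_nat m) * a (m + l)) / poly (q L) (of_nat m)"
        using n0[OF m(2)] by (simp add: field_simps eq_neg_iff_add_eq_0 add.commute)
      also have "\<dots> \<in> S"
        using less.IH m(1) by (intro S.divide_in S.minus_in S.sum_in S.mult_in qS') auto
      finally show ?thesis .
    qed
  qed
  obtain C \<kappa> :: real where C: "C > 0" "\<kappa> > 0" and fin: "\<And>H. H \<ge> 0 \<Longrightarrow> finite {x \<in> S. weil_height x \<le> H}"
    and count: "\<And>H. H \<ge> 0 \<Longrightarrow> real (card {x \<in> S. weil_height x \<le> H}) \<le> C * exp (\<kappa> * H)"
    by (rule northcott_bound[OF S.number_field_axioms]) blast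
  define D where "D = 4 * Suc L"
  \<comment> \<open>With this choice \<open>exp (\<kappa> * \<epsilon> * ln (3 * N))\<close> is the
    D-th root of \<open>3 * N\<close>, hence at most \<open>3 * t\<close> when
    \<open>N = t ^ D\<close>.\<close>
  define \<epsilon> where "\<epsilon> = 1 / (\<kappa> * real D)"
  have D: "real D > 0" "real D \<ge> 1" by (auto simp: D_def)
  have \<epsilon>: "\<epsilon> > 0" using C(2) D by (simp add: \<epsilon>_def)
  have "\<forall>\<^sub>F n in sequentially. ereal (weil_height (a n) / ln (real n)) < ereal \<epsilon>"
    by (rule Limsup_lessD) (use assms(3) \<epsilon> in simp)
  hence "\<forall>\<^sub>F n in sequentially. weil_height (a n) \<le> \<epsilon> * ln (real n)"
    using eventually_ge_at_top[of 2]
  proof eventually_elim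
    case (elim n)
    hence "ln (real n) > 0" by simp
    thus ?case using elim by (simp add: pos_divide_less_eq less_imp_le)
  qed
  then obtain n1 where n1: "\<And>n. n \<ge> n1 \<Longrightarrow> weil_height (a n) \<le> \<epsilon> * ln (real n)"
    by (auto simp: eventually_at_top_linorder)
  have "\<forall>\<^sub>F t in at_top. card (a ` {t ^ D..3 * t ^ D}) \<le> nat \<lceil>3 * C\<rceil> * t"
    using eventually_ge_at_top[of "Suc n1"]
  proof eventually_elim
    case (elim t)
    hence t: "t \<ge> 1" "t \<ge> n1" by auto
    define N where "N = t ^ D"
    have N: "N \<ge> t" unfolding N_def by (rule self_le_power[OF t(1)]) (simp add: D_def)
    \<comment> \<open>The logarithm at the right end of the interval bounds the heights of all terms
      in it.\<close>
    define H where "H = \<epsilon> * ln (real (3 * N))"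
    have H: "H \<ge> 0" using \<epsilon> N t by (simp add: H_def)
    have "a ` {N..3 * N} \<subseteq> {x \<in> S. weil_height x \<le> H}"
    proof safe
      fix n assume n: "n \<in> {N..3 * N}"
      have "weil_height (a n) \<le> \<epsilon> * ln (real n)" using n N t by (intro n1) auto
      also have "\<dots> \<le> H"
        unfolding H_def using n N t \<epsilon> by (intro mult_left_mono) auto
      finally show "weil_height (a n) \<le> H" .
    qed (rule aS)
    hence "card (a ` {N..3 * N}) \<le> card {x \<in> S. weil_height x \<le> H}" by (rule card_mono[OF fin[OF H]])
    hence "real (card (a ` {N..3 * N})) \<le> C * exp (\<kappa> * H)" using count[OF H] by linarith
    also have "\<kappa> * H = ln (real (3 * N)) / real D" using C(2) by (simp add: H_def \<epsilon>_def)
    also have "\<dots> = ln 3 / real D + ln (real t)"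
      using t(1) D by (simp add: N_def ln_mult ln_realpow add_divide_distrib)
    also have "\<dots> \<le> ln 3 + ln (real t)"
      using D(2) by (simp add: divide_le_eq mult_le_cancel_left1)
    also have "\<dots> = ln (3 * real t)" using t(1) by (simp add: ln_mult)
    finally have "real (card (a ` {N..3 * N})) \<le> C * (3 * real t)" using C(1) t(1) by simp
    also have "\<dots> \<le> real (nat \<lceil>3 * C\<rceil> * t)"
    proof -
      have "3 * C \<le> real (nat \<lceil>3 * C\<rceil>)" by (rule real_nat_ceiling_ge)
      thus ?thesis using mult_right_mono[of "3 * C" "real (nat \<lceil>3 * C\<rceil>)" "real t"] by (simp add: mult_ac)
    qed
    finally show ?case unfolding N_def by (simp only: of_nat_le_iff)
  qed
  thus ?thesis unfolding D_def by (intro eventually_periodic_if_slow_value_growth[OF rec lead])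
qed

end
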